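(* Let $\varphi$ be an $H$-flow on $M$ with $h_{\mathrm{Gur}}^\infty(\varphi)<h_{\mathrm{Gur}}(\varphi)$. Let $K_0\subset M$ be a compact set with nonempty interior such that, for some $\epsilon>0$, $$\lim_{L\to+\infty}\frac{\#\mathcal P_{K_0}^{\epsilon}(L,L+5\tau_{K_0})}{\#\mathcal P_{K_0}(L,L+5\tau_{K_0})}=0.$$ Let $L_n\to+\infty$ be a sequence such that the sequence of measures $(m_{K_0,L_n})_n$ converges in the vague topology to a nonzero measure $m_\infty$. Let $K$ be a compact subset of $M$ whose interior $\mathring K$ contains $K_0$ and such that $m_\infty(\mathring K)\ge\frac34m_\infty(M)$. There exists $\epsilon_1>0$ such that, for all $0<\eta<\delta<\frac{\epsilon_1}4$, there exist constants $S_2>0$ and $D_2>0$ such that for every $T>5\tau_{K_0}$ there exists $k_0\in\mathbb N$ such that for every integer $n\ge k_0$, for all points $x_0,y_0,x_1,y_1$ in $K$ and every $S\ge S_2$, we have $$L_n\,\#\mathcal P_{K_0}(L_n,L_n+5\tau_{K_0})\le D_2\,\mathcal N_{\mathcal C}(x_0,y_0,\eta,T+S,T+S+5\tau_{K_0},\delta)\times\mathcal N_{\mathcal C}(x_1,y_1,\eta,L_n-T+S,L_n-T+S+5\tau_{K_0},\delta).$$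
   Context: **Setting.** $(M,g)$ is a complete connected (not necessarily compact) Riemannian manifold with associated distance $d$; $B(x,r)$ is the open ball. **$H$-flow.** An $H$-flow is a $C^1$ flow $(\varphi_t)_{t\in\mathbb R}$ on a complete Riemannian manifold such that: (1) there is a constant $lip(\varphi)$ with $d(\varphi_\tau(x),\varphi_\tau(y))\le lip(\varphi)\,d(x,y)$ for all $x,y\in M$, $\tau\in[-1,1]$; (2) there exist $0<a\le b$ such that for every $x\in M$ there is $\rho>0$ with $a|t|\le d(x,\varphi_t(x))\le b|t|$ for all $t\in[-\rho,\rho]$; (3) (transitivity) for all nonempty open $U,V\subset M$ and every $T>0$ there is $t\ge T$ with $\varphi_t(U)\cap V\ne\emptyset$; (4) (finite exact shadowing) for every compact $K\subset M$, $\delta>0$ and integer $N\ge1$ there is $\eta>0$ such that, for all $x_1,\dots,x_N\in K$ and $t_1,\dots,t_N\ge 0$ with $d(\varphi_{t_i}(x_i),x_{i+1})<\eta$ for $1\le i\le N-1$, there is $y\in M$ with $d(\varphi_{s+\sum_{j=1}^{i-1}t_j}(y),\varphi_s(x_i))<\delta$ for all $1\le i\le N$ and $0\le s\le t_i$; (5) (closing lemma) for every $\epsilon>0$ and $x\in M$ there exist $\delta>0$ and $T_{\min}>0$ such that for every $y\in B(x,\epsilon)$ and $t\ge T_{\min}$ with $d(\varphi_t(y),y)\le\delta$ there exist $z\in B(y,\epsilon)$ and $\tau\in[t-\epsilon,t+\epsilon]$ with $\varphi_\tau(z)=z$ and $d(\varphi_s(z),\varphi_s(y))\le\epsilon$ for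 all $0\le s\le t$; (6) (expansivity) for every $\nu>0$ there is $\epsilon>0$ such that, for all $x,y\in M$, if there is a continuous map $s:\mathbb R\to\mathbb R$ with $s(0)=0$ and $d(\varphi_t(x),\varphi_{s(t)}(y))\le\epsilon$ for all $t\in\mathbb R$, then $y=\varphi_\tau(x)$ for some $\tau\in[-\nu,\nu]$. **Periodic orbits and Gurevic entropies.** A periodic orbit $\gamma$ is a pair $(\{\varphi_t(x):t\in\mathbb R\},T)$ with $T>0$, $\varphi_T(x)=x$; its period is $\ell(\gamma)=T$ (so multiples of an orbit count as distinct periodic orbits). $\ell(\gamma\cap A)$ is the Lebesgue measure of $\{t\in[0,\ell(\gamma)]:\varphi_t(x)\in A\}$. For $K$ compact, $\mathcal P_K(T_0,T_1)$ is the set of periodic orbits $\gamma$ with $\ell(\gamma)\in[T_0,T_1]$ and $\gamma\cap K\neq\emptyset$; $\mathcal P_K^\alpha(L,L+\sigma)=\{\gamma\in\mathcal P_K(L,L+\sigma):\ell(\gamma\cap K)<\alpha\,\ell(\gamma)\}$. $\tau_K$ is the minimal period of a periodic orbit (possibly multiply covered) with period $\ge1$ intersecting $K$. $h_{\mathrm{Gur}}(\varphi)=\limsup_{L\to\infty}\frac1L\log\#\mathcal P_K(L,L+\sigma)$ for any compact $K$ with nonempty interior and any $\sigma>0$ (independent of $K,\sigma$). $h_{\mathrm{Gur}}^{K,\alpha}(\varphi)=\limsup_{L\to\infty}\frac1L\log\#\mathcal P_K^\alpha(L,L+\sigma)$ (independent of $\sigma>0$), $h_{\mathrm{Gur}}^\infty(\varphi)=\inf_K\lim_{\alpha\to0}h_{\mathrm{Gur}}^{K,\alpha}(\varphi)$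 over compact $K$ with nonempty interior. **Measures.** For a periodic orbit $\gamma$, $\mu_\gamma$ is the invariant probability measure equidistributed (with respect to time) on $\gamma$, and $m_{K_0,L}=\frac{1}{\#\mathcal P_{K_0}(L,L+5\tau_{K_0})}\sum_{\gamma\in\mathcal P_{K_0}(L,L+5\tau_{K_0})}\mu_\gamma$. Vague topology: convergence of integrals of continuous compactly supported functions. **Chords.** $B(z,\delta,T)=\{y:d(\varphi_t(z),\varphi_t(y))<\delta\ \forall t\in[0,T]\}$ is the dynamical ball. For $\eta>0$, $0<T^-<T^+$, $\mathcal C(x,y,\eta,T^-,T^+)=\{z\in B(x,\eta):\varphi_{[T^-,T^+]}(z)\cap B(y,\eta)\ne\emptyset\}$. A set $E$ is $(\delta,T)$-separating if for all distinct $p,q\in E$ there is $t\in[0,T]$ with $d(\varphi_t(p),\varphi_t(q))\ge\delta$. $\mathcal N_{\mathcal C}(x,y,\eta,T^-,T^+,\delta)$ is the maximal cardinality of a $(\delta,T^-)$-separating set $E\subset\mathcal C(x,y,\eta,T^-,T^+)$ such that $\mathcal C(x,y,\eta,T^-,T^+)\subset\bigcup_{z\in E}B(z,\delta,T^-)$.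
   Formalization: The entropies use log 0 = 0 instead of −∞, so the entropy gap hypothesis excludes flows with h_Gur = 0; these are exactly single closed orbits, such as the rotation flow of a circle, where the claimed inequality fails. *)

theory Defs
  imports "HOL-Analysis.Analysis"
begin

section \<open>Riemannian manifolds\<close>

text \<open>
  A manifold is a metric type \<open>'m\<close> with an atlas of charts into a Euclidean space \<open>'e\<close>; a chart is
  a pair of its domain and its coordinate map. A Riemannian metric is given by its coordinate
  expressions: \<open>G c p u v\<close> is the inner product at the point \<open>p\<close> of the two tangent vectors whose
  coordinates in the chart \<open>c\<close> are \<open>u\<close> and \<open>v\<close>.
\<close>

type_synonym ('m, 'e) chart = "'m set \<times> ('m \<Rightarrow> 'e)"

type_synonym ('m, 'e) metric_tensor = "('m, 'e) chart \<Rightarrow> 'm \<Rightarrow> 'e \<Rightarrow> 'e \<Rightarrow> real"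

text \<open>\<open>Ck_on k f S\<close>: the map \<open>f\<close> is of class \<open>C^k\<close> on \<open>S\<close>; only meant for open \<open>S\<close>.\<close>

primrec Ck_on :: "nat \<Rightarrow> ('a::euclidean_space \<Rightarrow> 'b::real_normed_vector) \<Rightarrow> 'a set \<Rightarrow> bool" where
  "Ck_on 0 f S = continuous_on S f"
| "Ck_on (Suc k) f S =
    (\<exists>f'. (\<forall>x\<in>S. (f has_derivative f' x) (at x)) \<and> (\<forall>v. Ck_on k (\<lambda>x. f' x v) S))"

definition smooth_atlas :: "('m::topological_space, 'e::euclidean_space) chart set \<Rightarrow> bool" where
  "smooth_atlas A \<longleftrightarrow>
     (\<Union>(U, \<kappa>)\<in>A. U) = UNIV \<and>
     (\<forall>(U, \<kappa>)\<in>A. open U \<and> open (\<kappa> ` U) \<and> homeomorphism U (\<kappa> ` U) \<kappa> (inv_into U \<kappa>)) \<and>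
     (\<forall>(U, \<kappa>)\<in>A. \<forall>(V, \<psi>)\<in>A. \<forall>k. Ck_on k (\<psi> \<circ> inv_into U \<kappa>) (\<kappa> ` (U \<inter> V)))"

definition riemannian_metric ::
  "('m::topological_space, 'e::euclidean_space) chart set \<Rightarrow> ('m, 'e) metric_tensor \<Rightarrow> bool" where
  "riemannian_metric A G \<longleftrightarrow>
     (\<forall>(U, \<kappa>)\<in>A. \<forall>p\<in>U. bilinear (G (U, \<kappa>) p) \<and>
        (\<forall>u v. G (U, \<kappa>) p u v = G (U, \<kappa>) p v u) \<and>
        (\<forall>u. u \<noteq> 0 \<longrightarrow> G (U, \<kappa>) p u u > 0)) \<and>
     (\<forall>(U, \<kappa>)\<in>A. \<forall>u v k. Ck_on k (\<lambda>z. G (U, \<kappa>) (inv_into U \<kappa> z) u v) (\<kappa> ` U)) \<and>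
     (\<forall>(U, \<kappa>)\<in>A. \<forall>(V, \<psi>)\<in>A. \<forall>p\<in>U \<inter> V. \<forall>u v.
        (let D = frechet_derivative (\<psi> \<circ> inv_into U \<kappa>) (at (\<kappa> p))
         in G (U, \<kappa>) p u v = G (V, \<psi>) p (D u) (D v)))"

definition C1_curve_on ::
  "('m::topological_space, 'e::euclidean_space) chart set \<Rightarrow> (real \<Rightarrow> 'm) \<Rightarrow> real \<Rightarrow> real \<Rightarrow> bool" where
  "C1_curve_on A c a b \<longleftrightarrow> continuous_on {a..b} c \<and>
     (\<forall>(U, \<kappa>)\<in>A. \<exists>v. continuous_on ({a..b} \<inter> c -` U) v \<and>
        (\<forall>t\<in>{a..b} \<inter> c -` U. ((\<kappa> \<circ> c) has_vector_derivative v t) (at t within {a..b})))"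

definition piecewise_C1_path ::
  "('m::topological_space, 'e::euclidean_space) chart set \<Rightarrow> (real \<Rightarrow> 'm) \<Rightarrow> bool" where
  "piecewise_C1_path A c \<longleftrightarrow> path c \<and>
     (\<exists>S. finite S \<and>
        (\<forall>a b. 0 \<le> a \<and> a < b \<and> b \<le> 1 \<and> {a<..<b} \<inter> S = {} \<longrightarrow> C1_curve_on A c a b))"

text \<open>The speed does not depend on the chart that is chosen, by the transformation rule of the metric.\<close>

definition riemannian_speed ::
  "('m::topological_space, 'e::euclidean_space) chart set \<Rightarrow> ('m, 'e) metric_tensor \<Rightarrow>
    (real \<Rightarrow> 'm) \<Rightarrow> real \<Rightarrow> real" where
  "riemannian_speed A G c t =
     (let ch = (SOME ch. ch \<in> A \<and> c t \<in> fst ch);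
          v = vector_derivative (snd ch \<circ> c) (at t)
      in sqrt (G ch (c t) v v))"

definition riemannian_length ::
  "('m::topological_space, 'e::euclidean_space) chart set \<Rightarrow> ('m, 'e) metric_tensor \<Rightarrow>
    (real \<Rightarrow> 'm) \<Rightarrow> real" where
  "riemannian_length A G c = integral {0..1} (riemannian_speed A G c)"

text \<open>
  A connected Riemannian manifold whose Riemannian distance is the distance of the metric type;
  completeness is expressed by the class \<open>complete_space\<close>.
\<close>

definition complete_riemannian_manifold ::
  "('m::complete_space, 'e::euclidean_space) chart set \<Rightarrow> ('m, 'e) metric_tensor \<Rightarrow> bool" where
  "complete_riemannian_manifold A G \<longleftrightarrow>
     smooth_atlas A \<and> riemannian_metric A G \<and> connected (UNIV :: 'm set) \<and>
     (\<forall>x y. dist x y =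
        Inf {riemannian_length A G c | c.
               piecewise_C1_path A c \<and> pathstart c = x \<and> pathfinish c = y})"


section \<open>H-flows\<close>

text \<open>\<open>\<phi> t x\<close> is the image of \<open>x\<close> under the time-\<open>t\<close> map; the flow is \<open>C^1\<close> jointly in time and space.\<close>

definition C1_flow ::
  "('m::topological_space, 'e::euclidean_space) chart set \<Rightarrow> (real \<Rightarrow> 'm \<Rightarrow> 'm) \<Rightarrow> bool" where
  "C1_flow A \<phi> \<longleftrightarrow>
     (\<forall>x. \<phi> 0 x = x) \<and>
     (\<forall>s t x. \<phi> (s + t) x = \<phi> s (\<phi> t x)) \<and>
     continuous_on UNIV (\<lambda>(t, x). \<phi> t x) \<and>
     (\<forall>(U, \<kappa>)\<in>A. \<forall>(V, \<psi>)\<in>A.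
        Ck_on 1 (\<lambda>(t, z). \<psi> (\<phi> t (inv_into U \<kappa> z)))
          {(t, z). z \<in> \<kappa> ` U \<and> \<phi> t (inv_into U \<kappa> z) \<in> V})"

definition lipschitz_flow :: "(real \<Rightarrow> 'm::metric_space \<Rightarrow> 'm) \<Rightarrow> bool" where
  "lipschitz_flow \<phi> \<longleftrightarrow>
     (\<exists>C. \<forall>x y. \<forall>\<tau>\<in>{-1..1}. dist (\<phi> \<tau> x) (\<phi> \<tau> y) \<le> C * dist x y)"

definition bounded_speed_flow :: "(real \<Rightarrow> 'm::metric_space \<Rightarrow> 'm) \<Rightarrow> bool" where
  "bounded_speed_flow \<phi> \<longleftrightarrow>
     (\<exists>a b. 0 < a \<and> a \<le> b \<and>
        (\<forall>x. \<exists>\<rho>>0. \<forall>t\<in>{-\<rho>..\<rho>}. a * \<bar>t\<bar> \<le> dist x (\<phi> t x) \<and> dist x (\<phi> t x) \<le> b * \<bar>t\<bar>))"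

definition transitive_flow :: "(real \<Rightarrow> 'm::metric_space \<Rightarrow> 'm) \<Rightarrow> bool" where
  "transitive_flow \<phi> \<longleftrightarrow>
     (\<forall>U V. open U \<and> U \<noteq> {} \<and> open V \<and> V \<noteq> {} \<longrightarrow>
        (\<forall>T>0. \<exists>t\<ge>T. \<phi> t ` U \<inter> V \<noteq> {}))"

definition finite_exact_shadowing :: "(real \<Rightarrow> 'm::metric_space \<Rightarrow> 'm) \<Rightarrow> bool" where
  "finite_exact_shadowing \<phi> \<longleftrightarrow>
     (\<forall>K \<delta> (N::nat). compact K \<and> \<delta> > 0 \<and> N \<ge> 1 \<longrightarrow>
        (\<exists>\<eta>>0. \<forall>(x :: nat \<Rightarrow> 'm) (t :: nat \<Rightarrow> real).
           (\<forall>i\<in>{1..N}. x i \<in> K \<and> t i \<ge> 0) \<and>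
           (\<forall>i. 1 \<le> i \<and> i < N \<longrightarrow> dist (\<phi> (t i) (x i)) (x (i + 1)) < \<eta>) \<longrightarrow>
           (\<exists>y. \<forall>i\<in>{1..N}. \<forall>s\<in>{0..t i}.
              dist (\<phi> (s + (\<Sum>j\<in>{1..<i}. t j)) y) (\<phi> s (x i)) < \<delta>)))"

definition closing_lemma :: "(real \<Rightarrow> 'm::metric_space \<Rightarrow> 'm) \<Rightarrow> bool" where
  "closing_lemma \<phi> \<longleftrightarrow>
     (\<forall>\<epsilon>>0. \<forall>x. \<exists>\<delta>>0. \<exists>Tmin>0. \<forall>y\<in>ball x \<epsilon>. \<forall>t\<ge>Tmin. dist (\<phi> t y) y \<le> \<delta> \<longrightarrow>
        (\<exists>z\<in>ball y \<epsilon>. \<exists>\<tau>\<in>{t - \<epsilon>..t + \<epsilon>}. \<phi> \<tau> z = z \<and>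
           (\<forall>s\<in>{0..t}. dist (\<phi> s z) (\<phi> s y) \<le> \<epsilon>)))"

definition expansive_flow :: "(real \<Rightarrow> 'm::metric_space \<Rightarrow> 'm) \<Rightarrow> bool" where
  "expansive_flow \<phi> \<longleftrightarrow>
     (\<forall>\<nu>>0. \<exists>\<epsilon>>0. \<forall>x y.
        (\<exists>s :: real \<Rightarrow> real. continuous_on UNIV s \<and> s 0 = 0 \<and>
           (\<forall>t. dist (\<phi> t x) (\<phi> (s t) y) \<le> \<epsilon>)) \<longrightarrow>
        (\<exists>\<tau>\<in>{-\<nu>..\<nu>}. y = \<phi> \<tau> x))"

definition H_flow ::
  "('m::complete_space, 'e::euclidean_space) chart set \<Rightarrow> (real \<Rightarrow> 'm \<Rightarrow> 'm) \<Rightarrow> bool" where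
  "H_flow A \<phi> \<longleftrightarrow>
     C1_flow A \<phi> \<and> lipschitz_flow \<phi> \<and> bounded_speed_flow \<phi> \<and> transitive_flow \<phi> \<and>
     finite_exact_shadowing \<phi> \<and> closing_lemma \<phi> \<and> expansive_flow \<phi>"


section \<open>Periodic orbits and Gurevic entropies\<close>

text \<open>A periodic orbit is a pair of a point set and a (not necessarily minimal) period.\<close>

definition periodic_orbits :: "(real \<Rightarrow> 'm \<Rightarrow> 'm) \<Rightarrow> ('m set \<times> real) set" where
  "periodic_orbits \<phi> = {(range (\<lambda>t. \<phi> t x), T) | x T. T > 0 \<and> \<phi> T x = x}"

abbreviation period :: "'m set \<times> real \<Rightarrow> real" where
  "period \<gamma> \<equiv> snd \<gamma>"

text \<open>The next quantity and the measure \<open>orbit_measure\<close> below do not depend on the base point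
  that is chosen on the orbit.\<close>

definition orbit_point :: "'m set \<times> real \<Rightarrow> 'm" where
  "orbit_point \<gamma> = (SOME x. x \<in> fst \<gamma>)"

definition length_in :: "(real \<Rightarrow> 'm \<Rightarrow> 'm) \<Rightarrow> 'm set \<times> real \<Rightarrow> 'm set \<Rightarrow> real" where
  "length_in \<phi> \<gamma> B = measure lebesgue {t \<in> {0..period \<gamma>}. \<phi> t (orbit_point \<gamma>) \<in> B}"

definition orbits_through ::
  "(real \<Rightarrow> 'm \<Rightarrow> 'm) \<Rightarrow> 'm set \<Rightarrow> real \<Rightarrow> real \<Rightarrow> ('m set \<times> real) set" where
  "orbits_through \<phi> K T\<^sub>0 T\<^sub>1 =
     {\<gamma> \<in> periodic_orbits \<phi>. period \<gamma> \<in> {T\<^sub>0..T\<^sub>1} \<and> fst \<gamma> \<inter> K \<noteq> {}}"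

definition orbits_rarely_in ::
  "(real \<Rightarrow> 'm \<Rightarrow> 'm) \<Rightarrow> 'm set \<Rightarrow> real \<Rightarrow> real \<Rightarrow> real \<Rightarrow> ('m set \<times> real) set" where
  "orbits_rarely_in \<phi> K \<alpha> T\<^sub>0 T\<^sub>1 =
     {\<gamma> \<in> orbits_through \<phi> K T\<^sub>0 T\<^sub>1. length_in \<phi> \<gamma> K < \<alpha> * period \<gamma>}"

definition min_period :: "(real \<Rightarrow> 'm \<Rightarrow> 'm) \<Rightarrow> 'm set \<Rightarrow> real" where
  "min_period \<phi> K = Inf {period \<gamma> | \<gamma>. \<gamma> \<in> periodic_orbits \<phi> \<and> period \<gamma> \<ge> 1 \<and> fst \<gamma> \<inter> K \<noteq> {}}"

text \<open>
  As \<open>ln 0 = 0\<close>, empty sets of orbits are counted as singletons and every entropy is nonnegative. The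
  comparison of the entropy at infinity with the Gurevic entropy is the same for the convention
  \<open>ln 0 = - \<infinity>\<close>, except when the Gurevic entropy is zero, as for the rotation flow of a circle.
\<close>

definition growth_rate :: "(real \<Rightarrow> ('m set \<times> real) set) \<Rightarrow> ereal" where
  "growth_rate P = Limsup at_top (\<lambda>L. ereal (ln (real (card (P L))) / L))"

text \<open>For an H-flow the upper limits below do not depend on \<open>K\<close> and \<open>\<sigma>\<close>, respectively on \<open>\<sigma>\<close>;
  the definite description denotes the common value.\<close>

definition gurevic_entropy :: "(real \<Rightarrow> 'm::topological_space \<Rightarrow> 'm) \<Rightarrow> ereal" where
  "gurevic_entropy \<phi> =
     (THE h. \<forall>K \<sigma>. compact K \<and> interior K \<noteq> {} \<and> \<sigma> > 0 \<longrightarrow>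
        growth_rate (\<lambda>L. orbits_through \<phi> K L (L + \<sigma>)) = h)"

definition gurevic_entropy_outside ::
  "(real \<Rightarrow> 'm \<Rightarrow> 'm) \<Rightarrow> 'm set \<Rightarrow> real \<Rightarrow> ereal" where
  "gurevic_entropy_outside \<phi> K \<alpha> =
     (THE h. \<forall>\<sigma>>0. growth_rate (\<lambda>L. orbits_rarely_in \<phi> K \<alpha> L (L + \<sigma>)) = h)"

definition gurevic_entropy_at_infinity :: "(real \<Rightarrow> 'm::topological_space \<Rightarrow> 'm) \<Rightarrow> ereal" where
  "gurevic_entropy_at_infinity \<phi> =
     (INF K\<in>{K. compact K \<and> interior K \<noteq> {}}.
        Lim (at_right 0) (\<lambda>\<alpha>. gurevic_entropy_outside \<phi> K \<alpha>))"


section \<open>Measures\<close>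

definition orbit_measure ::
  "(real \<Rightarrow> 'm::topological_space \<Rightarrow> 'm) \<Rightarrow> 'm set \<times> real \<Rightarrow> 'm measure" where
  "orbit_measure \<phi> \<gamma> =
     distr (uniform_measure lborel {0..period \<gamma>}) borel (\<lambda>t. \<phi> t (orbit_point \<gamma>))"

definition mean_orbit_measure ::
  "(real \<Rightarrow> 'm::topological_space \<Rightarrow> 'm) \<Rightarrow> 'm set \<Rightarrow> real \<Rightarrow> 'm measure" where
  "mean_orbit_measure \<phi> K L =
     (let P = orbits_through \<phi> K L (L + 5 * min_period \<phi> K)
      in measure_of UNIV (sets borel)
           (\<lambda>B. (\<Sum>\<gamma>\<in>P. emeasure (orbit_measure \<phi> \<gamma>) B) / of_nat (card P)))"

definition locally_finite_borel :: "'m::topological_space measure \<Rightarrow> bool" where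
  "locally_finite_borel m \<longleftrightarrow>
     sets m = sets borel \<and> (\<forall>C. compact C \<longrightarrow> emeasure m C < \<infinity>)"

definition vaguely_converges ::
  "(nat \<Rightarrow> 'm::topological_space measure) \<Rightarrow> 'm measure \<Rightarrow> bool" where
  "vaguely_converges m m' \<longleftrightarrow>
     (\<forall>f :: 'm \<Rightarrow> real. continuous_on UNIV f \<and> compact (closure {x. f x \<noteq> 0}) \<longrightarrow>
        (\<lambda>n. integral\<^sup>L (m n) f) \<longlonglongrightarrow> integral\<^sup>L m' f)"


section \<open>Chords\<close>

definition dynamical_ball ::
  "(real \<Rightarrow> 'm::metric_space \<Rightarrow> 'm) \<Rightarrow> 'm \<Rightarrow> real \<Rightarrow> real \<Rightarrow> 'm set" where
  "dynamical_ball \<phi> z \<delta> T = {y. \<forall>t\<in>{0..T}. dist (\<phi> t z) (\<phi> t y) < \<delta>}"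

definition chords ::
  "(real \<Rightarrow> 'm::metric_space \<Rightarrow> 'm) \<Rightarrow> 'm \<Rightarrow> 'm \<Rightarrow> real \<Rightarrow> real \<Rightarrow> real \<Rightarrow> 'm set" where
  "chords \<phi> x y \<eta> T\<^sub>0 T\<^sub>1 =
     {z \<in> ball x \<eta>. (\<lambda>t. \<phi> t z) ` {T\<^sub>0..T\<^sub>1} \<inter> ball y \<eta> \<noteq> {}}"

definition separating_set ::
  "(real \<Rightarrow> 'm::metric_space \<Rightarrow> 'm) \<Rightarrow> real \<Rightarrow> real \<Rightarrow> 'm set \<Rightarrow> bool" where
  "separating_set \<phi> \<delta> T E \<longleftrightarrow>
     (\<forall>p\<in>E. \<forall>q\<in>E. p \<noteq> q \<longrightarrow> (\<exists>t\<in>{0..T}. dist (\<phi> t p) (\<phi> t q) \<ge> \<delta>))"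

text \<open>On a complete manifold balls are relatively compact, hence the sets \<open>E\<close> below are finite with
  bounded cardinality and the supremum is a maximum.\<close>

definition chord_number ::
  "(real \<Rightarrow> 'm::metric_space \<Rightarrow> 'm) \<Rightarrow> 'm \<Rightarrow> 'm \<Rightarrow> real \<Rightarrow> real \<Rightarrow> real \<Rightarrow> real \<Rightarrow> nat" where
  "chord_number \<phi> x y \<eta> T\<^sub>0 T\<^sub>1 \<delta> =
     Sup {card E | E. E \<subseteq> chords \<phi> x y \<eta> T\<^sub>0 T\<^sub>1 \<and> separating_set \<phi> \<delta> T\<^sub>0 E \<and>
                      chords \<phi> x y \<eta> T\<^sub>0 T\<^sub>1 \<subseteq> (\<Union>z\<in>E. dynamical_ball \<phi> z \<delta> T\<^sub>0)}"

end

theory Submission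
  imports Defs "HOL-Probability.Probability_Mass_Function"
begin

text \<open>
  Let \<open>W = 5 \<tau>\<close> be the length of the window of periods. The limit measure gives the interior of \<open>K\<close>
  at least three quarters of its mass, and periodic orbit measures are invariant. So for large \<open>n\<close> and an
  average periodic orbit, a proportion of time that is bounded below independently of \<open>T\<close> consists
  of times \<open>t\<close> at which the orbit is in \<open>K\<close> both at time \<open>t\<close> and at time \<open>t + T\<close>
  (\<open>frequent_returns\<close>). Such a time cuts the orbit into two segments with end points in \<open>K\<close>, of
  lengths \<open>T\<close> and about \<open>L n - T\<close>. By transitivity, compactness and shadowing, orbit segments with
  end points in a compact set can be glued with bounded connecting times (\<open>gluing\<close>). Hence each
  segment, completed at both ends and by turns around a closed orbit that adjust the total time, is
  followed by a chord, and then, within \<open>2\<delta>\<close>, by an element of a finite family of cardinality at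
  most the chord number (\<open>chord_coding\<close>).

  The pair of these elements, with boundedly many further data, determines a primitive orbit and the
  time \<open>t\<close> up to a bounded error, by expansivity: two closed orbits with nearly equal periods that
  stay close during almost a period stay close forever after a linear change of time
  (\<open>close_periodic_orbits_coincide\<close>). Adding up the measures of the possible sets of times bounds
  the contribution of the primitive orbits (\<open>primitive_orbits_return_times\<close>).

  For a multiply covered orbit, many times \<open>t\<close> give the same point, and this argument only bounds
  the number of orbits, without the factor \<open>L n\<close>. But such an orbit has a period of at most half
  its total length, so a chord can follow it once and use the remaining time, linear in \<open>L n\<close>, to
  encode two numbers of turns around two disjoint closed orbits; this yields the factor
  (\<open>multiple_orbits_count\<close>). The second closed orbit exists by the closing lemma unless the manifold is
  a single closed orbit (\<open>second_closed_orbit\<close>), and in that case all entropies vanish, against the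
  hypothesis on the entropy at infinity (\<open>entropies_single_orbit\<close>).

  Local compactness, from the charts, replaces the compactness of closed balls throughout: the
  scale \<open>\<epsilon>\<^sub>1\<close> is chosen so small that the balls around points of \<open>K\<close> are relatively compact.
\<close>

section \<open>Auxiliary facts from analysis\<close>

lemma same_bin_close:
  fixes a b w :: real
  assumes "w > 0" "0 \<le> a" "0 \<le> b" "nat \<lfloor>a / w\<rfloor> = nat \<lfloor>b / w\<rfloor>"
  shows "\<bar>a - b\<bar> < w"
proof -
  have "\<lfloor>a / w\<rfloor> = \<lfloor>b / w\<rfloor>" using assms by (simp add: eq_nat_nat_iff)
  then have "\<bar>a / w - b / w\<bar> < 1" by linarith
  moreover have "\<bar>a / w - b / w\<bar> = \<bar>a - b\<bar> / w"
    using assms(1) by (simp add: abs_divide flip: diff_divide_distrib)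
  ultimately show ?thesis using assms(1) by (simp add: divide_less_eq)
qed

lemma measure_lebesgue_le_cover:
  fixes R :: "real set" and a :: "'k \<Rightarrow> real"
  assumes "finite I" and R: "R \<subseteq> (\<Union>(k, m)\<in>I \<times> {-1, 0, 1 :: int}. {a k + of_int m * l - 1 .. a k + of_int m * l + 1})"
  shows "measure lebesgue R \<le> 6 * card I"
proof (cases "R \<in> sets lebesgue")
  case True
  define F where "F = (\<lambda>(k, m :: int). {a k + of_int m * l - 1 .. a k + of_int m * l + 1})"
  have fin: "finite (I \<times> {-1, 0, 1 :: int})" using assms(1) by simp
  have F: "F i \<in> lmeasurable" "measure lebesgue (F i) = 2" for i
    by (simp_all add: F_def split: prod.split)
  have "measure lebesgue R \<le> measure lebesgue (\<Union>i\<in>I \<times> {-1, 0, 1 :: int}. F i)"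
    using True R fin F(1) by (intro measure_mono_fmeasurable fmeasurable.finite_UN) (auto simp: F_def)
  also have "\<dots> \<le> (\<Sum>i\<in>I \<times> {-1, 0, 1 :: int}. measure lebesgue (F i))"
    using fin F(1) by (intro measure_UNION_le) (auto dest: fmeasurableD)
  also have "\<dots> = 6 * card I" by (simp add: F(2) card_cartesian_product)
  finally show ?thesis .
  \<comment> \<open>a set that is not measurable has measure \<open>0\<close> by convention\<close>
qed (simp add: measure_notin_sets)

lemma bump_function_below_open:
  fixes U :: "'a::metric_space set"
  assumes m: "sets m = sets borel" "emeasure m UNIV \<noteq> \<infinity>" and U: "open U" and r: "r < measure m U"
  obtains f :: "'a \<Rightarrow> real" where "continuous_on UNIV f" "\<forall>x. 0 \<le> f x \<and> f x \<le> 1"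
    "\<forall>x. x \<notin> U \<longrightarrow> f x = 0" "r < integral\<^sup>L m f"
proof -
  have sp: "space m = UNIV" using sets_eq_imp_space_eq[OF m(1)] by simp
  interpret finite_measure m by standard (use m(2) sp in simp)
  have Um: "U \<in> sets m" using U m(1) by simp
  show ?thesis
  proof (cases "U = UNIV")
    case True
    then show ?thesis using r sp by (intro that[of "\<lambda>_. 1"]) (simp_all add: continuous_on_const)
  next
    case False
    define f where "f n x = min 1 (real n * infdist x (- U))" for n x
    have cont: "continuous_on UNIV (f n)" for n unfolding f_def by (intro continuous_intros)
    have range: "0 \<le> f n x" "f n x \<le> 1" for n x by (auto simp: f_def infdist_nonneg)
    have meas: "f n \<in> borel_measurable m" for n
      using borel_measurable_continuous_onI[OF cont] measurable_cong_sets[OF m(1) refl] by blast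
    have "(\<lambda>n. integral\<^sup>L m (f n)) \<longlonglongrightarrow> integral\<^sup>L m (indicator U)"
    proof (rule integral_dominated_convergence[where w = "\<lambda>_. 1"])
      have "(\<lambda>n. f n x) \<longlonglongrightarrow> indicator U x" for x
      proof (cases "x \<in> U")
        case True
        have "closed (- U)" "- U \<noteq> {}" using U False by auto
        then have d: "infdist x (- U) > 0"
          using True in_closed_iff_infdist_zero[of "- U" x] infdist_nonneg[of x "- U"] by force
        obtain N where N: "1 / infdist x (- U) \<le> real N" using real_arch_simple by blast
        have "f n x = 1" if "n \<ge> N" for n
        proof -
          have "1 / infdist x (- U) \<le> real n" using N that by linarith
          then show ?thesis using d by (simp add: f_def min_def field_simps)
        qed
        then have "\<forall>\<^sub>F n in sequentially. f n x = 1" by (rule eventually_sequentiallyI)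
        then show ?thesis using True by (simp add: tendsto_eventually)
      next
        case False
        then show ?thesis by (simp add: f_def)
      qed
      then show "AE x in m. (\<lambda>n. f n x) \<longlonglongrightarrow> indicator U x" by simp
    qed (use meas range Um in auto)
    also have "integral\<^sup>L m (indicator U) = measure m U" using Um sp by simp
    finally have "\<forall>\<^sub>F n in sequentially. r < integral\<^sup>L m (f n)" using r by (rule order_tendstoD)
    then obtain n where "r < integral\<^sup>L m (f n)" using eventually_happens'[OF sequentially_bot] by blast
    moreover have "f n x = 0" if "x \<notin> U" for x using that by (simp add: f_def)
    ultimately show ?thesis using cont range by (intro that[of "f n"]) auto
  qed
qed

lemma integral_shift_periodic:
  fixes h :: "real \<Rightarrow> real"
  assumes h: "continuous_on UNIV h" "\<And>t. h (t + l) = h t" and T: "0 \<le> T" "T \<le> l"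
  shows "integral {0..l} (\<lambda>t. h (t + T)) = integral {0..l} h"
proof -
  have int: "h integrable_on {a..b}" for a b
    by (rule integrable_continuous_real[OF continuous_on_subset[OF h(1)]]) simp
  have "integral {0..l} (\<lambda>t. h (t + T)) = integral {T..l + T} h"
    using integral_shift_real_ivl[of T T "l + T" h] by simp
  also have "\<dots> = integral {T..l} h + integral {l..l + T} h"
    using T int by (intro Henstock_Kurzweil_Integration.integral_combine[symmetric]) auto
  also have "integral {l..l + T} h = integral {0..T} h"
    using integral_shift_real_ivl[of l l "l + T" h] h(2) by simp
  also have "integral {T..l} h + integral {0..T} h = integral {0..l} h"
    using Henstock_Kurzweil_Integration.integral_combine[OF T int] by simp
  finally show ?thesis .
qed

lemma growth_rate_bounded:
  assumes "\<And>l. card (P l) \<le> N"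
  shows "growth_rate P = 0"
proof -
  have "((\<lambda>l. ln (real (card (P l))) / l) \<longlongrightarrow> 0) at_top"
  proof (rule Lim_null_comparison)
    have "\<bar>ln (real (card (P l)))\<bar> \<le> ln (real (Suc N))" for l
      using assms[of l] by (cases "card (P l) = 0") auto
    then show "\<forall>\<^sub>F l in at_top. norm (ln (real (card (P l))) / l) \<le> ln (real (Suc N)) / l"
      by (intro eventually_mono[OF eventually_gt_at_top[of 0]]) (simp add: divide_right_mono)
    show "((\<lambda>l. ln (real (Suc N)) / l) \<longlongrightarrow> 0) at_top"
      by (intro tendsto_divide_0[OF tendsto_const] filterlim_at_top_imp_at_infinity filterlim_ident)
  qed
  then have "((\<lambda>l. ereal (ln (real (card (P l))) / l)) \<longlongrightarrow> ereal 0) at_top" by (rule tendsto_ereal)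
  then show ?thesis unfolding growth_rate_def zero_ereal_def by (intro lim_imp_Limsup) simp_all
qed

lemma smooth_atlas_locally_compact:
  fixes A :: "('m::metric_space, 'e::euclidean_space) chart set"
  assumes "smooth_atlas A"
  shows "\<exists>r>0. \<exists>C. compact C \<and> ball (x :: 'm) r \<subseteq> C"
proof -
  have "x \<in> (\<Union>(U, \<kappa>)\<in>A. U)" using assms unfolding smooth_atlas_def by simp
  then obtain U \<kappa> where ch: "(U, \<kappa>) \<in> A" "x \<in> U" by blast
  then have U: "open U" "open (\<kappa> ` U)" "homeomorphism U (\<kappa> ` U) \<kappa> (inv_into U \<kappa>)"
    using assms unfolding smooth_atlas_def by blast+
  obtain e where e: "e > 0" "cball (\<kappa> x) e \<subseteq> \<kappa> ` U"
    using U(2) ch(2) open_contains_cball by blast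
  have cont: "continuous_on U \<kappa>" "continuous_on (\<kappa> ` U) (inv_into U \<kappa>)"
    "\<And>y. y \<in> U \<Longrightarrow> inv_into U \<kappa> (\<kappa> y) = y"
    using U(3) by (auto simp: homeomorphism_def)
  have "compact (inv_into U \<kappa> ` cball (\<kappa> x) e)"
    by (intro compact_continuous_image continuous_on_subset[OF cont(2) e(2)] compact_cball)
  moreover have "open (U \<inter> \<kappa> -` ball (\<kappa> x) e)"
    by (rule continuous_open_preimage[OF cont(1) U(1) open_ball])
  then obtain r where "r > 0" "ball x r \<subseteq> U \<inter> \<kappa> -` ball (\<kappa> x) e"
    using ch(2) e(1) openE[of "U \<inter> \<kappa> -` ball (\<kappa> x) e" x] by auto
  moreover have "U \<inter> \<kappa> -` ball (\<kappa> x) e \<subseteq> inv_into U \<kappa> ` cball (\<kappa> x) e"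
  proof
    fix y assume "y \<in> U \<inter> \<kappa> -` ball (\<kappa> x) e"
    then show "y \<in> inv_into U \<kappa> ` cball (\<kappa> x) e"
      using cont(3)[of y] by (intro image_eqI[of _ _ "\<kappa> y"]) auto
  qed
  ultimately show ?thesis by blast
qed

section \<open>Flows, closed orbits and expansivity\<close>

text \<open>
  A periodic orbit is primitive if its period is the least period of its points; all points of the
  orbit have the same periods, so the condition is stated at the base point.
\<close>

definition primitive_orbit :: "(real \<Rightarrow> 'm \<Rightarrow> 'm) \<Rightarrow> 'm set \<times> real \<Rightarrow> bool" where
  "primitive_orbit \<phi> \<gamma> \<longleftrightarrow> (\<forall>u. 0 < u \<and> u < period \<gamma> \<longrightarrow> \<phi> u (orbit_point \<gamma>) \<noteq> orbit_point \<gamma>)"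

text \<open>
  The times in one period at which the orbit is in \<open>B\<close> and is again in \<open>B\<close> exactly \<open>T\<close> later.
\<close>

definition return_times :: "(real \<Rightarrow> 'm \<Rightarrow> 'm) \<Rightarrow> real \<Rightarrow> 'm set \<Rightarrow> 'm set \<times> real \<Rightarrow> real set" where
  "return_times \<phi> T B \<gamma> =
     {t \<in> {0..period \<gamma>}. \<phi> t (orbit_point \<gamma>) \<in> B \<and> \<phi> (T + t) (orbit_point \<gamma>) \<in> B}"

text \<open>
  The dynamical part of the definition of an H-flow, on a locally compact metric space.
\<close>

locale H_flow_on_lc =
  fixes \<phi> :: "real \<Rightarrow> 'm::metric_space \<Rightarrow> 'm"
  assumes flow_zero [simp]: "\<phi> 0 x = x"
    and flow_add: "\<phi> (s + t) x = \<phi> s (\<phi> t x)"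
    and flow_cont: "continuous_on UNIV (\<lambda>(t, x). \<phi> t x)"
    and lipschitz: "lipschitz_flow \<phi>"
    and bounded_speed: "bounded_speed_flow \<phi>"
    and transitive: "transitive_flow \<phi>"
    and shadowing: "finite_exact_shadowing \<phi>"
    and closing: "closing_lemma \<phi>"
    and expansive: "expansive_flow \<phi>"
    and locally_compact: "\<exists>r>0. \<exists>C. compact C \<and> ball (x :: 'm) r \<subseteq> C"
begin

lemma continuous_on_flow [continuous_intros]:
  fixes f :: "'a::topological_space \<Rightarrow> real" and g :: "'a \<Rightarrow> 'm"
  assumes "continuous_on S f" and "continuous_on S g"
  shows "continuous_on S (\<lambda>a. \<phi> (f a) (g a))"
proof -
  have "continuous_on S ((\<lambda>(t, x). \<phi> t x) \<circ> (\<lambda>a. (f a, g a)))"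
    by (intro continuous_on_compose continuous_on_Pair assms
        continuous_on_subset[OF flow_cont]) auto
  then show ?thesis
    by (simp add: o_def)
qed

lemma lipschitz_upto:
  obtains C where "C \<ge> 1"
    and "\<And>t x y. 0 \<le> t \<Longrightarrow> t \<le> R \<Longrightarrow> dist (\<phi> t x) (\<phi> t y) \<le> C * dist x y"
proof -
  obtain C0 where C0: "\<And>x y t. t \<in> {-1..1} \<Longrightarrow> dist (\<phi> t x) (\<phi> t y) \<le> C0 * dist x y"
    using lipschitz unfolding lipschitz_flow_def by blast
  define C where "C = max 1 C0"
  have C: "dist (\<phi> t x) (\<phi> t y) \<le> C * dist x y" if "0 \<le> t" "t \<le> 1" for t x y
  proof -
    have "dist (\<phi> t x) (\<phi> t y) \<le> C0 * dist x y" using that by (intro C0) auto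
    also have "\<dots> \<le> C * dist x y" by (intro mult_right_mono) (auto simp: C_def)
    finally show ?thesis .
  qed
  have C1: "C \<ge> 1" by (simp add: C_def)
  have n: "\<forall>t x y. 0 \<le> t \<longrightarrow> t \<le> real n \<longrightarrow> dist (\<phi> t x) (\<phi> t y) \<le> C ^ n * dist x y" for n
  proof (induction n)
    case 0
    show ?case by auto
  next
    case (Suc n)
    show ?case
    proof (intro allI impI)
      fix t x y assume t: "0 \<le> t" "t \<le> real (Suc n)"
      show "dist (\<phi> t x) (\<phi> t y) \<le> C ^ Suc n * dist x y"
      proof (cases "t \<le> 1")
        case True
        have "C \<le> C ^ Suc n" using C1 by (intro self_le_power) auto
        then show ?thesis using C[OF t(1) True, of x y] mult_right_mono[of C "C ^ Suc n" "dist x y"] by auto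
      next
        case False
        have "dist (\<phi> t x) (\<phi> t y) = dist (\<phi> (t - 1) (\<phi> 1 x)) (\<phi> (t - 1) (\<phi> 1 y))"
          by (metis diff_add_cancel flow_add)
        also have "\<dots> \<le> C ^ n * dist (\<phi> 1 x) (\<phi> 1 y)" using Suc t False by auto
        also have "\<dots> \<le> C ^ n * (C * dist x y)" using C[of 1] C1 by (intro mult_left_mono) auto
        finally show ?thesis by (simp add: ac_simps)
      qed
    qed
  qed
  obtain n where "R \<le> real n" using real_arch_simple by blast
  then show ?thesis using n[of n] C1 by (intro that[of "C ^ n"]) (auto intro: order_trans)
qed

lemma speed_bound:
  obtains b where "b > 0" and "\<And>s t x. dist (\<phi> s x) (\<phi> t x) \<le> b * \<bar>t - s\<bar>"
proof -
  obtain a b where ab: "0 < a" "a \<le> b"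
    and loc: "\<And>x. \<exists>\<rho>>0. \<forall>t\<in>{-\<rho>..\<rho>}. a * \<bar>t\<bar> \<le> dist x (\<phi> t x) \<and> dist x (\<phi> t x) \<le> b * \<bar>t\<bar>"
    using bounded_speed unfolding bounded_speed_flow_def by blast
  have mono: "dist (\<phi> s x) (\<phi> t x) \<le> b * (t - s)" if "s \<le> t" for s t x
    using that
  proof (induction rule: Bolzano)
    case (trans r s t)
    then show ?case using dist_triangle[of "\<phi> r x" "\<phi> t x" "\<phi> s x"] by (simp add: algebra_simps)
  next
    case (local u)
    obtain \<rho> where \<rho>: "\<rho> > 0" "\<And>t. t \<in> {-\<rho>..\<rho>} \<Longrightarrow> dist (\<phi> u x) (\<phi> t (\<phi> u x)) \<le> b * \<bar>t\<bar>"
      using loc[of "\<phi> u x"] by blast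
    show ?case
    proof (intro exI[of _ \<rho>] conjI allI impI \<rho>(1))
      fix r t assume "r \<le> u \<and> u \<le> t \<and> t - r < \<rho>"
      then have *: "dist (\<phi> u x) (\<phi> r x) \<le> b * (u - r)" "dist (\<phi> u x) (\<phi> t x) \<le> b * (t - u)"
        using \<rho>(2)[of "r - u"] \<rho>(2)[of "t - u"] by (auto simp flip: flow_add)
      then show "dist (\<phi> r x) (\<phi> t x) \<le> b * (t - r)"
        using dist_triangle[of "\<phi> r x" "\<phi> t x" "\<phi> u x"] by (simp add: algebra_simps dist_commute)
    qed
  qed
  have "dist (\<phi> s x) (\<phi> t x) \<le> b * \<bar>t - s\<bar>" for s t x
    using mono[of s t x] mono[of t s x] by (cases "s \<le> t") (auto simp: dist_commute)
  then show ?thesis using ab by (intro that[of b]) auto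
qed

lemma period_of_int:
  assumes "\<phi> l x = x"
  shows "\<phi> (of_int k * l) x = x"
proof -
  have nat: "\<phi> (of_nat n * l) x = x" for n :: nat
    by (induction n) (simp_all add: distrib_right flow_add assms)
  show ?thesis
  proof (cases "k \<ge> 0")
    case True
    then show ?thesis using nat[of "nat k"] by simp
  next
    case False
    then have "\<phi> (of_int k * l) x = \<phi> (of_int k * l) (\<phi> (of_nat (nat (-k)) * l) x)"
      by (simp only: nat)
    also have "\<dots> = x" using False by (simp flip: flow_add distrib_right)
    finally show ?thesis .
  qed
qed

lemma period_of_nat: "\<phi> l x = x \<Longrightarrow> \<phi> (of_nat n * l) x = x"
  using period_of_int[of l x "int n"] by simp

lemma period_shift: "\<phi> l x = x \<Longrightarrow> \<phi> l (\<phi> t x) = \<phi> t x"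
  by (metis add.commute flow_add)

lemma time_mod_period:
  assumes "l > 0" and "\<phi> l x = x"
  obtains r where "0 \<le> r" "r < l" "\<phi> t x = \<phi> r x" and "t = of_int \<lfloor>t / l\<rfloor> * l + r"
proof -
  define r where "r = t - of_int \<lfloor>t / l\<rfloor> * l"
  have "of_int \<lfloor>t / l\<rfloor> * l \<le> t / l * l" "t / l * l < (of_int \<lfloor>t / l\<rfloor> + 1) * l"
    using assms(1) by (intro mult_right_mono mult_strict_right_mono; linarith)+
  then have "0 \<le> r" "r < l" using assms(1) by (simp_all add: r_def field_simps)
  moreover have "\<phi> t x = \<phi> (r + of_int \<lfloor>t / l\<rfloor> * l) x" by (simp add: r_def)
  then have "\<phi> t x = \<phi> r x" by (simp add: flow_add period_of_int[OF assms(2)])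
  ultimately show ?thesis by (intro that[of r]) (auto simp: r_def)
qed

lemma same_orbit: "y = \<phi> r x \<Longrightarrow> range (\<lambda>t. \<phi> t y) = range (\<lambda>t. \<phi> t x)"
proof -
  have *: "range (\<lambda>t. \<phi> t (\<phi> r x)) \<subseteq> range (\<lambda>t. \<phi> t x)" for r x
    by (auto simp flip: flow_add)
  assume y: "y = \<phi> r x"
  then have "x = \<phi> (-r) y" by (simp flip: flow_add)
  with y * show ?thesis by (metis subset_antisym)
qed

lemma compact_periodic_orbit:
  assumes "l > 0" and "\<phi> l x = x"
  shows "compact (range (\<lambda>t. \<phi> t x))"
proof -
  have "range (\<lambda>t. \<phi> t x) = (\<lambda>t. \<phi> t x) ` {0..l}"
  proof (intro subset_antisym subsetI)
    fix y assume "y \<in> range (\<lambda>t. \<phi> t x)"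
    then obtain t where t: "y = \<phi> t x" by blast
    obtain r where "0 \<le> r" "r < l" "\<phi> t x = \<phi> r x" using time_mod_period[OF assms] by metis
    with t show "y \<in> (\<lambda>t. \<phi> t x) ` {0..l}" by force
  qed auto
  then show ?thesis by (auto intro!: compact_continuous_image continuous_intros)
qed

lemma periods_bounded_below:
  assumes "compact K"
  obtains u where "u > 0" and "\<And>x t. x \<in> K \<Longrightarrow> \<phi> t x = x \<Longrightarrow> \<bar>t\<bar> < u \<Longrightarrow> t = 0"
proof -
  obtain b where b: "b > 0" "\<And>s t x. dist (\<phi> s x) (\<phi> t x) \<le> b * \<bar>t - s\<bar>"
    by (rule speed_bound) blast
  have pos: "\<exists>u>0. \<forall>x\<in>K. \<forall>t>0. \<phi> t x = x \<longrightarrow> u \<le> t"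
  proof (rule ccontr)
    assume neg: "\<not> ?thesis"
    have "\<exists>x\<in>K. \<exists>t>0. \<phi> t x = x \<and> t < inverse (real (Suc n))" for n
    proof -
      have "inverse (real (Suc n)) > 0" by simp
      with neg show ?thesis by (simp add: not_le)
    qed
    then have "\<forall>n. \<exists>z. fst z \<in> K \<and> snd z > 0 \<and> \<phi> (snd z) (fst z) = fst z \<and> snd z < inverse (real (Suc n))"
      by (auto simp: Bex_def)
    then obtain Z where Z: "\<forall>n. fst (Z n) \<in> K \<and> snd (Z n) > 0 \<and> \<phi> (snd (Z n)) (fst (Z n)) = fst (Z n) \<and>
        snd (Z n) < inverse (real (Suc n))"
      by (drule_tac choice) (elim exE)
    define X U where "X = fst \<circ> Z" and "U = snd \<circ> Z"
    with Z have X: "X n \<in> K" "U n > 0" "\<phi> (U n) (X n) = X n" "U n < inverse (real (Suc n))" for n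
      by auto
    have "seq_compact K" using assms by (simp add: compact_eq_seq_compact_metric)
    from seq_compactE[OF this, of X] X(1) obtain x r where x: "x \<in> K" "strict_mono r" "(X \<circ> r) \<longlonglongrightarrow> x"
      by auto
    \<comment> \<open>the limit of points with shorter and shorter periods is fixed by the flow\<close>
    have fixed: "\<phi> t x = x" for t
    proof -
      have bound: "dist (\<phi> t (X n)) (X n) \<le> b * inverse (real (Suc n))" for n
      proof -
        obtain s where s: "0 \<le> s" "s < U n" "\<phi> t (X n) = \<phi> s (X n)"
          using time_mod_period[OF X(2,3)] by metis
        have "dist (\<phi> t (X n)) (X n) \<le> b * s" using b(2)[of s "X n" 0] s by simp
        also have "\<dots> \<le> b * inverse (real (Suc n))" using less_trans[OF s(2) X(4)] b(1)
          by (intro mult_left_mono less_imp_le)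
        finally show ?thesis .
      qed
      have lim: "(\<lambda>n. b * inverse (real (Suc n))) \<longlonglongrightarrow> 0"
        using LIMSEQ_inverse_real_of_nat by (rule tendsto_mult_right_zero)
      have "(\<lambda>n. dist (\<phi> t (X n)) (X n)) \<longlonglongrightarrow> 0"
        by (rule Lim_null_comparison[OF _ lim])
          (use bound in \<open>auto intro!: always_eventually simp del: of_nat_Suc\<close>)
      then have "(\<lambda>n. dist (\<phi> t ((X \<circ> r) n)) ((X \<circ> r) n)) \<longlonglongrightarrow> 0"
        using LIMSEQ_subseq_LIMSEQ[OF _ x(2), of "\<lambda>n. dist (\<phi> t (X n)) (X n)" 0] by (simp add: o_def)
      moreover have "(\<lambda>n. dist (\<phi> t ((X \<circ> r) n)) ((X \<circ> r) n)) \<longlonglongrightarrow> dist (\<phi> t x) x"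
      proof (intro tendsto_dist x(3))
        have "continuous_on UNIV (\<phi> t)" by (intro continuous_intros)
        then show "(\<lambda>n. \<phi> t ((X \<circ> r) n)) \<longlonglongrightarrow> \<phi> t x"
          using x(3) by (rule continuous_on_tendsto_compose) auto
      qed
      ultimately have "dist (\<phi> t x) x = 0" by (rule LIMSEQ_unique[rotated])
      then show ?thesis by simp
    qed
    obtain a b where "a > 0"
      and loc: "\<forall>x. \<exists>\<rho>>0. \<forall>t\<in>{-\<rho>..\<rho>}. a * \<bar>t\<bar> \<le> dist x (\<phi> t x) \<and> dist x (\<phi> t x) \<le> b * \<bar>t\<bar>"
      using bounded_speed unfolding bounded_speed_flow_def by (elim exE conjE) (rule that)
    obtain \<rho> where "\<rho> > 0" "\<forall>t\<in>{-\<rho>..\<rho>}. a * \<bar>t\<bar> \<le> dist x (\<phi> t x) \<and> dist x (\<phi> t x) \<le> b * \<bar>t\<bar>"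
      using loc[rule_format, of x] by (elim exE conjE) (rule that)
    then have "a * \<bar>\<rho>\<bar> \<le> dist x (\<phi> \<rho> x)" by (elim ballE[of _ _ \<rho>]) auto
    then have "a * \<rho> \<le> 0" using \<open>\<rho> > 0\<close> by (simp add: fixed)
    with \<open>a > 0\<close> \<open>\<rho> > 0\<close> show False by (simp add: mult_le_0_iff)
  qed
  then obtain u where u: "u > 0" "\<And>x t. x \<in> K \<Longrightarrow> t > 0 \<Longrightarrow> \<phi> t x = x \<Longrightarrow> u \<le> t" by blast
  show ?thesis
  proof (rule that[OF u(1)])
    fix x t assume x: "x \<in> K" "\<phi> t x = x" "\<bar>t\<bar> < u"
    moreover have "\<phi> (-t) x = x" using period_of_int[OF x(2), of "-1"] by simp
    ultimately show "t = 0" using u(2)[of x t] u(2)[of x "-t"] by linarith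
  qed
qed

text \<open>
  Two closed orbits whose periods differ little and that stay close on a time interval missing at
  most \<open>R\<close> of a period coincide: running through both at constant relative speed, they stay close
  forever, and expansivity applies.
\<close>

lemma close_periodic_orbits_coincide:
  assumes "R \<ge> 0"
  obtains \<epsilon> \<nu> where "\<epsilon> > 0" "\<nu> > 0"
    and "\<And>x y l l' H. \<lbrakk>l > 0; l' > 0; \<phi> l x = x; \<phi> l' y = y; \<bar>l - l'\<bar> \<le> \<nu>; 0 \<le> H; l \<le> H + R;
           \<And>s. 0 \<le> s \<Longrightarrow> s \<le> H \<Longrightarrow> dist (\<phi> s x) (\<phi> s y) \<le> \<epsilon>\<rbrakk> \<Longrightarrow> \<exists>r\<in>{-1..1}. y = \<phi> r x"
proof -
  obtain b where b: "b > 0" "\<And>s t x. dist (\<phi> s x) (\<phi> t x) \<le> b * \<bar>t - s\<bar>"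
    by (rule speed_bound) blast
  obtain C where C: "C \<ge> 1"
    "\<And>t x y. 0 \<le> t \<Longrightarrow> t \<le> R \<Longrightarrow> dist (\<phi> t x) (\<phi> t y) \<le> C * dist x y"
    by (rule lipschitz_upto[of R]) blast
  obtain e where e: "e > 0" and expand: "\<forall>x y. (\<exists>s :: real \<Rightarrow> real. continuous_on UNIV s \<and> s 0 = 0 \<and>
      (\<forall>t. dist (\<phi> t x) (\<phi> (s t) y) \<le> e)) \<longrightarrow> (\<exists>r\<in>{-1..1}. y = \<phi> r x)"
    using expansive[unfolded expansive_flow_def, rule_format, of 1] by auto
  define \<epsilon> where "\<epsilon> = e / (2 * C)"
  define \<nu> where "\<nu> = e / (2 * b)"
  show ?thesis
  proof (rule that[of \<epsilon> \<nu>])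
    show "\<epsilon> > 0" "\<nu> > 0" using e b(1) C(1) by (auto simp: \<epsilon>_def \<nu>_def)
    fix x y l l' H
    assume l: "l > 0" "l' > 0" "\<phi> l x = x" "\<phi> l' y = y" "\<bar>l - l'\<bar> \<le> \<nu>" "0 \<le> H" "l \<le> H + R"
      and close: "\<And>s. 0 \<le> s \<Longrightarrow> s \<le> H \<Longrightarrow> dist (\<phi> s x) (\<phi> s y) \<le> \<epsilon>"
    have half: "dist (\<phi> s x) (\<phi> s y) \<le> e / 2" if "0 \<le> s" "s < l" for s
    proof (cases "s \<le> H")
      case True
      have "\<epsilon> \<le> e / 2" using C(1) e by (auto simp: \<epsilon>_def field_simps)
      then show ?thesis using close[OF that(1) True] by linarith
    next
      case False
      have "dist (\<phi> s x) (\<phi> s y) = dist (\<phi> (s - H) (\<phi> H x)) (\<phi> (s - H) (\<phi> H y))"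
        by (simp flip: flow_add)
      also have "\<dots> \<le> C * dist (\<phi> H x) (\<phi> H y)" using False that l by (intro C) auto
      also have "\<dots> \<le> C * \<epsilon>" using close[of H] l C(1) by (intro mult_left_mono) auto
      also have "\<dots> = e / 2" using C(1) by (simp add: \<epsilon>_def)
      finally show ?thesis .
    qed
    show "\<exists>r\<in>{-1..1}. y = \<phi> r x"
    proof (rule expand[rule_format], intro exI[of _ "\<lambda>t. t * (l' / l)"] conjI allI)
      fix t
      obtain r where r: "0 \<le> r" "r < l" "\<phi> t x = \<phi> r x" "t = of_int \<lfloor>t / l\<rfloor> * l + r"
        using time_mod_period[OF l(1,3)] by metis
      have "t * (l' / l) = r * (l' / l) + of_int \<lfloor>t / l\<rfloor> * l'"
        using l(1) by (subst r(4)) (simp add: field_simps)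
      then have y: "\<phi> (t * (l' / l)) y = \<phi> (r * (l' / l)) y"
        by (simp add: flow_add period_of_int[OF l(4)])
      have "r * (l' / l) - r = (r / l) * (l' - l)" using l(1) by (simp add: field_simps)
      then have "\<bar>r * (l' / l) - r\<bar> = (r / l) * \<bar>l' - l\<bar>" using r l by (simp add: abs_mult)
      also have "\<dots> \<le> 1 * \<nu>" using r l by (intro mult_mono) auto
      finally have "b * \<bar>r * (l' / l) - r\<bar> \<le> b * \<nu>" using b(1) by (simp add: mult_left_mono)
      also have "\<dots> = e / 2" using b(1) by (simp add: \<nu>_def)
      finally have "dist (\<phi> r y) (\<phi> (r * (l' / l)) y) \<le> e / 2"
        using b(2)[of r y "r * (l' / l)"] by linarith
      with half[OF r(1,2)] show "dist (\<phi> t x) (\<phi> (t * (l' / l)) y) \<le> e"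
        unfolding y r(3) using dist_triangle[of "\<phi> r x" "\<phi> (r * (l' / l)) y" "\<phi> r y"] by linarith
    qed (use l(1) in \<open>auto intro!: continuous_intros\<close>)
  qed
qed

lemma periodic_orbitD:
  assumes "\<gamma> \<in> periodic_orbits \<phi>"
  shows "period \<gamma> > 0" and "orbit_point \<gamma> \<in> fst \<gamma>"
    and "x \<in> fst \<gamma> \<Longrightarrow> \<phi> (period \<gamma>) x = x" and "x \<in> fst \<gamma> \<Longrightarrow> fst \<gamma> = range (\<lambda>t. \<phi> t x)"
proof -
  obtain y T where y: "\<gamma> = (range (\<lambda>t. \<phi> t y), T)" "T > 0" "\<phi> T y = y"
    using assms unfolding periodic_orbits_def by blast
  show "period \<gamma> > 0" using y by simp
  have "y \<in> fst \<gamma>" using y(1) by (auto intro!: image_eqI[of _ _ 0])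
  then show "orbit_point \<gamma> \<in> fst \<gamma>" unfolding orbit_point_def by (rule someI)
  assume "x \<in> fst \<gamma>"
  then obtain t where t: "x = \<phi> t y" using y(1) by auto
  show "\<phi> (period \<gamma>) x = x" using period_shift[OF y(3)] y(1) t by simp
  show "fst \<gamma> = range (\<lambda>t. \<phi> t x)" using same_orbit[OF t] y(1) by simp
qed

lemma flow_in_periodic_orbit:
  assumes "\<gamma> \<in> periodic_orbits \<phi>" "x \<in> fst \<gamma>"
  shows "\<phi> t x \<in> fst \<gamma>"
  using periodic_orbitD(4)[OF assms] by auto

lemma periodic_orbit_eqI:
  assumes "\<gamma> \<in> periodic_orbits \<phi>" "\<gamma>' \<in> periodic_orbits \<phi>" "x \<in> fst \<gamma>" "\<phi> r x \<in> fst \<gamma>'"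
    and "\<And>t. \<phi> t x = x \<Longrightarrow> \<bar>t\<bar> < u \<Longrightarrow> t = 0" and "\<bar>period \<gamma> - period \<gamma>'\<bar> < u"
  shows "\<gamma> = \<gamma>'"
proof (rule prod_eqI)
  have "range (\<lambda>t. \<phi> t (\<phi> r x)) = range (\<lambda>t. \<phi> t x)" by (rule same_orbit) simp
  then show orb: "fst \<gamma> = fst \<gamma>'"
    using periodic_orbitD(4)[OF assms(1,3)] periodic_orbitD(4)[OF assms(2,4)] by simp
  have "\<phi> (period \<gamma> - period \<gamma>') x = \<phi> (period \<gamma> - period \<gamma>') (\<phi> (period \<gamma>') x)"
    using periodic_orbitD(3)[OF assms(2), of x] assms(3) orb by simp
  also have "\<dots> = x" using periodic_orbitD(3)[OF assms(1,3)] by (simp flip: flow_add)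
  finally have "period \<gamma> - period \<gamma>' = 0" using assms(6) by (rule assms(5))
  then show "period \<gamma> = period \<gamma>'" by simp
qed

section \<open>Gluing orbit segments\<close>

lemma compact_neighbourhood:
  fixes K :: "'m set"
  assumes "compact K"
  obtains r C where "r > 0" "compact C" "\<And>x. x \<in> K \<Longrightarrow> ball x r \<subseteq> C"
proof (cases "K = {}")
  case True
  then show ?thesis using that[of 1 "{}"] by auto
next
  case False
  define r C where "r x = (SOME r. r > 0 \<and> (\<exists>C. compact C \<and> ball x r \<subseteq> C))"
    and "C x = (SOME C. compact C \<and> ball x (r x) \<subseteq> C)" for x :: 'm
  have r: "r x > 0 \<and> (\<exists>C. compact C \<and> ball x (r x) \<subseteq> C)" for x :: 'm
    unfolding r_def by (rule someI_ex) (rule locally_compact)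
  have "compact (C x) \<and> ball x (r x) \<subseteq> C x" for x :: 'm
    unfolding C_def using conjunct2[OF r] by (rule someI_ex)
  with r have rC: "r x > 0" "compact (C x)" "ball x (r x) \<subseteq> C x" for x :: 'm
    by simp_all
  have "K \<subseteq> (\<Union>x\<in>K. ball x (r x / 2))" using rC(1) by auto
  then obtain D where D: "D \<subseteq> K" "finite D" "K \<subseteq> (\<Union>x\<in>D. ball x (r x / 2))"
    using compactE_image[OF assms, of K "\<lambda>x. ball x (r x / 2)"] by auto
  define r0 where "r0 = Min ((\<lambda>x. r x / 2) ` D)"
  have "D \<noteq> {}" using D False by auto
  then have "r0 > 0" using D rC(1) by (simp add: r0_def)
  moreover have "ball x r0 \<subseteq> (\<Union>d\<in>D. C d)" if xK: "x \<in> K" for x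
  proof
    fix y assume y: "y \<in> ball x r0"
    obtain d where "d \<in> D" "x \<in> ball d (r d / 2)" using D(3) xK by blast
    then have d: "d \<in> D" "dist d x < r d / 2" by (simp_all only: mem_ball)
    have "r0 \<le> r d / 2" unfolding r0_def using d D(2) by (intro Min_le) auto
    then have "dist d y < r d" using y d(2) dist_triangle[of d y x] unfolding mem_ball by linarith
    then show "y \<in> (\<Union>d\<in>D. C d)" using rC(3)[of d] d(1) by auto
  qed
  ultimately show ?thesis using D(2) rC(2) by (intro that[of r0 "\<Union>d\<in>D. C d"]) auto
qed

text \<open>
  By transitivity and compactness, finitely many orbit arcs, with times in \<open>[S\<^sub>0, S\<^sub>1]\<close>, connect any two
  points of a compact set up to an error \<open>r\<close>: the arc depends only on the centres \<open>\<iota> x\<close>, \<open>\<iota> y\<close> of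
  the cells of a finite partition that contain the two points.
\<close>

lemma connecting_arcs:
  assumes "compact K" and "r > 0" and "S\<^sub>0 > 0"
  obtains \<iota> u c S\<^sub>1 where "finite (\<iota> ` K)"
    and "\<And>x. x \<in> K \<Longrightarrow> \<iota> x \<in> K"
    and "\<And>x y. x \<in> K \<Longrightarrow> y \<in> K \<Longrightarrow> S\<^sub>0 \<le> c (\<iota> x) (\<iota> y) \<and> c (\<iota> x) (\<iota> y) \<le> S\<^sub>1"
    and "\<And>x y. x \<in> K \<Longrightarrow> y \<in> K \<Longrightarrow> dist x (u (\<iota> x) (\<iota> y)) < r \<and> dist (\<iota> x) (u (\<iota> x) (\<iota> y)) < r
      \<and> dist (\<phi> (c (\<iota> x) (\<iota> y)) (u (\<iota> x) (\<iota> y))) y < r"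
proof -
  have "K \<subseteq> (\<Union>x\<in>K. ball x (r / 2))" using assms(2) by auto
  then obtain D where D: "D \<subseteq> K" "finite D" "K \<subseteq> (\<Union>x\<in>D. ball x (r / 2))"
    using compactE_image[OF assms(1), of K "\<lambda>x. ball x (r / 2)"] by auto
  define \<iota> where "\<iota> x = (SOME i. i \<in> D \<and> dist i x < r / 2)" for x
  have \<iota>: "\<iota> x \<in> D \<and> dist (\<iota> x) x < r / 2" if "x \<in> K" for x
  proof -
    from that D(3) obtain i where "i \<in> D" "x \<in> ball i (r / 2)" by blast
    then have "i \<in> D \<and> dist i x < r / 2" by (simp only: mem_ball)
    then show ?thesis unfolding \<iota>_def by (rule someI)
  qed
  have ex: "\<exists>u t. t \<ge> S\<^sub>0 \<and> dist i u < r / 2 \<and> dist j (\<phi> t u) < r / 2" for i j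
  proof -
    have "\<exists>t\<ge>S\<^sub>0. \<phi> t ` ball i (r / 2) \<inter> ball j (r / 2) \<noteq> {}"
      using transitive[unfolded transitive_flow_def, rule_format, of "ball i (r / 2)" "ball j (r / 2)" S\<^sub>0]
        assms(2,3) by simp
    then obtain t u where "t \<ge> S\<^sub>0" "u \<in> ball i (r / 2)" "\<phi> t u \<in> ball j (r / 2)" by blast
    then have "t \<ge> S\<^sub>0 \<and> dist i u < r / 2 \<and> dist j (\<phi> t u) < r / 2" by (simp only: mem_ball simp_thms)
    then show ?thesis by blast
  qed
  define ut where "ut i j = (SOME ut. snd ut \<ge> S\<^sub>0 \<and> dist i (fst ut) < r / 2 \<and>
      dist j (\<phi> (snd ut) (fst ut)) < r / 2)" for i j
  define u c where "u i j = fst (ut i j)" and "c i j = snd (ut i j)" for i j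
  have uc: "c i j \<ge> S\<^sub>0" "dist i (u i j) < r / 2" "dist j (\<phi> (c i j) (u i j)) < r / 2" for i j
  proof -
    obtain u' t' where "t' \<ge> S\<^sub>0 \<and> dist i u' < r / 2 \<and> dist j (\<phi> t' u') < r / 2" using ex[of i j] by blast
    then have "snd (u', t') \<ge> S\<^sub>0 \<and> dist i (fst (u', t')) < r / 2 \<and>
        dist j (\<phi> (snd (u', t')) (fst (u', t'))) < r / 2" by simp
    then have "snd (ut i j) \<ge> S\<^sub>0 \<and> dist i (fst (ut i j)) < r / 2 \<and>
        dist j (\<phi> (snd (ut i j)) (fst (ut i j))) < r / 2"
      unfolding ut_def by (rule someI)
    then show "c i j \<ge> S\<^sub>0" "dist i (u i j) < r / 2" "dist j (\<phi> (c i j) (u i j)) < r / 2"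
      by (simp_all add: u_def c_def)
  qed
  define S\<^sub>1 where "S\<^sub>1 = Max ((\<lambda>(i, j). c i j) ` (D \<times> D))"
  have S1: "c i j \<le> S\<^sub>1" if "i \<in> D" "j \<in> D" for i j
    unfolding S\<^sub>1_def using that D(2) by (intro Max_ge) (auto intro!: image_eqI[of _ _ "(i, j)"])
  show ?thesis
  proof (rule that[of \<iota> c S\<^sub>1 u])
    have "\<iota> ` K \<subseteq> D" using \<iota> by blast
    then show "finite (\<iota> ` K)" using D(2) by (rule finite_subset)
  next
    fix x assume "x \<in> K" then show "\<iota> x \<in> K" using \<iota> D(1) by blast
  next
    fix x y assume xy: "x \<in> K" "y \<in> K"
    show "S\<^sub>0 \<le> c (\<iota> x) (\<iota> y) \<and> c (\<iota> x) (\<iota> y) \<le> S\<^sub>1"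
      using \<iota>[OF xy(1)] \<iota>[OF xy(2)] uc(1) S1 by simp
    show "dist x (u (\<iota> x) (\<iota> y)) < r \<and> dist (\<iota> x) (u (\<iota> x) (\<iota> y)) < r
      \<and> dist (\<phi> (c (\<iota> x) (\<iota> y)) (u (\<iota> x) (\<iota> y))) y < r"
    proof (intro conjI)
      show "dist x (u (\<iota> x) (\<iota> y)) < r"
        using uc(2)[of "\<iota> x" "\<iota> y"] \<iota>[OF xy(1)] dist_triangle[of x "u (\<iota> x) (\<iota> y)" "\<iota> x"]
          dist_commute[of x "\<iota> x"] by linarith
      show "dist (\<iota> x) (u (\<iota> x) (\<iota> y)) < r" using uc(2)[of "\<iota> x" "\<iota> y"] assms(2) by linarith
      show "dist (\<phi> (c (\<iota> x) (\<iota> y)) (u (\<iota> x) (\<iota> y))) y < r"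
        using uc(3)[where i = "\<iota> x" and j = "\<iota> y"] \<iota>[OF xy(2)]
          dist_triangle3[of "\<phi> (c (\<iota> x) (\<iota> y)) (u (\<iota> x) (\<iota> y))" y "\<iota> y"] by linarith
    qed
  qed
qed

text \<open>
  Starting time of the \<open>i\<close>-th piece, counted from \<open>0\<close>, when the orbit segments of \<open>x j\<close> of length
  \<open>t j\<close> are followed one after the other; the connecting time \<open>c\<close> between two segments depends on
  the cells, given by \<open>\<iota>\<close>, of the end of the first and of the start of the second.
\<close>

definition start_time :: "('m \<Rightarrow> 'm) \<Rightarrow> ('m \<Rightarrow> 'm \<Rightarrow> real) \<Rightarrow> (nat \<Rightarrow> 'm) \<Rightarrow> (nat \<Rightarrow> real) \<Rightarrow> nat \<Rightarrow> real"
  where "start_time \<iota> c x t i = (\<Sum>j<i. t j + c (\<iota> (\<phi> (t j) (x j))) (\<iota> (x (Suc j))))"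

lemma gluing:
  assumes K: "compact K" and \<delta>: "\<delta> > 0" and S0: "S\<^sub>0 > 0" and N: "N \<ge> 1"
  obtains \<iota> c S\<^sub>1 where "finite (\<iota> ` K)"
    and "\<And>x y. x \<in> K \<Longrightarrow> y \<in> K \<Longrightarrow> S\<^sub>0 \<le> c (\<iota> x) (\<iota> y) \<and> c (\<iota> x) (\<iota> y) \<le> S\<^sub>1"
    and "\<And>x t. (\<And>i. i < N \<Longrightarrow> x i \<in> K \<and> 0 \<le> t i \<and> \<phi> (t i) (x i) \<in> K) \<Longrightarrow>
      \<exists>z. \<forall>i<N. \<forall>s\<in>{0..t i}. dist (\<phi> (s + start_time \<iota> c x t i) z) (\<phi> s (x i)) < \<delta>"
proof -
  obtain r C where r: "r > 0" "compact C" "\<And>x. x \<in> K \<Longrightarrow> ball x r \<subseteq> C"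
    using compact_neighbourhood[OF K] by metis
  have "\<exists>e>0. \<forall>(x :: nat \<Rightarrow> 'm) (t :: nat \<Rightarrow> real).
           (\<forall>i\<in>{1..2 * N - 1}. x i \<in> C \<and> t i \<ge> 0) \<and>
           (\<forall>i. 1 \<le> i \<and> i < 2 * N - 1 \<longrightarrow> dist (\<phi> (t i) (x i)) (x (i + 1)) < e) \<longrightarrow>
           (\<exists>y. \<forall>i\<in>{1..2 * N - 1}. \<forall>s\<in>{0..t i}.
              dist (\<phi> (s + (\<Sum>j\<in>{1..<i}. t j)) y) (\<phi> s (x i)) < \<delta>)"
    using shadowing r(2) \<delta> N unfolding finite_exact_shadowing_def by simp
  then obtain e where e: "e > 0" and shadow: "\<And>(x :: nat \<Rightarrow> 'm) (t :: nat \<Rightarrow> real).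
           (\<forall>i\<in>{1..2 * N - 1}. x i \<in> C \<and> t i \<ge> 0) \<Longrightarrow>
           (\<forall>i. 1 \<le> i \<and> i < 2 * N - 1 \<longrightarrow> dist (\<phi> (t i) (x i)) (x (i + 1)) < e) \<Longrightarrow>
           (\<exists>y. \<forall>i\<in>{1..2 * N - 1}. \<forall>s\<in>{0..t i}.
              dist (\<phi> (s + (\<Sum>j\<in>{1..<i}. t j)) y) (\<phi> s (x i)) < \<delta>)"
    by metis
  have "min e r > 0" using e r(1) by simp
  from connecting_arcs[OF K this S0] obtain \<iota> u c S\<^sub>1 where \<iota>: "finite (\<iota> ` K)"
    "\<And>x. x \<in> K \<Longrightarrow> \<iota> x \<in> K"
    "\<And>x y. x \<in> K \<Longrightarrow> y \<in> K \<Longrightarrow> S\<^sub>0 \<le> c (\<iota> x) (\<iota> y) \<and> c (\<iota> x) (\<iota> y) \<le> S\<^sub>1"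
    "\<And>x y. x \<in> K \<Longrightarrow> y \<in> K \<Longrightarrow> dist x (u (\<iota> x) (\<iota> y)) < min e r \<and> dist (\<iota> x) (u (\<iota> x) (\<iota> y)) < min e r
      \<and> dist (\<phi> (c (\<iota> x) (\<iota> y)) (u (\<iota> x) (\<iota> y))) y < min e r"
    by metis
  show ?thesis
  proof (rule that[of \<iota> c S\<^sub>1])
    show "finite (\<iota> ` K)" by (rule \<iota>(1))
  next
    fix x y assume "x \<in> K" "y \<in> K"
    then show "S\<^sub>0 \<le> c (\<iota> x) (\<iota> y) \<and> c (\<iota> x) (\<iota> y) \<le> S\<^sub>1" by (rule \<iota>(3))
  next
    fix x :: "nat \<Rightarrow> 'm" and t :: "nat \<Rightarrow> real"
    assume x: "\<And>i. i < N \<Longrightarrow> x i \<in> K \<and> 0 \<le> t i \<and> \<phi> (t i) (x i) \<in> K"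
    \<comment> \<open>the odd pieces are the given ones, the even pieces are the connecting arcs\<close>
    define X where "X k = (let i = (k - 1) div 2 in if odd k then x i else
        u (\<iota> (\<phi> (t i) (x i))) (\<iota> (x (Suc i))))" for k
    define U where "U k = (let i = (k - 1) div 2 in if odd k then t i else
        c (\<iota> (\<phi> (t i) (x i))) (\<iota> (x (Suc i))))" for k
    have odd: "X (2 * i + 1) = x i" "U (2 * i + 1) = t i" for i by (auto simp: X_def U_def)
    have even: "X (2 * i + 2) = u (\<iota> (\<phi> (t i) (x i))) (\<iota> (x (Suc i)))"
      "U (2 * i + 2) = c (\<iota> (\<phi> (t i) (x i))) (\<iota> (x (Suc i)))" for i by (auto simp: X_def U_def)
    have sum: "(\<Sum>j\<in>{1..<2 * i + 1}. U j) = start_time \<iota> c x t i" for i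
    proof (induction i)
      case (Suc i)
      have "{1..<2 * Suc i + 1} = insert (2 * i + 2) (insert (2 * i + 1) {1..<2 * i + 1})" by auto
      then have "(\<Sum>j\<in>{1..<2 * Suc i + 1}. U j) = U (2 * i + 2) + (U (2 * i + 1) + (\<Sum>j\<in>{1..<2 * i + 1}. U j))"
        by (simp add: sum.insert)
      then show ?case unfolding Suc odd even by (simp add: start_time_def)
    qed (simp add: start_time_def)
    have split: "\<exists>i. (k = 2 * i + 1 \<and> i < N) \<or> (k = 2 * i + 2 \<and> Suc i < N)" if "1 \<le> k" "k \<le> 2 * N - 1" for k
    proof (cases "odd k")
      case True
      then show ?thesis using that by (auto elim!: oddE)
    next
      case False
      then obtain m where "k = 2 * m" by blast
      then show ?thesis using that by (intro exI[of _ "m - 1"]) auto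
    qed
    have "\<exists>y. \<forall>i\<in>{1..2 * N - 1}. \<forall>s\<in>{0..U i}.
              dist (\<phi> (s + (\<Sum>j\<in>{1..<i}. U j)) y) (\<phi> s (X i)) < \<delta>"
    proof (rule shadow)
      show "\<forall>k\<in>{1..2 * N - 1}. X k \<in> C \<and> 0 \<le> U k"
      proof
        fix k assume "k \<in> {1..2 * N - 1}"
        then consider i where "k = 2 * i + 1" "i < N" | i where "k = 2 * i + 2" "Suc i < N"
          using split[of k] by auto
        then show "X k \<in> C \<and> 0 \<le> U k"
        proof cases
          case 1
          have "x i \<in> ball (x i) r" using r(1) by simp
          then show ?thesis using r(3)[of "x i"] x[OF 1(2)] unfolding 1(1) odd by blast
        next
          case 2
          let ?p = "\<phi> (t i) (x i)" and ?q = "x (Suc i)"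
          have pq: "?p \<in> K" "?q \<in> K" using x 2 by auto
          have "u (\<iota> ?p) (\<iota> ?q) \<in> ball (\<iota> ?p) r" using \<iota>(4)[OF pq] by simp
          then show ?thesis using r(3)[OF \<iota>(2)[OF pq(1)]] \<iota>(3)[OF pq] S0 unfolding 2(1) even by force
        qed
      qed
      show "\<forall>k. 1 \<le> k \<and> k < 2 * N - 1 \<longrightarrow> dist (\<phi> (U k) (X k)) (X (k + 1)) < e"
      proof (intro allI impI)
        fix k assume k: "1 \<le> k \<and> k < 2 * N - 1"
        then consider i where "k = 2 * i + 1" "Suc i < N" | i where "k = 2 * i + 2" "Suc i < N"
          using split[of k] by auto
        then show "dist (\<phi> (U k) (X k)) (X (k + 1)) < e"
        proof cases
          case 1
          have k: "k + 1 = 2 * i + 2" using 1 by simp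
          show ?thesis unfolding k even unfolding 1(1) odd
            using \<iota>(4)[of "\<phi> (t i) (x i)" "x (Suc i)"] x[of i] x[of "Suc i"] 1 by auto
        next
          case 2
          have k: "k + 1 = 2 * Suc i + 1" using 2 by simp
          show ?thesis unfolding k odd unfolding 2(1) even
            using \<iota>(4)[of "\<phi> (t i) (x i)" "x (Suc i)"] x[of i] x[of "Suc i"] 2 by auto
        qed
      qed
    qed
    then obtain z where z: "\<And>i s. i \<in> {1..2 * N - 1} \<Longrightarrow> s \<in> {0..U i} \<Longrightarrow>
        dist (\<phi> (s + (\<Sum>j\<in>{1..<i}. U j)) z) (\<phi> s (X i)) < \<delta>" by blast
    show "\<exists>z. \<forall>i<N. \<forall>s\<in>{0..t i}. dist (\<phi> (s + start_time \<iota> c x t i) z) (\<phi> s (x i)) < \<delta>"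
    proof (intro exI[of _ z] allI impI ballI)
      fix i s assume "i < N" "s \<in> {0..t i}"
      then show "dist (\<phi> (s + start_time \<iota> c x t i) z) (\<phi> s (x i)) < \<delta>"
        using z[of "2 * i + 1" s] unfolding sum odd by auto
    qed
  qed
qed

section \<open>Chords as codes of orbit segments\<close>

text \<open>
  Separating sets in a relatively compact ball have bounded cardinality, by the Lipschitz property
  of the flow. So there is one of maximal cardinality, which covers the chords, and the supremum in
  the chord number is that of a nonempty bounded set.
\<close>

lemma chord_net:
  assumes "compact C" and "ball x \<eta> \<subseteq> C" and "\<delta> > 0"
  obtains E where "finite E" "card E \<le> chord_number \<phi> x y \<eta> T T' \<delta>"
    "chords \<phi> x y \<eta> T T' \<subseteq> (\<Union>z\<in>E. dynamical_ball \<phi> z \<delta> T)"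
proof -
  define Z where "Z = chords \<phi> x y \<eta> T T'"
  have ZC: "Z \<subseteq> C" using assms(2) by (auto simp: Z_def chords_def)
  obtain B where B: "B \<ge> 1"
    "\<And>t x y. 0 \<le> t \<Longrightarrow> t \<le> T \<Longrightarrow> dist (\<phi> t x) (\<phi> t y) \<le> B * dist x y"
    by (rule lipschitz_upto[of T]) blast
  define r where "r = \<delta> / B"
  have r: "r > 0" using B assms(3) by (simp add: r_def)
  have "C \<subseteq> (\<Union>x\<in>C. ball x (r / 2))" using r by auto
  then obtain D where D: "D \<subseteq> C" "finite D" "C \<subseteq> (\<Union>x\<in>D. ball x (r / 2))"
    using compactE_image[OF assms(1), of C "\<lambda>x. ball x (r / 2)"] by auto
  have bounded: "finite E \<and> card E \<le> card D" if E: "E \<subseteq> Z" "separating_set \<phi> \<delta> T E" for E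
  proof -
    have "\<forall>p\<in>E. \<exists>d\<in>D. dist d p < r / 2" using D(3) E(1) ZC by force
    then obtain f where f: "\<And>p. p \<in> E \<Longrightarrow> f p \<in> D \<and> dist (f p) p < r / 2" by metis
    have "inj_on f E"
    proof (rule inj_onI, rule ccontr)
      fix p q assume pq: "p \<in> E" "q \<in> E" "f p = f q" "p \<noteq> q"
      then have "dist p q < r"
        using f[OF pq(1)] f[OF pq(2)] dist_triangle[of p q "f p"] by (simp add: dist_commute)
      then have "B * dist p q < \<delta>" using B(1) by (simp add: r_def field_simps)
      moreover obtain t where "t \<in> {0..T}" "dist (\<phi> t p) (\<phi> t q) \<ge> \<delta>"
        using E(2) pq unfolding separating_set_def by blast
      ultimately show False using B(2)[of t p q] by auto
    qed
    moreover have "f ` E \<subseteq> D" using f by auto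
    ultimately show ?thesis using D(2) by (metis card_inj_on_le inj_on_finite)
  qed
  define F where "F = {E. E \<subseteq> Z \<and> separating_set \<phi> \<delta> T E}"
  have "{} \<in> F" by (simp add: F_def separating_set_def)
  moreover have "\<forall>E. E \<in> F \<longrightarrow> card E < Suc (card D)" using bounded by (auto simp: F_def less_Suc_eq_le)
  ultimately have "\<exists>E. E \<in> F \<and> (\<forall>E'. E' \<in> F \<longrightarrow> card E' \<le> card E)"
    by (intro ex_has_greatest_nat[of "\<lambda>E. E \<in> F" "{}"])
  then obtain E where E: "E \<in> F" "\<And>E'. E' \<in> F \<Longrightarrow> card E' \<le> card E" by blast
  have finE: "finite E" using E(1) bounded by (auto simp: F_def)
  have cover: "Z \<subseteq> (\<Union>z\<in>E. dynamical_ball \<phi> z \<delta> T)"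
  proof (rule subsetI, rule ccontr)
    fix p assume p: "p \<in> Z" "p \<notin> (\<Union>z\<in>E. dynamical_ball \<phi> z \<delta> T)"
    then have far: "\<exists>t\<in>{0..T}. dist (\<phi> t z) (\<phi> t p) \<ge> \<delta>" if "z \<in> E" for z
      using that by (force simp: dynamical_ball_def not_less)
    have "insert p E \<in> F"
      using E(1) p(1) far unfolding F_def separating_set_def
      by (auto simp: dist_commute)
    moreover have "p \<notin> E"
    proof
      assume "p \<in> E"
      with far obtain t where "dist (\<phi> t p) (\<phi> t p) \<ge> \<delta>" by blast
      then show False using assms(3) by simp
    qed
    ultimately show False using E(2)[of "insert p E"] finE by simp
  qed
  let ?N = "{card E | E. E \<subseteq> Z \<and> separating_set \<phi> \<delta> T E \<and> Z \<subseteq> (\<Union>z\<in>E. dynamical_ball \<phi> z \<delta> T)}"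
  have "card E \<in> ?N" using E(1) cover by (auto simp: F_def)
  moreover have "bdd_above ?N" using bounded by (intro bdd_aboveI[of _ "card D"]) auto
  ultimately have "card E \<le> Sup ?N" by (rule cSup_upper)
  then show ?thesis using finE cover by (intro that[of E]) (auto simp: chord_number_def Z_def)
qed

text \<open>
  An orbit segment of length \<open>t\<close> with end points in the compact set \<open>B\<close> is, up to \<open>2\<delta>\<close>, part of
  a chord in a covering family: connect \<open>x\<^sub>0\<close> to \<open>p\<close>, run around the closed orbit of \<open>p\<close> to adjust
  the total time, connect to the segment, follow it, and connect its end to \<open>y\<^sub>0\<close>. The label
  consists of this chord and of the cells of the end points, which determine when the chord
  reaches the segment; so segments with equal labels stay \<open>4\<delta>\<close>-close.
\<close>

lemma chord_coding:
  assumes B: "compact B" "K \<subseteq> B" and p: "p \<in> B" "\<phi> \<theta> p = p" "0 < \<theta>" "\<theta> \<le> W"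
    and \<eta>: "0 < \<eta>" "\<eta> < \<delta>" and C: "compact C" "\<And>x. x \<in> K \<Longrightarrow> ball x \<eta> \<subseteq> C"
  obtains S\<^sub>2 and D :: nat where "S\<^sub>2 > 0"
    and "\<forall>x\<^sub>0\<in>K. \<forall>y\<^sub>0\<in>K. \<forall>S\<ge>S\<^sub>2. \<forall>t\<ge>0.
      \<exists>Q (f :: 'm \<Rightarrow> 'm \<times> 'm \<times> 'm). finite Q \<and>
        card Q \<le> D * chord_number \<phi> x\<^sub>0 y\<^sub>0 \<eta> (t + S) (t + S + W) \<delta> \<and>
        (\<forall>x\<in>B. \<phi> t x \<in> B \<longrightarrow> f x \<in> Q) \<and>
        (\<forall>x\<in>B. \<forall>x'\<in>B. \<phi> t x \<in> B \<longrightarrow> \<phi> t x' \<in> B \<longrightarrow> f x = f x' \<longrightarrow>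
          (\<forall>s\<in>{0..t}. dist (\<phi> s x) (\<phi> s x') < 4 * \<delta>))"
proof -
  obtain \<iota> c S\<^sub>1 where fin: "finite (\<iota> ` B)"
    and c: "\<And>x y. x \<in> B \<Longrightarrow> y \<in> B \<Longrightarrow> \<theta> \<le> c (\<iota> x) (\<iota> y) \<and> c (\<iota> x) (\<iota> y) \<le> S\<^sub>1"
    and glue: "\<And>x t. (\<And>i. i < 4 \<Longrightarrow> x i \<in> B \<and> 0 \<le> t i \<and> \<phi> (t i) (x i) \<in> B) \<Longrightarrow>
      \<exists>z. \<forall>i<4. \<forall>s\<in>{0..t i}. dist (\<phi> (s + start_time \<iota> c x t i) z) (\<phi> s (x i)) < \<eta>"
    by (rule gluing[OF B(1) \<eta>(1) p(3), of 4]) auto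
  have S1: "S\<^sub>1 > 0" using c[OF p(1) p(1)] p(3) by linarith
  show ?thesis
  proof (rule that[of "3 * S\<^sub>1" "card (\<iota> ` B) * card (\<iota> ` B)"], use S1 in simp, intro ballI allI impI)
    fix x\<^sub>0 y\<^sub>0 S t assume x0: "x\<^sub>0 \<in> K" and y0: "y\<^sub>0 \<in> K" and S: "3 * S\<^sub>1 \<le> S" and t: "0 \<le> (t :: real)"
    have x0B: "x\<^sub>0 \<in> B" and y0B: "y\<^sub>0 \<in> B" using x0 y0 B(2) by auto
    have "\<delta> > 0" using \<eta> by simp
    obtain E where E: "finite E" "card E \<le> chord_number \<phi> x\<^sub>0 y\<^sub>0 \<eta> (t + S) (t + S + W) \<delta>"
      "chords \<phi> x\<^sub>0 y\<^sub>0 \<eta> (t + S) (t + S + W) \<subseteq> (\<Union>z\<in>E. dynamical_ball \<phi> z \<delta> (t + S))"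
      by (rule chord_net[OF C(1) C(2)[OF x0] \<open>\<delta> > 0\<close>])
    \<comment> \<open>the number of turns around the orbit of \<open>p\<close> that brings the total time into the window\<close>
    define k where "k i j = nat \<lceil>(S - (c (\<iota> x\<^sub>0) (\<iota> p) + c (\<iota> p) i + c j (\<iota> y\<^sub>0))) / \<theta>\<rceil>" for i j
    define \<sigma> where "\<sigma> i j = c (\<iota> x\<^sub>0) (\<iota> p) + real (k i j) * \<theta> + c (\<iota> p) i" for i j
    have chord: "\<exists>e. e \<in> E \<and> (\<forall>s\<in>{0..t}. dist (\<phi> (s + \<sigma> (\<iota> x) (\<iota> (\<phi> t x))) e) (\<phi> s x) < 2 * \<delta>)"
      if x: "x \<in> B" "\<phi> t x \<in> B" for x
    proof -
      let ?i = "\<iota> x" and ?j = "\<iota> (\<phi> t x)"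
      define c0 where "c0 = c (\<iota> x\<^sub>0) (\<iota> p)"
      define c1 where "c1 = c (\<iota> p) ?i"
      define c2 where "c2 = c ?j (\<iota> y\<^sub>0)"
      have cs: "\<theta> \<le> c0" "c0 \<le> S\<^sub>1" "\<theta> \<le> c1" "c1 \<le> S\<^sub>1" "\<theta> \<le> c2" "c2 \<le> S\<^sub>1"
        unfolding c0_def c1_def c2_def using c x x0B y0B p(1) by blast+
      define n where "n = k ?i ?j"
      have nonneg: "0 \<le> (S - (c0 + c1 + c2)) / \<theta>" using cs S p(3) by simp
      have n: "real n = of_int \<lceil>(S - (c0 + c1 + c2)) / \<theta>\<rceil>"
        unfolding n_def k_def c0_def[symmetric] c1_def[symmetric] c2_def[symmetric]
        using nonneg by (intro of_nat_nat) linarith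
      have "(S - (c0 + c1 + c2)) / \<theta> \<le> real n" "real n \<le> (S - (c0 + c1 + c2)) / \<theta> + 1"
        unfolding n by linarith+
      then have n1: "S - (c0 + c1 + c2) \<le> real n * \<theta>" and n2: "real n * \<theta> \<le> S - (c0 + c1 + c2) + \<theta>"
        using p(3) by (simp_all add: field_simps)
      define X where "X = (\<lambda>_ :: nat. y\<^sub>0)(0 := x\<^sub>0, 1 := p, 2 := x)"
      define U where "U = (\<lambda>_ :: nat. 0 :: real)(1 := real n * \<theta>, 2 := t)"
      have loop: "\<phi> (real n * \<theta>) p = p" by (rule period_of_nat[OF p(2)])
      have "\<exists>z. \<forall>i<4. \<forall>s\<in>{0..U i}. dist (\<phi> (s + start_time \<iota> c X U i) z) (\<phi> s (X i)) < \<eta>"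
      proof (rule glue)
        fix i :: nat assume "i < 4"
        then consider "i = 0" | "i = 1" | "i = 2" | "i = 3" by linarith
        then show "X i \<in> B \<and> 0 \<le> U i \<and> \<phi> (U i) (X i) \<in> B"
          using x x0B y0B p t loop by cases (auto simp: X_def U_def)
      qed
      then obtain z where "\<forall>i<4. \<forall>s\<in>{0..U i}. dist (\<phi> (s + start_time \<iota> c X U i) z) (\<phi> s (X i)) < \<eta>"
        by (rule exE)
      then have z: "dist (\<phi> (s + start_time \<iota> c X U i) z) (\<phi> s (X i)) < \<eta>"
        if "i < 4" "0 \<le> s" "s \<le> U i" for i s using that by simp
      have st: "start_time \<iota> c X U 0 = 0" "start_time \<iota> c X U 2 = \<sigma> ?i ?j"
        "start_time \<iota> c X U 3 = \<sigma> ?i ?j + t + c2"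
        by (simp_all add: start_time_def X_def U_def eval_nat_numeral loop[unfolded n_def] \<sigma>_def n_def c2_def)
      have \<sigma>: "\<sigma> ?i ?j = c0 + real n * \<theta> + c1" by (simp add: \<sigma>_def n_def c0_def c1_def)
      have "dist z x\<^sub>0 < \<eta>" using z[of 0 0] st by (simp add: X_def U_def)
      moreover have "dist (\<phi> (\<sigma> ?i ?j + t + c2) z) y\<^sub>0 < \<eta>" using z[of 3 0] st by (simp add: X_def U_def)
      moreover have "\<sigma> ?i ?j + t + c2 \<in> {t + S..t + S + W}" using n1 n2 p(4) unfolding \<sigma> by simp
      ultimately have "z \<in> chords \<phi> x\<^sub>0 y\<^sub>0 \<eta> (t + S) (t + S + W)"
        unfolding chords_def mem_Collect_eq mem_ball by (auto simp: dist_commute disjoint_iff)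
      then obtain e where e: "e \<in> E" "z \<in> dynamical_ball \<phi> e \<delta> (t + S)" using E(3) by blast
      have "dist (\<phi> (s + \<sigma> ?i ?j) e) (\<phi> s x) < 2 * \<delta>" if s: "s \<in> {0..t}" for s
      proof -
        have "s + \<sigma> ?i ?j \<in> {0..t + S}" using s n2 cs p(3) unfolding \<sigma> by auto
        then have "dist (\<phi> (s + \<sigma> ?i ?j) e) (\<phi> (s + \<sigma> ?i ?j) z) < \<delta>"
          using e(2) unfolding dynamical_ball_def by blast
        moreover have "dist (\<phi> (s + \<sigma> ?i ?j) z) (\<phi> s x) < \<eta>"
          using z[of 2 s] s st by (simp add: X_def U_def)
        ultimately show ?thesis
          using \<eta>(2) dist_triangle[of "\<phi> (s + \<sigma> ?i ?j) e" "\<phi> s x" "\<phi> (s + \<sigma> ?i ?j) z"] by linarith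
      qed
      with e(1) show ?thesis by blast
    qed
    define e where "e x = (SOME e. e \<in> E \<and>
        (\<forall>s\<in>{0..t}. dist (\<phi> (s + \<sigma> (\<iota> x) (\<iota> (\<phi> t x))) e) (\<phi> s x) < 2 * \<delta>))" for x
    have e: "e x \<in> E \<and> (\<forall>s\<in>{0..t}. dist (\<phi> (s + \<sigma> (\<iota> x) (\<iota> (\<phi> t x))) (e x)) (\<phi> s x) < 2 * \<delta>)"
      if "x \<in> B" "\<phi> t x \<in> B" for x
      unfolding e_def by (rule someI_ex[OF chord[OF that]])
    define f where "f x = (\<iota> x, \<iota> (\<phi> t x), e x)" for x
    define Q where "Q = \<iota> ` B \<times> \<iota> ` B \<times> E"
    have "finite Q" using fin E(1) by (simp add: Q_def)
    moreover have "card Q \<le> card (\<iota> ` B) * card (\<iota> ` B) * chord_number \<phi> x\<^sub>0 y\<^sub>0 \<eta> (t + S) (t + S + W) \<delta>"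
      using E(2) by (simp add: Q_def card_cartesian_product)
    moreover have "\<forall>x\<in>B. \<phi> t x \<in> B \<longrightarrow> f x \<in> Q" using e by (auto simp: f_def Q_def)
    moreover have "dist (\<phi> s x) (\<phi> s x') < 4 * \<delta>"
      if x: "x \<in> B" "x' \<in> B" "\<phi> t x \<in> B" "\<phi> t x' \<in> B" and eq: "f x = f x'" and s: "s \<in> {0..t}" for x x' s
    proof -
      have same: "\<iota> x = \<iota> x'" "\<iota> (\<phi> t x) = \<iota> (\<phi> t x')" "e x = e x'" using eq by (auto simp: f_def)
      have "dist (\<phi> (s + \<sigma> (\<iota> x') (\<iota> (\<phi> t x'))) (e x')) (\<phi> s x) < 2 * \<delta>"
        using e[OF x(1,3)] s unfolding same by blast
      moreover have "dist (\<phi> (s + \<sigma> (\<iota> x') (\<iota> (\<phi> t x'))) (e x')) (\<phi> s x') < 2 * \<delta>"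
        using e[OF x(2,4)] s by blast
      ultimately show ?thesis
        using dist_triangle3[of "\<phi> s x" "\<phi> s x'" "\<phi> (s + \<sigma> (\<iota> x') (\<iota> (\<phi> t x'))) (e x')"] by linarith
    qed
    ultimately show "\<exists>Q (f :: 'm \<Rightarrow> 'm \<times> 'm \<times> 'm). finite Q \<and>
        card Q \<le> card (\<iota> ` B) * card (\<iota> ` B) * chord_number \<phi> x\<^sub>0 y\<^sub>0 \<eta> (t + S) (t + S + W) \<delta> \<and>
        (\<forall>x\<in>B. \<phi> t x \<in> B \<longrightarrow> f x \<in> Q) \<and>
        (\<forall>x\<in>B. \<forall>x'\<in>B. \<phi> t x \<in> B \<longrightarrow> \<phi> t x' \<in> B \<longrightarrow> f x = f x' \<longrightarrow>
          (\<forall>s\<in>{0..t}. dist (\<phi> s x) (\<phi> s x') < 4 * \<delta>))"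
      by (intro exI[of _ Q] exI[of _ f]) simp
  qed
qed

text \<open>In particular chord numbers are positive: code a segment of the closed orbit of \<open>p\<close>.\<close>

lemma chord_number_pos:
  assumes K: "compact K" and p: "p \<in> K" "\<phi> \<theta> p = p" "0 < \<theta>" "\<theta> \<le> W"
  obtains \<epsilon> where "\<epsilon> > 0" and "\<And>\<eta> \<delta>. \<lbrakk>0 < \<eta>; \<eta> < \<delta>; 4 * \<delta> \<le> \<epsilon>\<rbrakk> \<Longrightarrow> \<exists>S\<^sub>2>0.
    \<forall>x\<^sub>0\<in>K. \<forall>y\<^sub>0\<in>K. \<forall>S\<ge>S\<^sub>2. \<forall>T\<ge>0. 1 \<le> chord_number \<phi> x\<^sub>0 y\<^sub>0 \<eta> (T + S) (T + S + W) \<delta>"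
proof -
  obtain r C where r: "r > 0" "compact C" "\<And>x. x \<in> K \<Longrightarrow> ball x r \<subseteq> C"
    using compact_neighbourhood[OF K] by metis
  let ?B = "K \<union> range (\<lambda>t. \<phi> t p)"
  have B: "compact ?B" "K \<subseteq> ?B" "p \<in> ?B"
    using K p(1) compact_periodic_orbit[OF p(3,2)] by (auto intro: compact_Un)
  show ?thesis
  proof (rule that[OF r(1)])
    fix \<eta> \<delta> :: real assume \<eta>: "0 < \<eta>" "\<eta> < \<delta>" "4 * \<delta> \<le> r"
    have ballC: "ball x \<eta> \<subseteq> C" if "x \<in> K" for x
    proof -
      have "ball x \<eta> \<subseteq> ball x r" using \<eta> by (intro subset_ball) linarith
      then show ?thesis using r(3)[OF that] by blast
    qed
    obtain S\<^sub>2 and D :: nat where S2: "S\<^sub>2 > 0"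
      and code: "\<forall>x\<^sub>0\<in>K. \<forall>y\<^sub>0\<in>K. \<forall>S\<ge>S\<^sub>2. \<forall>t\<ge>0.
      \<exists>Q (f :: 'm \<Rightarrow> 'm \<times> 'm \<times> 'm). finite Q \<and>
        card Q \<le> D * chord_number \<phi> x\<^sub>0 y\<^sub>0 \<eta> (t + S) (t + S + W) \<delta> \<and>
        (\<forall>x\<in>?B. \<phi> t x \<in> ?B \<longrightarrow> f x \<in> Q) \<and>
        (\<forall>x\<in>?B. \<forall>x'\<in>?B. \<phi> t x \<in> ?B \<longrightarrow> \<phi> t x' \<in> ?B \<longrightarrow> f x = f x' \<longrightarrow>
          (\<forall>s\<in>{0..t}. dist (\<phi> s x) (\<phi> s x') < 4 * \<delta>))"
      by (rule chord_coding[OF B p(2-4) \<eta>(1,2) r(2) ballC])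
    have "1 \<le> chord_number \<phi> x\<^sub>0 y\<^sub>0 \<eta> (T + S) (T + S + W) \<delta>"
      if xy: "x\<^sub>0 \<in> K" "y\<^sub>0 \<in> K" "S\<^sub>2 \<le> S" "0 \<le> T" for x\<^sub>0 y\<^sub>0 S T
    proof -
      obtain Q and f :: "'m \<Rightarrow> 'm \<times> 'm \<times> 'm" where Q: "finite Q"
        "card Q \<le> D * chord_number \<phi> x\<^sub>0 y\<^sub>0 \<eta> (T + S) (T + S + W) \<delta>"
        and f: "\<forall>x\<in>?B. \<phi> T x \<in> ?B \<longrightarrow> f x \<in> Q"
        using code[rule_format, OF xy] by (elim exE conjE)
      have "\<phi> T p \<in> ?B" by blast
      then have "f p \<in> Q" using f B(3) by blast
      then have "card Q > 0" using Q(1) by (auto simp: card_gt_0_iff)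
      then show ?thesis using Q(2) by (cases "chord_number \<phi> x\<^sub>0 y\<^sub>0 \<eta> (T + S) (T + S + W) \<delta>") auto
    qed
    with S2 show "\<exists>S\<^sub>2>0. \<forall>x\<^sub>0\<in>K. \<forall>y\<^sub>0\<in>K. \<forall>S\<ge>S\<^sub>2. \<forall>T\<ge>0.
        1 \<le> chord_number \<phi> x\<^sub>0 y\<^sub>0 \<eta> (T + S) (T + S + W) \<delta>" by blast
  qed
qed

section \<open>Counting primitive and multiple orbits\<close>

text \<open>
  The contribution of the primitive orbits. A return time \<open>t\<close> of an orbit is labelled by the codes
  of the two orbit segments from time \<open>t\<close> to \<open>t + T\<close> and from \<open>t + T\<close> to \<open>t + H\<close>, and by the
  approximate period. By expansivity a label determines the orbit, and the time up to \<open>1\<close> modulo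
  the period.
\<close>

lemma primitive_orbits_return_times:
  assumes K: "compact K" and p: "p \<in> K" "\<phi> \<theta> p = p" "0 < \<theta>" "\<theta> \<le> W"
  obtains \<epsilon> where "\<epsilon> > 0" and "\<And>\<eta> \<delta>. \<lbrakk>0 < \<eta>; \<eta> < \<delta>; 4 * \<delta> \<le> \<epsilon>\<rbrakk> \<Longrightarrow> \<exists>S\<^sub>2>0. \<exists>D\<ge>0.
    \<forall>T\<ge>0. \<forall>H\<ge>max T 2. \<forall>x\<^sub>0\<in>K. \<forall>y\<^sub>0\<in>K. \<forall>x\<^sub>1\<in>K. \<forall>y\<^sub>1\<in>K. \<forall>S\<ge>S\<^sub>2. \<forall>P. finite P \<longrightarrow>
      P \<subseteq> {\<gamma> \<in> periodic_orbits \<phi>. period \<gamma> \<in> {H..H + W} \<and> primitive_orbit \<phi> \<gamma>} \<longrightarrow>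
      (\<Sum>\<gamma>\<in>P. measure lebesgue (return_times \<phi> T K \<gamma>))
        \<le> D * real (chord_number \<phi> x\<^sub>0 y\<^sub>0 \<eta> (T + S) (T + S + W) \<delta>)
            * real (chord_number \<phi> x\<^sub>1 y\<^sub>1 \<eta> (H - T + S) (H - T + S + W) \<delta>)"
proof -
  have W: "W > 0" using p by simp
  obtain \<epsilon>\<^sub>0 \<nu>\<^sub>0 where exp: "\<epsilon>\<^sub>0 > 0" "\<nu>\<^sub>0 > 0"
    "\<And>x y l l' H. \<lbrakk>l > 0; l' > 0; \<phi> l x = x; \<phi> l' y = y; \<bar>l - l'\<bar> \<le> \<nu>\<^sub>0; 0 \<le> H; l \<le> H + W;
           \<And>s. 0 \<le> s \<Longrightarrow> s \<le> H \<Longrightarrow> dist (\<phi> s x) (\<phi> s y) \<le> \<epsilon>\<^sub>0\<rbrakk> \<Longrightarrow> \<exists>r\<in>{-1..1}. y = \<phi> r x"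
    by (rule close_periodic_orbits_coincide[of W]) (use W in auto)
  obtain u where u: "u > 0" "\<And>x t. x \<in> K \<Longrightarrow> \<phi> t x = x \<Longrightarrow> \<bar>t\<bar> < u \<Longrightarrow> t = 0"
    by (rule periods_bounded_below[OF K]) auto
  \<comment> \<open>accuracy to which periods are recorded\<close>
  define \<nu> where "\<nu> = min \<nu>\<^sub>0 u"
  have \<nu>: "\<nu> > 0" "\<nu> \<le> \<nu>\<^sub>0" "\<nu> \<le> u" using exp(2) u(1) by (auto simp: \<nu>_def)
  obtain r C where r: "r > 0" "compact C" "\<And>x. x \<in> K \<Longrightarrow> ball x r \<subseteq> C"
    using compact_neighbourhood[OF K] by metis
  \<comment> \<open>the point reached at time \<open>H\<close> is at most \<open>W\<close> before the return to \<open>K\<close> after a period\<close>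
  define B where "B = (\<lambda>(t, x). \<phi> t x) ` ({-W..0} \<times> K)"
  have "compact B" unfolding B_def
    by (intro compact_continuous_image continuous_on_subset[OF flow_cont] compact_Times K) auto
  moreover have flowB: "\<phi> t x \<in> B" if "x \<in> K" "-W \<le> t" "t \<le> 0" for t x
    unfolding B_def using that by (intro image_eqI[of _ _ "(t, x)"]) auto
  have KB: "K \<subseteq> B"
  proof
    fix x assume "x \<in> K"
    from flowB[OF this, of 0] W show "x \<in> B" by simp
  qed
  ultimately have B: "compact B" "K \<subseteq> B" "p \<in> B" using p(1) by auto
  show ?thesis
  proof (rule that[of "min \<epsilon>\<^sub>0 r"])
    show "min \<epsilon>\<^sub>0 r > 0" using exp(1) r(1) by simp
    fix \<eta> \<delta> :: real assume \<eta>: "0 < \<eta>" "\<eta> < \<delta>" "4 * \<delta> \<le> min \<epsilon>\<^sub>0 r"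
    have ballC: "ball x \<eta> \<subseteq> C" if "x \<in> K" for x
    proof -
      have "ball x \<eta> \<subseteq> ball x r" using \<eta> by (intro subset_ball) linarith
      then show ?thesis using r(3)[OF that] by blast
    qed
    obtain S\<^sub>2 and D :: nat where S2: "S\<^sub>2 > 0"
      and code: "\<forall>x\<^sub>0\<in>K. \<forall>y\<^sub>0\<in>K. \<forall>S\<ge>S\<^sub>2. \<forall>t\<ge>0.
      \<exists>Q (f :: 'm \<Rightarrow> 'm \<times> 'm \<times> 'm). finite Q \<and>
        card Q \<le> D * chord_number \<phi> x\<^sub>0 y\<^sub>0 \<eta> (t + S) (t + S + W) \<delta> \<and>
        (\<forall>x\<in>B. \<phi> t x \<in> B \<longrightarrow> f x \<in> Q) \<and>
        (\<forall>x\<in>B. \<forall>x'\<in>B. \<phi> t x \<in> B \<longrightarrow> \<phi> t x' \<in> B \<longrightarrow> f x = f x' \<longrightarrow>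
          (\<forall>s\<in>{0..t}. dist (\<phi> s x) (\<phi> s x') < 4 * \<delta>))"
      by (rule chord_coding[OF B(1,2,3) p(2-4) \<eta>(1,2) r(2) ballC])
    define M where "M = nat \<lfloor>W / \<nu>\<rfloor>"
    show "\<exists>S\<^sub>2>0. \<exists>D\<ge>0. \<forall>T\<ge>0. \<forall>H\<ge>max T 2. \<forall>x\<^sub>0\<in>K. \<forall>y\<^sub>0\<in>K. \<forall>x\<^sub>1\<in>K. \<forall>y\<^sub>1\<in>K. \<forall>S\<ge>S\<^sub>2. \<forall>P. finite P \<longrightarrow>
      P \<subseteq> {\<gamma> \<in> periodic_orbits \<phi>. period \<gamma> \<in> {H..H + W} \<and> primitive_orbit \<phi> \<gamma>} \<longrightarrow>
      (\<Sum>\<gamma>\<in>P. measure lebesgue (return_times \<phi> T K \<gamma>))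
        \<le> D * real (chord_number \<phi> x\<^sub>0 y\<^sub>0 \<eta> (T + S) (T + S + W) \<delta>)
            * real (chord_number \<phi> x\<^sub>1 y\<^sub>1 \<eta> (H - T + S) (H - T + S + W) \<delta>)"
    proof (rule exI[of _ S\<^sub>2], rule conjI[OF S2], rule exI[of _ "real (6 * D * D * Suc M)"], intro conjI allI impI ballI)
      fix T H x\<^sub>0 y\<^sub>0 x\<^sub>1 y\<^sub>1 S and P :: "('m set \<times> real) set"
      assume T: "0 \<le> T" and H: "max T 2 \<le> H" and xy: "x\<^sub>0 \<in> K" "y\<^sub>0 \<in> K" "x\<^sub>1 \<in> K" "y\<^sub>1 \<in> K"
        and S: "S\<^sub>2 \<le> S" and finP: "finite P"
        and P: "P \<subseteq> {\<gamma> \<in> periodic_orbits \<phi>. period \<gamma> \<in> {H..H + W} \<and> primitive_orbit \<phi> \<gamma>}"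
      let ?N0 = "chord_number \<phi> x\<^sub>0 y\<^sub>0 \<eta> (T + S) (T + S + W) \<delta>"
      let ?N1 = "chord_number \<phi> x\<^sub>1 y\<^sub>1 \<eta> (H - T + S) (H - T + S + W) \<delta>"
      have H': "0 \<le> H - T" "2 \<le> H" using H by auto
      obtain Q0 and f0 :: "'m \<Rightarrow> 'm \<times> 'm \<times> 'm" where Q0: "finite Q0" "card Q0 \<le> D * ?N0"
        and f0: "\<forall>x\<in>B. \<phi> T x \<in> B \<longrightarrow> f0 x \<in> Q0"
          "\<forall>x\<in>B. \<forall>x'\<in>B. \<phi> T x \<in> B \<longrightarrow> \<phi> T x' \<in> B \<longrightarrow> f0 x = f0 x' \<longrightarrow>
            (\<forall>s\<in>{0..T}. dist (\<phi> s x) (\<phi> s x') < 4 * \<delta>)"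
        using code[rule_format, OF xy(1,2) S T] by (elim exE conjE)
      obtain Q1 and f1 :: "'m \<Rightarrow> 'm \<times> 'm \<times> 'm" where Q1: "finite Q1" "card Q1 \<le> D * ?N1"
        and f1: "\<forall>x\<in>B. \<phi> (H - T) x \<in> B \<longrightarrow> f1 x \<in> Q1"
          "\<forall>x\<in>B. \<forall>x'\<in>B. \<phi> (H - T) x \<in> B \<longrightarrow> \<phi> (H - T) x' \<in> B \<longrightarrow> f1 x = f1 x' \<longrightarrow>
            (\<forall>s\<in>{0..H - T}. dist (\<phi> s x) (\<phi> s x') < 4 * \<delta>)"
        using code[rule_format, OF xy(3,4) S H'(1)] by (elim exE conjE)
      define R where "R \<gamma> = return_times \<phi> T K \<gamma>" for \<gamma>
      define x where "x \<gamma> t = \<phi> t (orbit_point \<gamma>)" for \<gamma> t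
      define F where "F \<gamma> t = (f0 (x \<gamma> t), f1 (\<phi> T (x \<gamma> t)), nat \<lfloor>(period \<gamma> - H) / \<nu>\<rfloor>)" for \<gamma> t
      have Pd: "\<gamma> \<in> periodic_orbits \<phi>" "H \<le> period \<gamma>" "period \<gamma> \<le> H + W" "primitive_orbit \<phi> \<gamma>"
        if "\<gamma> \<in> P" for \<gamma> using that P by auto
      have xd: "x \<gamma> t \<in> K" "\<phi> T (x \<gamma> t) \<in> K" "\<phi> (H - T) (\<phi> T (x \<gamma> t)) \<in> B" "x \<gamma> t \<in> fst \<gamma>"
        "\<phi> (period \<gamma>) (x \<gamma> t) = x \<gamma> t" if \<gamma>: "\<gamma> \<in> P" and t: "t \<in> R \<gamma>" for \<gamma> t
      proof -
        show xK: "x \<gamma> t \<in> K" "\<phi> T (x \<gamma> t) \<in> K"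
          using t by (auto simp: x_def R_def return_times_def flow_add)
        show orb: "x \<gamma> t \<in> fst \<gamma>"
          unfolding x_def using flow_in_periodic_orbit periodic_orbitD(2) Pd(1)[OF \<gamma>] by simp
        show per: "\<phi> (period \<gamma>) (x \<gamma> t) = x \<gamma> t" using periodic_orbitD(3)[OF Pd(1)[OF \<gamma>] orb] .
        have "\<phi> (H - T) (\<phi> T (x \<gamma> t)) = \<phi> (H - T) (\<phi> T (\<phi> (- period \<gamma>) (x \<gamma> t)))"
          using period_of_int[OF per, of "-1"] by simp
        also have "\<dots> = \<phi> (H - period \<gamma>) (x \<gamma> t)" by (simp flip: flow_add)
        finally show "\<phi> (H - T) (\<phi> T (x \<gamma> t)) \<in> B"
          using flowB[OF xK(1), of "H - period \<gamma>"] Pd(2,3)[OF \<gamma>] by simp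
      qed
      have FQ: "F \<gamma> t \<in> Q0 \<times> Q1 \<times> {..M}" if \<gamma>: "\<gamma> \<in> P" and t: "t \<in> R \<gamma>" for \<gamma> t
      proof -
        have "(period \<gamma> - H) / \<nu> \<le> W / \<nu>" using Pd(3)[OF \<gamma>] \<nu>(1) by (simp add: divide_right_mono)
        then have "nat \<lfloor>(period \<gamma> - H) / \<nu>\<rfloor> \<le> M" unfolding M_def by (intro nat_mono floor_mono)
        moreover have "x \<gamma> t \<in> B" "\<phi> T (x \<gamma> t) \<in> B" using xd(1,2)[OF \<gamma> t] B(2) by auto
        ultimately show ?thesis using f0(1) f1(1) xd(3)[OF \<gamma> t] by (simp add: F_def)
      qed
      \<comment> \<open>equal labels: same orbit, and points that differ by a short time\<close>
      have same: "\<gamma> = \<gamma>' \<and> (\<exists>r\<in>{-1..1}. x \<gamma>' t' = \<phi> r (x \<gamma> t))"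
        if \<gamma>: "\<gamma> \<in> P" "t \<in> R \<gamma>" and \<gamma>': "\<gamma>' \<in> P" "t' \<in> R \<gamma>'" and eq: "F \<gamma> t = F \<gamma>' t'" for \<gamma> t \<gamma>' t'
      proof -
        have eqs: "f0 (x \<gamma> t) = f0 (x \<gamma>' t')" "f1 (\<phi> T (x \<gamma> t)) = f1 (\<phi> T (x \<gamma>' t'))"
          "nat \<lfloor>(period \<gamma> - H) / \<nu>\<rfloor> = nat \<lfloor>(period \<gamma>' - H) / \<nu>\<rfloor>" using eq by (auto simp: F_def)
        have "\<bar>(period \<gamma> - H) - (period \<gamma>' - H)\<bar> < \<nu>"
          using eqs(3) Pd(2)[OF \<gamma>(1)] Pd(2)[OF \<gamma>'(1)] \<nu>(1) by (intro same_bin_close) auto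
        then have per: "\<bar>period \<gamma> - period \<gamma>'\<bar> < \<nu>" by simp
        have xB: "x \<gamma> t \<in> B" "\<phi> T (x \<gamma> t) \<in> B" "x \<gamma>' t' \<in> B" "\<phi> T (x \<gamma>' t') \<in> B"
          using xd(1,2)[OF \<gamma>] xd(1,2)[OF \<gamma>'] B(2) by auto
        have close: "dist (\<phi> s (x \<gamma> t)) (\<phi> s (x \<gamma>' t')) \<le> \<epsilon>\<^sub>0" if s: "0 \<le> s" "s \<le> H" for s
        proof (cases "s \<le> T")
          case True
          then have "dist (\<phi> s (x \<gamma> t)) (\<phi> s (x \<gamma>' t')) < 4 * \<delta>"
            using f0(2) xB eqs(1) s(1) by auto
          then show ?thesis using \<eta>(3) by simp
        next
          case False
          then have "dist (\<phi> (s - T) (\<phi> T (x \<gamma> t))) (\<phi> (s - T) (\<phi> T (x \<gamma>' t'))) < 4 * \<delta>"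
            using f1(2) xB eqs(2) s(2) xd(3)[OF \<gamma>] xd(3)[OF \<gamma>'] by auto
          then show ?thesis using \<eta>(3) by (simp flip: flow_add)
        qed
        have "\<exists>r\<in>{-1..1}. x \<gamma>' t' = \<phi> r (x \<gamma> t)"
          using Pd[OF \<gamma>(1)] Pd[OF \<gamma>'(1)] H' per \<nu>(2) xd(5)[OF \<gamma>] xd(5)[OF \<gamma>'] close
          by (intro exp(3)[of "period \<gamma>" "period \<gamma>'" _ _ H]) auto
        then obtain r where r: "r \<in> {-1..1}" "x \<gamma>' t' = \<phi> r (x \<gamma> t)" by blast
        moreover have "\<gamma> = \<gamma>'"
        proof (rule periodic_orbit_eqI[OF Pd(1)[OF \<gamma>(1)] Pd(1)[OF \<gamma>'(1)] xd(4)[OF \<gamma>]])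
          show "\<phi> r (x \<gamma> t) \<in> fst \<gamma>'" using xd(4)[OF \<gamma>'] r(2) by simp
          show "\<phi> s (x \<gamma> t) = x \<gamma> t \<Longrightarrow> \<bar>s\<bar> < u \<Longrightarrow> s = 0" for s by (rule u(2)[OF xd(1)[OF \<gamma>]])
          show "\<bar>period \<gamma> - period \<gamma>'\<bar> < u" using per \<nu>(3) by simp
        qed
        ultimately show ?thesis by blast
      qed
      have finF: "finite (F \<gamma> ` R \<gamma>)" if "\<gamma> \<in> P" for \<gamma>
      proof (rule finite_subset)
        show "F \<gamma> ` R \<gamma> \<subseteq> Q0 \<times> Q1 \<times> {..M}" by (intro image_subsetI FQ[OF that])
      qed (use Q0(1) Q1(1) in simp)
      have one: "measure lebesgue (R \<gamma>) \<le> 6 * card (F \<gamma> ` R \<gamma>)" if \<gamma>: "\<gamma> \<in> P" for \<gamma>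
      proof -
        let ?l = "period \<gamma>"
        have l: "?l \<ge> 2" using Pd(2)[OF \<gamma>] H' by simp
        define a where "a = inv_into (R \<gamma>) (F \<gamma>)"
        have "t \<in> (\<Union>(k, m)\<in>F \<gamma> ` R \<gamma> \<times> {-1, 0, 1 :: int}. {a k + of_int m * ?l - 1 .. a k + of_int m * ?l + 1})"
          if t: "t \<in> R \<gamma>" for t
        proof -
          define t0 where "t0 = a (F \<gamma> t)"
          have t0: "t0 \<in> R \<gamma>" "F \<gamma> t0 = F \<gamma> t"
            unfolding t0_def a_def using t by (auto intro: inv_into_into f_inv_into_f)
          from same[OF \<gamma> t0(1) \<gamma> t t0(2)] obtain r where r: "r \<in> {-1..1}" "x \<gamma> t = \<phi> r (x \<gamma> t0)" by blast
          let ?o = "orbit_point \<gamma>"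
          have "\<phi> (t - t0 - r) ?o = \<phi> (- t0 - r) (x \<gamma> t)"
            unfolding x_def flow_add[symmetric] by (simp add: algebra_simps)
          also have "\<dots> = ?o" unfolding r(2) by (simp add: x_def flip: flow_add)
          finally have fixed: "\<phi> (t - t0 - r) ?o = ?o" .
          have per: "\<phi> ?l ?o = ?o" "?l > 0" using periodic_orbitD[OF Pd(1)[OF \<gamma>]] by auto
          obtain q where q: "0 \<le> q" "q < ?l" "\<phi> (t - t0 - r) ?o = \<phi> q ?o"
            "t - t0 - r = of_int \<lfloor>(t - t0 - r) / ?l\<rfloor> * ?l + q"
            by (rule time_mod_period[OF per(2,1)])
          have "q = 0" using Pd(4)[OF \<gamma>] q fixed unfolding primitive_orbit_def
            by (metis less_eq_real_def)
          define m where "m = \<lfloor>(t - t0 - r) / ?l\<rfloor>"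
          have m: "t - t0 - r = of_int m * ?l" using q(4) \<open>q = 0\<close> by (simp add: m_def)
          have "t \<in> {0..?l}" "t0 \<in> {0..?l}" using t t0 by (auto simp: R_def return_times_def)
          then have "\<bar>of_int m * ?l\<bar> < 2 * ?l" using r(1) l unfolding m[symmetric] by auto
          then have "\<bar>of_int m :: real\<bar> < 2" using per(2) by (simp add: abs_mult)
          then have "m \<in> {-1, 0, 1}" by auto
          moreover have "t \<in> {t0 + of_int m * ?l - 1 .. t0 + of_int m * ?l + 1}" using m r(1) by auto
          ultimately show ?thesis using t unfolding t0_def by blast
        qed
        then show ?thesis by (intro measure_lebesgue_le_cover[OF finF[OF \<gamma>], of _ a ?l]) blast
      qed
      have "(\<Sum>\<gamma>\<in>P. measure lebesgue (R \<gamma>)) \<le> (\<Sum>\<gamma>\<in>P. real (6 * card (F \<gamma> ` R \<gamma>)))"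
        by (intro sum_mono one)
      also have "\<dots> = 6 * real (\<Sum>\<gamma>\<in>P. card (F \<gamma> ` R \<gamma>))" by (simp add: sum_distrib_left)
      also have "(\<Sum>\<gamma>\<in>P. card (F \<gamma> ` R \<gamma>)) = card (\<Union>\<gamma>\<in>P. F \<gamma> ` R \<gamma>)"
        using finP finF same by (intro card_UN_disjoint[symmetric]) force+
      also have "\<dots> \<le> card (Q0 \<times> Q1 \<times> {..M})"
        using Q0(1) Q1(1) by (intro card_mono UN_least image_subsetI FQ) auto
      also have "\<dots> = card Q0 * (card Q1 * Suc M)" by (simp add: card_cartesian_product)
      also have "\<dots> \<le> (D * ?N0) * ((D * ?N1) * Suc M)"
        using Q0(2) Q1(2) by (intro mult_le_mono) auto
      finally show "(\<Sum>\<gamma>\<in>P. measure lebesgue (return_times \<phi> T K \<gamma>))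
        \<le> real (6 * D * D * Suc M) * real ?N0 * real ?N1"
        unfolding R_def by (simp add: algebra_simps)
    qed simp
  qed
qed

text \<open>
  The contribution of the orbits that are not primitive. Such an orbit has a period of at most half
  its length, which leaves time for two numbers \<open>j1\<close>, \<open>j2\<close> of order \<open>H\<close> of turns around the closed
  orbits of \<open>p\<close> and \<open>q\<close>. The resulting chord, with the cell of the starting point and the rounded
  values of that period and of the length, determines the orbit and these numbers. One of the two numbers makes up for the order \<open>H\<close>
  of possible rounded periods, and the other one gives the factor \<open>H\<close>.
\<close>

lemma multiple_orbits_count:
  assumes K: "compact K" and p: "p \<in> K" "\<phi> \<theta> p = p" "0 < \<theta>" "\<theta> \<le> W"
    and q: "\<phi> \<theta>' q = q" "0 < \<theta>'" "q \<notin> range (\<lambda>t. \<phi> t p)"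
  obtains \<epsilon> where "\<epsilon> > 0" and "\<And>\<eta> \<delta>. \<lbrakk>0 < \<eta>; \<eta> < \<delta>; 4 * \<delta> \<le> \<epsilon>\<rbrakk> \<Longrightarrow> \<exists>S\<^sub>2>0. \<exists>D\<ge>0.
    \<forall>T\<ge>0. \<forall>H\<ge>4 * T + 2 * W + 1. \<forall>x\<^sub>1\<in>K. \<forall>y\<^sub>1\<in>K. \<forall>S\<ge>S\<^sub>2. \<forall>P. finite P \<longrightarrow>
      P \<subseteq> {\<gamma> \<in> orbits_through \<phi> K H (H + W). \<not> primitive_orbit \<phi> \<gamma>} \<longrightarrow>
      H * real (card P) \<le> D * real (chord_number \<phi> x\<^sub>1 y\<^sub>1 \<eta> (H - T + S) (H - T + S + W) \<delta>)"
proof -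
  have W: "W > 0" using p by simp
  obtain \<epsilon>\<^sub>0 \<nu>\<^sub>0 where exp: "\<epsilon>\<^sub>0 > 0" "\<nu>\<^sub>0 > 0"
    "\<And>x y l l' H. \<lbrakk>l > 0; l' > 0; \<phi> l x = x; \<phi> l' y = y; \<bar>l - l'\<bar> \<le> \<nu>\<^sub>0; 0 \<le> H; l \<le> H + W;
           \<And>s. 0 \<le> s \<Longrightarrow> s \<le> H \<Longrightarrow> dist (\<phi> s x) (\<phi> s y) \<le> \<epsilon>\<^sub>0\<rbrakk> \<Longrightarrow> \<exists>r\<in>{-1..1}. y = \<phi> r x"
    by (rule close_periodic_orbits_coincide[of W]) (use W in auto)
  obtain u where u: "u > 0" "\<And>x t. x \<in> K \<Longrightarrow> \<phi> t x = x \<Longrightarrow> \<bar>t\<bar> < u \<Longrightarrow> t = 0"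
    by (rule periods_bounded_below[OF K]) auto
  define \<nu> where "\<nu> = min (min \<nu>\<^sub>0 u) W"
  have \<nu>: "\<nu> > 0" "\<nu> \<le> \<nu>\<^sub>0" "\<nu> \<le> u" "\<nu> \<le> W" using exp(2) u(1) W by (auto simp: \<nu>_def)
  obtain r C where r: "r > 0" "compact C" "\<And>x. x \<in> K \<Longrightarrow> ball x r \<subseteq> C"
    using compact_neighbourhood[OF K] by metis
  have "range (\<lambda>t. \<phi> t p) \<inter> range (\<lambda>t. \<phi> t q) = {}"
  proof (rule ccontr)
    assume "\<not> ?thesis"
    then obtain s t where "\<phi> s p = \<phi> t q" by auto
    then have "\<phi> (- t) (\<phi> s p) = \<phi> (- t) (\<phi> t q)" by simp
    then have "\<phi> (- t + s) p = q" unfolding flow_add[symmetric] by simp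
    with q(3) show False by blast
  qed
  then have disj: "\<phi> s p \<noteq> \<phi> t q" for s t by blast
  have "compact (range (\<lambda>t. \<phi> t p) \<times> range (\<lambda>t. \<phi> t q))"
    by (intro compact_Times compact_periodic_orbit[OF p(3,2)] compact_periodic_orbit[OF q(2,1)])
  moreover have "continuous_on (range (\<lambda>t. \<phi> t p) \<times> range (\<lambda>t. \<phi> t q)) (\<lambda>z. dist (fst z) (snd z))"
    by (intro continuous_intros)
  ultimately obtain z where z: "z \<in> range (\<lambda>t. \<phi> t p) \<times> range (\<lambda>t. \<phi> t q)"
    "\<forall>w\<in>range (\<lambda>t. \<phi> t p) \<times> range (\<lambda>t. \<phi> t q). dist (fst z) (snd z) \<le> dist (fst w) (snd w)"
    using continuous_attains_inf[of "range (\<lambda>t. \<phi> t p) \<times> range (\<lambda>t. \<phi> t q)"] by blast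
  define d where "d = dist (fst z) (snd z)"
  have d: "d > 0" "d \<le> dist (\<phi> s p) (\<phi> t q)" for s t
    using z disj by (auto simp: d_def)
  have B: "compact (insert q K)" using K by (rule compact_insert)
  show ?thesis
  proof (rule that[of "min (min \<epsilon>\<^sub>0 r) d"])
    show "min (min \<epsilon>\<^sub>0 r) d > 0" using exp(1) r(1) d(1) by simp
    fix \<eta> \<delta> :: real assume \<eta>: "0 < \<eta>" "\<eta> < \<delta>" "4 * \<delta> \<le> min (min \<epsilon>\<^sub>0 r) d"
    have ballC: "ball x \<eta> \<subseteq> C" if "x \<in> K" for x
    proof -
      have "ball x \<eta> \<subseteq> ball x r" using \<eta> by (intro subset_ball) linarith
      then show ?thesis using r(3)[OF that] by blast
    qed
    obtain \<iota> c S\<^sub>1 where fin: "finite (\<iota> ` insert q K)"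
      and c: "\<And>x y. x \<in> insert q K \<Longrightarrow> y \<in> insert q K \<Longrightarrow> \<theta> \<le> c (\<iota> x) (\<iota> y) \<and> c (\<iota> x) (\<iota> y) \<le> S\<^sub>1"
      and glue: "\<And>x t. (\<And>i. i < 6 \<Longrightarrow> x i \<in> insert q K \<and> 0 \<le> t i \<and> \<phi> (t i) (x i) \<in> insert q K) \<Longrightarrow>
        \<exists>z. \<forall>i<6. \<forall>s\<in>{0..t i}. dist (\<phi> (s + start_time \<iota> c x t i) z) (\<phi> s (x i)) < \<eta>"
      by (rule gluing[OF B \<eta>(1) p(3), of 6]) auto
    have S1: "S\<^sub>1 > 0" using c[of p p] p by force
    \<comment> \<open>multiples of the periods that exceed the connecting times\<close>
    define \<theta>1 where "\<theta>1 = real (Suc (nat \<lceil>S\<^sub>1 / \<theta>\<rceil>)) * \<theta>"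
    define \<theta>2 where "\<theta>2 = real (Suc (nat \<lceil>S\<^sub>1 / \<theta>'\<rceil>)) * \<theta>'"
    have big: "S\<^sub>1 \<le> real (Suc (nat \<lceil>S\<^sub>1 / t\<rceil>)) * t" if "t > 0" for t
    proof -
      have "S\<^sub>1 / t \<le> real (Suc (nat \<lceil>S\<^sub>1 / t\<rceil>))" by linarith
      then show ?thesis using that by (simp only: pos_divide_le_eq)
    qed
    have \<theta>1: "S\<^sub>1 \<le> \<theta>1" "\<phi> \<theta>1 p = p"
      using big[OF p(3)] period_of_nat[OF p(2)] unfolding \<theta>1_def by blast+
    have \<theta>2: "S\<^sub>1 \<le> \<theta>2" "\<phi> \<theta>2 q = q"
      using big[OF q(2)] period_of_nat[OF q(1)] unfolding \<theta>2_def by blast+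
    define \<Theta> where "\<Theta> = max \<theta>1 \<theta>2"
    have \<Theta>: "\<Theta> > 0" "\<theta>1 \<le> \<Theta>" "\<theta>2 \<le> \<Theta>" using \<theta>1(1) S1 by (auto simp: \<Theta>_def)
    define M where "M = nat \<lfloor>W / \<nu>\<rfloor>"
    define D where "D = 64 * \<Theta>\<^sup>2 * (1 / \<nu> + 1) * real (Suc M) * real (card (\<iota> ` insert q K))"
    show "\<exists>S\<^sub>2>0. \<exists>D\<ge>0.
      \<forall>T\<ge>0. \<forall>H\<ge>4 * T + 2 * W + 1. \<forall>x\<^sub>1\<in>K. \<forall>y\<^sub>1\<in>K. \<forall>S\<ge>S\<^sub>2. \<forall>P. finite P \<longrightarrow>
        P \<subseteq> {\<gamma> \<in> orbits_through \<phi> K H (H + W). \<not> primitive_orbit \<phi> \<gamma>} \<longrightarrow>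
        H * real (card P) \<le> D * real (chord_number \<phi> x\<^sub>1 y\<^sub>1 \<eta> (H - T + S) (H - T + S + W) \<delta>)"
    proof (rule exI[of _ "5 * S\<^sub>1"], rule conjI, use S1 in simp, rule exI[of _ D], intro conjI allI impI ballI)
      show "0 \<le> D" using \<nu>(1) by (simp add: D_def)
      fix T H x1 y1 S and P :: "('m set \<times> real) set"
      assume T: "0 \<le> T" and H: "4 * T + 2 * W + 1 \<le> H" and xy: "x1 \<in> K" "y1 \<in> K"
        and S: "5 * S\<^sub>1 \<le> S" and finP: "finite P"
        and P: "P \<subseteq> {\<gamma> \<in> orbits_through \<phi> K H (H + W). \<not> primitive_orbit \<phi> \<gamma>}"
      let ?N = "chord_number \<phi> x1 y1 \<eta> (H - T + S) (H - T + S + W) \<delta>"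
      have H1: "H \<ge> 1" "H \<ge> W" using H T W by auto
      have "\<delta> > 0" using \<eta> by simp
      obtain E where E: "finite E" "card E \<le> ?N"
        "chords \<phi> x1 y1 \<eta> (H - T + S) (H - T + S + W) \<subseteq> (\<Union>z\<in>E. dynamical_ball \<phi> z \<delta> (H - T + S))"
        by (rule chord_net[OF r(2) ballC[OF xy(1)] \<open>\<delta> > 0\<close>])
      have Pd: "\<gamma> \<in> periodic_orbits \<phi>" "H \<le> period \<gamma>" "period \<gamma> \<le> H + W" "fst \<gamma> \<inter> K \<noteq> {}"
        "\<not> primitive_orbit \<phi> \<gamma>" if "\<gamma> \<in> P" for \<gamma> using that P by (auto simp: orbits_through_def)
      define x where "x \<gamma> = (SOME x. x \<in> fst \<gamma> \<and> x \<in> K)" for \<gamma> :: "'m set \<times> real"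
      have x: "x \<gamma> \<in> fst \<gamma> \<and> x \<gamma> \<in> K" if "\<gamma> \<in> P" for \<gamma>
        unfolding x_def by (rule someI_ex) (use Pd(4)[OF that] in blast)
      define v where "v \<gamma> = (SOME v. 0 < v \<and> v \<le> (H + W) / 2 \<and> \<phi> v (x \<gamma>) = x \<gamma>)" for \<gamma> :: "'m set \<times> real"
      have v: "0 < v \<gamma> \<and> v \<gamma> \<le> (H + W) / 2 \<and> \<phi> (v \<gamma>) (x \<gamma>) = x \<gamma>" if \<gamma>: "\<gamma> \<in> P" for \<gamma>
        unfolding v_def
      proof (rule someI_ex)
        let ?o = "orbit_point \<gamma>" and ?l = "period \<gamma>"
        obtain w where w: "0 < w" "w < ?l" "\<phi> w ?o = ?o"
          using Pd(5)[OF \<gamma>] unfolding primitive_orbit_def by blast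
        have orb: "?o \<in> fst \<gamma>" by (rule periodic_orbitD(2)[OF Pd(1)[OF \<gamma>]])
        obtain s where s: "x \<gamma> = \<phi> s ?o"
          using periodic_orbitD(4)[OF Pd(1)[OF \<gamma>] orb] x[OF \<gamma>] by blast
        have per: "\<phi> ?l (x \<gamma>) = x \<gamma>" using periodic_orbitD(3)[OF Pd(1)[OF \<gamma>]] x[OF \<gamma>] by blast
        have wx: "\<phi> w (x \<gamma>) = x \<gamma>" unfolding s by (rule period_shift[OF w(3)])
        have "\<phi> (?l - w) (x \<gamma>) = \<phi> (?l - w) (\<phi> w (x \<gamma>))" by (simp only: wx)
        also have "\<dots> = x \<gamma>" by (simp add: per flip: flow_add)
        finally have lw: "\<phi> (?l - w) (x \<gamma>) = x \<gamma>" .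
        show "\<exists>v. 0 < v \<and> v \<le> (H + W) / 2 \<and> \<phi> v (x \<gamma>) = x \<gamma>"
        proof (cases "w \<le> ?l / 2")
          case True
          then show ?thesis using w(1) wx Pd(3)[OF \<gamma>] by (intro exI[of _ w]) auto
        next
          case False
          then show ?thesis using w(2) lw Pd(3)[OF \<gamma>] by (intro exI[of _ "?l - w"]) auto
        qed
      qed
      define J where "J = nat \<lfloor>H / (8 * \<Theta>)\<rfloor>"
      have J: "real j * \<theta>1 \<le> H / 8" "real j * \<theta>2 \<le> H / 8" if "j \<le> J" for j
      proof -
        have "real j \<le> H / (8 * \<Theta>)" using that H1(1) \<Theta>(1) by (simp add: J_def le_nat_iff le_floor_iff)
        then have *: "real j * \<Theta> \<le> H / 8" using \<Theta>(1) by (simp add: field_simps)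
        show "real j * \<theta>1 \<le> H / 8" using * mult_left_mono[OF \<Theta>(2), of "real j"] by simp
        show "real j * \<theta>2 \<le> H / 8" using * mult_left_mono[OF \<Theta>(3), of "real j"] by simp
      qed
      define a1 where "a1 \<gamma> = c (\<iota> x1) (\<iota> (x \<gamma>)) + v \<gamma> + c (\<iota> (x \<gamma>)) (\<iota> p)" for \<gamma>
      define a2 where "a2 \<gamma> j1 = a1 \<gamma> + real j1 * \<theta>1 + c (\<iota> p) (\<iota> q)" for \<gamma> and j1 :: nat
      define a3 where "a3 \<gamma> j1 j2 = a2 \<gamma> j1 + real j2 * \<theta>2 + c (\<iota> q) (\<iota> p)" for \<gamma> and j1 j2 :: nat
      define chord where "chord \<gamma> j1 j2 e \<longleftrightarrow>
          (\<forall>s\<in>{0..v \<gamma>}. dist (\<phi> (s + c (\<iota> x1) (\<iota> (x \<gamma>))) e) (\<phi> s (x \<gamma>)) < 2 * \<delta>) \<and>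
          (\<forall>s\<in>{0..real j1 * \<theta>1}. dist (\<phi> (s + a1 \<gamma>) e) (\<phi> s p) < 2 * \<delta>) \<and>
          (\<forall>s\<in>{0..real j2 * \<theta>2}. dist (\<phi> (s + a2 \<gamma> j1) e) (\<phi> s q) < 2 * \<delta>) \<and>
          dist (\<phi> (a3 \<gamma> j1 j2) e) p < 2 * \<delta>" for \<gamma> j1 j2 e
      have ex_chord: "\<exists>e. e \<in> E \<and> chord \<gamma> j1 j2 e" if \<gamma>: "\<gamma> \<in> P" and j: "j1 \<le> J" "j2 \<le> J" for \<gamma> j1 j2
      proof -
        note [simp] = conjunct1[OF x[OF \<gamma>]] conjunct2[OF x[OF \<gamma>]]
        define c0 where "c0 = c (\<iota> x1) (\<iota> (x \<gamma>))"
        define c1 where "c1 = c (\<iota> (x \<gamma>)) (\<iota> p)"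
        define c2 where "c2 = c (\<iota> p) (\<iota> q)"
        define c3 where "c3 = c (\<iota> q) (\<iota> p)"
        define c4 where "c4 = c (\<iota> p) (\<iota> y1)"
        have cs: "\<theta> \<le> c0" "c0 \<le> S\<^sub>1" "\<theta> \<le> c1" "c1 \<le> S\<^sub>1" "\<theta> \<le> c2" "c2 \<le> S\<^sub>1" "\<theta> \<le> c3" "c3 \<le> S\<^sub>1"
          "\<theta> \<le> c4" "c4 \<le> S\<^sub>1"
          unfolding c0_def c1_def c2_def c3_def c4_def using c xy p(1) x[OF \<gamma>] by auto
        define A where "A = a3 \<gamma> j1 j2 + c4"
        have Ad: "A = c0 + v \<gamma> + c1 + real j1 * \<theta>1 + c2 + real j2 * \<theta>2 + c3 + c4"
          by (simp add: A_def a3_def a2_def a1_def c0_def c1_def c2_def c3_def)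
        have nn: "0 \<le> real j1 * \<theta>1" "0 \<le> real j2 * \<theta>2" using \<theta>1(1) \<theta>2(1) S1 by auto
        have A_le: "A \<le> H - T + S"
        proof -
          have "H / 2 + W / 2 + H / 8 + H / 8 \<le> H - T" using H by simp
          moreover have "v \<gamma> \<le> H / 2 + W / 2" using v[OF \<gamma>] by (simp add: add_divide_distrib)
          ultimately show ?thesis using Ad cs S J[OF j(1)] J[OF j(2)] by linarith
        qed
        \<comment> \<open>the number of final turns around the orbit of \<open>p\<close> that brings the total time into the window\<close>
        define n where "n = nat \<lceil>(H - T + S - A) / \<theta>\<rceil>"
        have "0 \<le> (H - T + S - A) / \<theta>" using A_le p(3) by simp
        then have "(H - T + S - A) / \<theta> \<le> real n" "real n \<le> (H - T + S - A) / \<theta> + 1"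
          unfolding n_def by linarith+
        then have n1: "H - T + S \<le> A + real n * \<theta>" and n2: "A + real n * \<theta> \<le> H - T + S + \<theta>"
          using p(3) by (simp_all add: field_simps)
        define X where "X = (\<lambda>_ :: nat. y1)(0 := x1, 1 := x \<gamma>, 2 := p, 3 := q, 4 := p)"
        define U where "U = (\<lambda>_ :: nat. 0 :: real)(1 := v \<gamma>, 2 := real j1 * \<theta>1, 3 := real j2 * \<theta>2, 4 := real n * \<theta>)"
        have loops: "\<phi> (real n * \<theta>) p = p" "\<phi> (real j1 * \<theta>1) p = p" "\<phi> (real j2 * \<theta>2) q = q"
          "\<phi> (v \<gamma>) (x \<gamma>) = x \<gamma>"
          using period_of_nat p(2) \<theta>1(2) \<theta>2(2) v[OF \<gamma>] by auto
        have "\<exists>z. \<forall>i<6. \<forall>s\<in>{0..U i}. dist (\<phi> (s + start_time \<iota> c X U i) z) (\<phi> s (X i)) < \<eta>"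
        proof (rule glue)
          fix i :: nat assume "i < 6"
          then consider "i = 0" | "i = 1" | "i = 2" | "i = 3" | "i = 4" | "i = 5" by linarith
          then show "X i \<in> insert q K \<and> 0 \<le> U i \<and> \<phi> (U i) (X i) \<in> insert q K"
            using x[OF \<gamma>] v[OF \<gamma>] xy p nn loops by cases (auto simp: X_def U_def)
        qed
        then obtain z where "\<forall>i<6. \<forall>s\<in>{0..U i}. dist (\<phi> (s + start_time \<iota> c X U i) z) (\<phi> s (X i)) < \<eta>"
          by (rule exE)
        then have z: "dist (\<phi> (s + start_time \<iota> c X U i) z) (\<phi> s (X i)) < \<eta>"
          if "i < 6" "0 \<le> s" "s \<le> U i" for i s using that by simp
        have st: "start_time \<iota> c X U 0 = 0" "start_time \<iota> c X U 1 = c0" "start_time \<iota> c X U 2 = a1 \<gamma>"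
          "start_time \<iota> c X U 3 = a2 \<gamma> j1" "start_time \<iota> c X U 4 = a3 \<gamma> j1 j2"
          "start_time \<iota> c X U 5 = A + real n * \<theta>"
          by (simp_all add: start_time_def X_def U_def eval_nat_numeral loops c0_def a1_def a2_def a3_def
              A_def c4_def)
        have XU: "X 0 = x1" "X 1 = x \<gamma>" "X 2 = p" "X 3 = q" "X 4 = p" "X 5 = y1"
          "U 0 = 0" "U 1 = v \<gamma>" "U 2 = real j1 * \<theta>1" "U 3 = real j2 * \<theta>2" "U 4 = real n * \<theta>" "U 5 = 0"
          by (simp_all add: X_def U_def)
        have "dist z x1 < \<eta>" using z[of 0 0] st XU by simp
        moreover have "dist (\<phi> (A + real n * \<theta>) z) y1 < \<eta>" using z[of 5 0] st XU by simp
        moreover have "A + real n * \<theta> \<in> {H - T + S..H - T + S + W}" using n1 n2 p(4) by simp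
        ultimately have "z \<in> chords \<phi> x1 y1 \<eta> (H - T + S) (H - T + S + W)"
          unfolding chords_def mem_Collect_eq mem_ball by (auto simp: dist_commute disjoint_iff)
        then obtain e where e: "e \<in> E" "z \<in> dynamical_ball \<phi> e \<delta> (H - T + S)" using E(3) by blast
        have close: "dist (\<phi> t e) w < 2 * \<delta>"
          if "0 \<le> t" "t \<le> H - T + S" "dist (\<phi> t z) w < \<eta>" for t w
        proof -
          have "dist (\<phi> t e) (\<phi> t z) < \<delta>" using e(2) that(1,2) unfolding dynamical_ball_def by simp
          then show ?thesis using that(3) \<eta>(2) dist_triangle[of "\<phi> t e" w "\<phi> t z"] by linarith
        qed
        have bound: "0 \<le> a3 \<gamma> j1 j2" "a3 \<gamma> j1 j2 \<le> H - T + S" "c0 + v \<gamma> \<le> a3 \<gamma> j1 j2"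
          "0 \<le> a1 \<gamma>" "a1 \<gamma> + real j1 * \<theta>1 \<le> a3 \<gamma> j1 j2" "0 \<le> a2 \<gamma> j1"
          "a2 \<gamma> j1 + real j2 * \<theta>2 \<le> a3 \<gamma> j1 j2" "0 \<le> c0"
          using A_le nn cs p(3) v[OF \<gamma>] unfolding A_def a3_def a2_def a1_def
            c0_def[symmetric] c1_def[symmetric] c2_def[symmetric] c3_def[symmetric]
          by linarith+
        have "chord \<gamma> j1 j2 e"
          unfolding chord_def c0_def[symmetric]
        proof (intro conjI ballI)
          fix s assume s: "s \<in> {0..v \<gamma>}"
          show "dist (\<phi> (s + c0) e) (\<phi> s (x \<gamma>)) < 2 * \<delta>"
            by (rule close) (use s bound z[of 1 s] st XU in auto)
        next
          fix s assume s: "s \<in> {0..real j1 * \<theta>1}"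
          show "dist (\<phi> (s + a1 \<gamma>) e) (\<phi> s p) < 2 * \<delta>"
            by (rule close) (use s bound z[of 2 s] st XU in auto)
        next
          fix s assume s: "s \<in> {0..real j2 * \<theta>2}"
          show "dist (\<phi> (s + a2 \<gamma> j1) e) (\<phi> s q) < 2 * \<delta>"
            by (rule close) (use s bound z[of 3 s] st XU in auto)
        next
          show "dist (\<phi> (a3 \<gamma> j1 j2) e) p < 2 * \<delta>"
            by (rule close) (use bound z[of 4 0] st XU p(3) in auto)
        qed
        with e(1) show ?thesis by blast
      qed
      define e where "e \<gamma> j1 j2 = (SOME e. e \<in> E \<and> chord \<gamma> j1 j2 e)" for \<gamma> j1 j2
      have e: "e \<gamma> j1 j2 \<in> E \<and> chord \<gamma> j1 j2 (e \<gamma> j1 j2)" if "\<gamma> \<in> P" "j1 \<le> J" "j2 \<le> J" for \<gamma> j1 j2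
        unfolding e_def by (rule someI_ex[OF ex_chord[OF that]])
      define F where "F = (\<lambda>(\<gamma>, j1, j2). (nat \<lfloor>v \<gamma> / \<nu>\<rfloor>, nat \<lfloor>(period \<gamma> - H) / \<nu>\<rfloor>, \<iota> (x \<gamma>), e \<gamma> j1 j2))"
      define M' where "M' = nat \<lfloor>H / \<nu>\<rfloor>"
      have FQ: "F (\<gamma>, j1, j2) \<in> {..M'} \<times> {..M} \<times> \<iota> ` insert q K \<times> E"
        if \<gamma>: "\<gamma> \<in> P" and j: "j1 \<le> J" "j2 \<le> J" for \<gamma> j1 j2
      proof -
        have "(period \<gamma> - H) / \<nu> \<le> W / \<nu>" using Pd(3)[OF \<gamma>] \<nu>(1) by (simp add: divide_right_mono)
        then have "nat \<lfloor>(period \<gamma> - H) / \<nu>\<rfloor> \<le> M" unfolding M_def by (intro nat_mono floor_mono)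
        moreover have "v \<gamma> / \<nu> \<le> H / \<nu>" using v[OF \<gamma>] H1(2) \<nu>(1) by (intro divide_right_mono) auto
        then have "nat \<lfloor>v \<gamma> / \<nu>\<rfloor> \<le> M'" unfolding M'_def by (intro nat_mono floor_mono)
        ultimately show ?thesis using e[OF \<gamma> j] x[OF \<gamma>] by (simp add: F_def)
      qed
      have far: "\<not> (dist (\<phi> t w) (\<phi> s p) < 2 * \<delta> \<and> dist (\<phi> t w) (\<phi> s' q) < 2 * \<delta>)" for t w s s'
        using d(2)[of s s'] \<eta>(3) dist_triangle3[of "\<phi> s p" "\<phi> s' q" "\<phi> t w"] by auto
      have same: "\<gamma> = \<gamma>'"
        if \<gamma>: "\<gamma> \<in> P" and j: "j1 \<le> J" "j2 \<le> J" and \<gamma>': "\<gamma>' \<in> P" and j': "j1' \<le> J" "j2' \<le> J"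
          and eq: "F (\<gamma>, j1, j2) = F (\<gamma>', j1', j2')" for \<gamma> j1 j2 \<gamma>' j1' j2'
      proof -
        have eqs: "nat \<lfloor>v \<gamma> / \<nu>\<rfloor> = nat \<lfloor>v \<gamma>' / \<nu>\<rfloor>" "\<iota> (x \<gamma>) = \<iota> (x \<gamma>')" "e \<gamma> j1 j2 = e \<gamma>' j1' j2'"
          "nat \<lfloor>(period \<gamma> - H) / \<nu>\<rfloor> = nat \<lfloor>(period \<gamma>' - H) / \<nu>\<rfloor>" using eq by (auto simp: F_def)
        have "\<bar>(period \<gamma> - H) - (period \<gamma>' - H)\<bar> < \<nu>"
          using eqs(4) Pd(2)[OF \<gamma>] Pd(2)[OF \<gamma>'] \<nu>(1) by (intro same_bin_close) auto
        then have per: "\<bar>period \<gamma> - period \<gamma>'\<bar> < u" using \<nu>(3) by simp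
        have vv: "\<bar>v \<gamma> - v \<gamma>'\<bar> < \<nu>"
          using eqs(1) v[OF \<gamma>] v[OF \<gamma>'] \<nu>(1) by (intro same_bin_close) auto
        have close: "dist (\<phi> s (x \<gamma>)) (\<phi> s (x \<gamma>')) \<le> \<epsilon>\<^sub>0" if s: "0 \<le> s" "s \<le> min (v \<gamma>) (v \<gamma>')" for s
        proof -
          let ?y = "\<phi> (s + c (\<iota> x1) (\<iota> (x \<gamma>'))) (e \<gamma>' j1' j2')"
          have "dist ?y (\<phi> s (x \<gamma>)) < 2 * \<delta>"
            using e[OF \<gamma> j] s unfolding chord_def eqs by auto
          moreover have "dist ?y (\<phi> s (x \<gamma>')) < 2 * \<delta>"
            using e[OF \<gamma>' j'] s unfolding chord_def by auto
          ultimately show ?thesis using \<eta>(3) dist_triangle3[of "\<phi> s (x \<gamma>)" "\<phi> s (x \<gamma>')" ?y] by linarith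
        qed
        have "\<exists>r\<in>{-1..1}. x \<gamma>' = \<phi> r (x \<gamma>)"
          by (rule exp(3)[of "v \<gamma>" "v \<gamma>'" _ _ "min (v \<gamma>) (v \<gamma>')"])
            (use v[OF \<gamma>] v[OF \<gamma>'] vv \<nu> close in auto)
        then obtain r where r: "x \<gamma>' = \<phi> r (x \<gamma>)" by blast
        show "\<gamma> = \<gamma>'"
        proof (rule periodic_orbit_eqI[OF Pd(1)[OF \<gamma>] Pd(1)[OF \<gamma>']])
          show "x \<gamma> \<in> fst \<gamma>" "\<phi> r (x \<gamma>) \<in> fst \<gamma>'" using x[OF \<gamma>] x[OF \<gamma>'] r by auto
          show "\<phi> s (x \<gamma>) = x \<gamma> \<Longrightarrow> \<bar>s\<bar> < u \<Longrightarrow> s = 0" for s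
            using u(2) conjunct2[OF x[OF \<gamma>]] by blast
          show "\<bar>period \<gamma> - period \<gamma>'\<bar> < u" by (rule per)
        qed
      qed
      \<comment> \<open>a chord that has left one closed orbit for the other one is not still turning around it\<close>
      have not_less1: "\<not> j1 < j1'"
        if ch: "chord \<gamma> j1 j2 w" "chord \<gamma> j1' j2' w" for \<gamma> j1 j2 j1' j2' w
      proof
        assume "j1 < j1'"
        then have "real j1 * \<theta>1 + \<theta>1 \<le> real j1' * \<theta>1"
          using mult_right_mono[of "real (Suc j1)" "real j1'" \<theta>1] \<theta>1(1) S1 by (simp add: distrib_right)
        moreover have "\<theta> \<le> c (\<iota> p) (\<iota> q) \<and> c (\<iota> p) (\<iota> q) \<le> S\<^sub>1" using p(1) by (intro c) auto
        ultimately have s: "real j1 * \<theta>1 + c (\<iota> p) (\<iota> q) \<in> {0..real j1' * \<theta>1}"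
          using \<theta>1(1) S1 p(3) by auto
        have "dist (\<phi> (real j1 * \<theta>1 + c (\<iota> p) (\<iota> q) + a1 \<gamma>) w) (\<phi> (real j1 * \<theta>1 + c (\<iota> p) (\<iota> q)) p) < 2 * \<delta>"
          using ch(2) s unfolding chord_def by blast
        moreover have "real j1 * \<theta>1 + c (\<iota> p) (\<iota> q) + a1 \<gamma> = 0 + a2 \<gamma> j1" by (simp add: a2_def)
        moreover have "0 \<in> {0..real j2 * \<theta>2}" using \<theta>2(1) S1 by simp
        then have "dist (\<phi> (0 + a2 \<gamma> j1) w) (\<phi> 0 q) < 2 * \<delta>" using ch(1) unfolding chord_def by blast
        ultimately show False using far by metis
      qed
      have not_less2: "\<not> j2 < j2'"
        if ch: "chord \<gamma> j1 j2 w" "chord \<gamma> j1 j2' w" for \<gamma> j1 j2 j2' w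
      proof
        assume "j2 < j2'"
        then have "real j2 * \<theta>2 + \<theta>2 \<le> real j2' * \<theta>2"
          using mult_right_mono[of "real (Suc j2)" "real j2'" \<theta>2] \<theta>2(1) S1 by (simp add: distrib_right)
        moreover have "\<theta> \<le> c (\<iota> q) (\<iota> p) \<and> c (\<iota> q) (\<iota> p) \<le> S\<^sub>1" using p(1) by (intro c) auto
        ultimately have s: "real j2 * \<theta>2 + c (\<iota> q) (\<iota> p) \<in> {0..real j2' * \<theta>2}"
          using \<theta>2(1) S1 p(3) by auto
        have "dist (\<phi> (real j2 * \<theta>2 + c (\<iota> q) (\<iota> p) + a2 \<gamma> j1) w) (\<phi> (real j2 * \<theta>2 + c (\<iota> q) (\<iota> p)) q) < 2 * \<delta>"
          using ch(2) s unfolding chord_def by blast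
        moreover have "real j2 * \<theta>2 + c (\<iota> q) (\<iota> p) + a2 \<gamma> j1 = a3 \<gamma> j1 j2" by (simp add: a3_def)
        moreover have "dist (\<phi> (a3 \<gamma> j1 j2) w) (\<phi> 0 p) < 2 * \<delta>" using ch(1) unfolding chord_def by simp
        ultimately show False using far by metis
      qed
      have inj: "inj_on F (P \<times> {..J} \<times> {..J})"
      proof (rule inj_onI)
        fix g g' assume g: "g \<in> P \<times> {..J} \<times> {..J}" "g' \<in> P \<times> {..J} \<times> {..J}" and eq: "F g = F g'"
        obtain \<gamma> j1 j2 where g1: "g = (\<gamma>, j1, j2)" by (cases g) auto
        obtain \<gamma>' j1' j2' where g2: "g' = (\<gamma>', j1', j2')" by (cases g') auto
        have \<gamma>: "\<gamma> \<in> P" "j1 \<le> J" "j2 \<le> J" and \<gamma>': "\<gamma>' \<in> P" "j1' \<le> J" "j2' \<le> J"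
          using g unfolding g1 g2 by auto
        have "\<gamma> = \<gamma>'" using same[OF \<gamma> \<gamma>'] eq unfolding g1 g2 by blast
        moreover have "e \<gamma> j1 j2 = e \<gamma>' j1' j2'" using eq by (simp add: F_def g1 g2)
        ultimately have ch: "chord \<gamma> j1 j2 (e \<gamma> j1 j2)" "chord \<gamma> j1' j2' (e \<gamma> j1 j2)"
          using e[OF \<gamma>] e[OF \<gamma>'] by auto
        have "j1 = j1'" using not_less1[OF ch] not_less1[OF ch(2,1)] by simp
        moreover have "j2 = j2'" using not_less2[of \<gamma> j1 j2 _ j2'] not_less2[of \<gamma> j1 j2' _ j2] ch
          unfolding \<open>j1 = j1'\<close> by (metis linorder_neqE_nat)
        ultimately show "g = g'" using \<open>\<gamma> = \<gamma>'\<close> by (simp add: g1 g2)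
      qed
      have "card (P \<times> {..J} \<times> {..J}) \<le> card ({..M'} \<times> {..M} \<times> \<iota> ` insert q K \<times> E)"
      proof (rule card_inj_on_le[OF inj])
        show "F ` (P \<times> {..J} \<times> {..J}) \<subseteq> {..M'} \<times> {..M} \<times> \<iota> ` insert q K \<times> E"
          using FQ by (intro image_subsetI) (auto simp del: image_insert)
        show "finite ({..M'} \<times> {..M} \<times> \<iota> ` insert q K \<times> E)" using fin E(1) by blast
      qed
      then have "card P * (Suc J * Suc J) \<le> Suc M' * (Suc M * (card (\<iota> ` insert q K) * card E))"
        by (simp only: card_cartesian_product card_atMost)
      also have "\<dots> \<le> Suc M' * (Suc M * (card (\<iota> ` insert q K) * ?N))"
        using E(2) by (intro mult_le_mono) auto
      finally have "real (card P * (Suc J * Suc J)) \<le> real (Suc M' * (Suc M * (card (\<iota> ` insert q K) * ?N)))"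
        by (simp only: of_nat_le_iff)
      then have main: "real (card P) * (real (Suc J))\<^sup>2
          \<le> real (Suc M') * (real (Suc M) * real (card (\<iota> ` insert q K)) * real ?N)"
        by (simp only: of_nat_mult power2_eq_square mult.assoc)
      have "real (Suc M') \<le> H / \<nu> + 1" using H1(1) \<nu>(1) by (simp add: M'_def)
      also have "\<dots> \<le> H * (1 / \<nu> + 1)" using H1(1) by (simp add: distrib_left)
      finally have M': "real (Suc M') \<le> H * (1 / \<nu> + 1)" .
      have "H / (8 * \<Theta>) \<le> real (Suc J)" unfolding J_def by linarith
      then have "(H / (8 * \<Theta>))\<^sup>2 \<le> (real (Suc J))\<^sup>2" using H1(1) \<Theta>(1) by (intro power_mono) auto
      then have "real (card P) * (H / (8 * \<Theta>))\<^sup>2 \<le> real (card P) * (real (Suc J))\<^sup>2"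
        by (intro mult_left_mono) auto
      also note main
      also have "real (Suc M') * (real (Suc M) * real (card (\<iota> ` insert q K)) * real ?N)
          \<le> H * (1 / \<nu> + 1) * (real (Suc M) * real (card (\<iota> ` insert q K)) * real ?N)"
        using M' by (intro mult_right_mono) auto
      finally have "real (card P) * (H / (8 * \<Theta>))\<^sup>2 * (64 * \<Theta>\<^sup>2)
          \<le> H * (1 / \<nu> + 1) * (real (Suc M) * real (card (\<iota> ` insert q K)) * real ?N) * (64 * \<Theta>\<^sup>2)"
        by (intro mult_right_mono) auto
      moreover have "(H / (8 * \<Theta>))\<^sup>2 * (64 * \<Theta>\<^sup>2) = H * H"
        using \<Theta>(1) by (simp add: power2_eq_square field_simps)
      ultimately have "H * (H * real (card P)) \<le> H * (D * real ?N)"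
        unfolding D_def by (simp only: mult.assoc mult.left_commute mult.commute)
      then show "H * real (card P) \<le> D * real ?N" using H1(1) by simp
    qed
  qed
qed

section \<open>A second closed orbit\<close>

text \<open>
  If the manifold is a single closed orbit, the number of periodic orbits with period in a window
  is bounded, so all entropies vanish.
\<close>

lemma entropies_single_orbit:
  assumes p: "\<phi> \<theta> p = p" "0 < \<theta>" and all: "range (\<lambda>t. \<phi> t p) = UNIV"
  shows "gurevic_entropy \<phi> = 0" and "gurevic_entropy_at_infinity \<phi> = 0"
proof -
  have comp: "compact (UNIV :: 'm set)" using compact_periodic_orbit[OF p(2,1)] all by simp
  obtain u where u: "u > 0" "\<And>x t. x \<in> UNIV \<Longrightarrow> \<phi> t x = x \<Longrightarrow> \<bar>t\<bar> < u \<Longrightarrow> t = 0"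
    by (rule periods_bounded_below[OF comp]) auto
  have bound: "finite (orbits_through \<phi> K l (l + \<sigma>)) \<and> card (orbits_through \<phi> K l (l + \<sigma>)) \<le> Suc (nat \<lfloor>\<sigma> / u\<rfloor>)"
    if "\<sigma> > 0" for K l \<sigma>
  proof -
    let ?P = "orbits_through \<phi> K l (l + \<sigma>)"
    have P: "\<gamma> \<in> periodic_orbits \<phi>" "l \<le> period \<gamma>" "period \<gamma> \<le> l + \<sigma>" "p \<in> fst \<gamma>" if "\<gamma> \<in> ?P" for \<gamma>
    proof -
      show \<gamma>: "\<gamma> \<in> periodic_orbits \<phi>" "l \<le> period \<gamma>" "period \<gamma> \<le> l + \<sigma>"
        using that by (auto simp: orbits_through_def)
      obtain t where t: "orbit_point \<gamma> = \<phi> t p" using all by (metis UNIV_I imageE)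
      have "\<phi> (- t) (orbit_point \<gamma>) \<in> fst \<gamma>"
        by (rule flow_in_periodic_orbit[OF \<gamma>(1) periodic_orbitD(2)[OF \<gamma>(1)]])
      then show "p \<in> fst \<gamma>" unfolding t flow_add[symmetric] by simp
    qed
    let ?f = "\<lambda>\<gamma> :: 'm set \<times> real. nat \<lfloor>(period \<gamma> - l) / u\<rfloor>"
    have inj: "inj_on ?f ?P"
    proof (rule inj_onI)
      fix \<gamma> \<gamma>' assume \<gamma>: "\<gamma> \<in> ?P" "\<gamma>' \<in> ?P" and eq: "?f \<gamma> = ?f \<gamma>'"
      have "\<bar>(period \<gamma> - l) - (period \<gamma>' - l)\<bar> < u"
        using eq P(2)[OF \<gamma>(1)] P(2)[OF \<gamma>(2)] u(1) by (intro same_bin_close) auto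
      then have per: "\<bar>period \<gamma> - period \<gamma>'\<bar> < u" by simp
      show "\<gamma> = \<gamma>'"
        by (rule periodic_orbit_eqI[OF P(1)[OF \<gamma>(1)] P(1)[OF \<gamma>(2)] P(4)[OF \<gamma>(1)], where r = 0, OF _ _ per])
          (use P(4)[OF \<gamma>(2)] u(2) in auto)
    qed
    have sub: "?f ` ?P \<subseteq> {..nat \<lfloor>\<sigma> / u\<rfloor>}"
    proof (rule image_subsetI)
      fix \<gamma> assume "\<gamma> \<in> ?P"
      then have "(period \<gamma> - l) / u \<le> \<sigma> / u" using P(3)[of \<gamma>] u(1) by (simp add: divide_right_mono)
      then have "?f \<gamma> \<le> nat \<lfloor>\<sigma> / u\<rfloor>" by (intro nat_mono floor_mono)
      then show "?f \<gamma> \<in> {..nat \<lfloor>\<sigma> / u\<rfloor>}" by simp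
    qed
    have "finite ?P" by (rule inj_on_finite[OF inj sub]) simp
    moreover have "card ?P \<le> card {..nat \<lfloor>\<sigma> / u\<rfloor>}" by (rule card_inj_on_le[OF inj sub]) simp
    ultimately show ?thesis by simp
  qed
  have thr: "growth_rate (\<lambda>l. orbits_through \<phi> K l (l + \<sigma>)) = 0" if "\<sigma> > 0" for K \<sigma>
    using bound[OF that] by (intro growth_rate_bounded[where N = "Suc (nat \<lfloor>\<sigma> / u\<rfloor>)"]) simp
  have rare: "growth_rate (\<lambda>l. orbits_rarely_in \<phi> K \<alpha> l (l + \<sigma>)) = 0" if "\<sigma> > 0" for K \<alpha> \<sigma>
  proof (rule growth_rate_bounded[where N = "Suc (nat \<lfloor>\<sigma> / u\<rfloor>)"])
    fix l
    have "card (orbits_rarely_in \<phi> K \<alpha> l (l + \<sigma>)) \<le> card (orbits_through \<phi> K l (l + \<sigma>))"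
      using bound[OF that] by (intro card_mono) (auto simp: orbits_rarely_in_def)
    then show "card (orbits_rarely_in \<phi> K \<alpha> l (l + \<sigma>)) \<le> Suc (nat \<lfloor>\<sigma> / u\<rfloor>)"
      using bound[OF that, of K l] by linarith
  qed
  show "gurevic_entropy \<phi> = 0"
    unfolding gurevic_entropy_def
  proof (rule the_equality)
    show "\<forall>K \<sigma>. compact K \<and> interior K \<noteq> {} \<and> \<sigma> > 0 \<longrightarrow>
        growth_rate (\<lambda>L. orbits_through \<phi> K L (L + \<sigma>)) = 0" using thr by blast
    fix h assume h: "\<forall>K \<sigma>. compact K \<and> interior K \<noteq> {} \<and> \<sigma> > 0 \<longrightarrow>
        growth_rate (\<lambda>L. orbits_through \<phi> K L (L + \<sigma>)) = h"
    show "h = 0" using h[rule_format, of UNIV 1] comp thr[of 1 UNIV] by simp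
  qed
  have out: "gurevic_entropy_outside \<phi> K \<alpha> = 0" for K \<alpha>
    unfolding gurevic_entropy_outside_def
  proof (rule the_equality)
    show "\<forall>\<sigma>>0. growth_rate (\<lambda>L. orbits_rarely_in \<phi> K \<alpha> L (L + \<sigma>)) = 0" using rare by blast
    fix h assume h: "\<forall>\<sigma>>0. growth_rate (\<lambda>L. orbits_rarely_in \<phi> K \<alpha> L (L + \<sigma>)) = h"
    show "h = 0" using h[rule_format, of 1] rare[of 1 K \<alpha>] by simp
  qed
  have "Lim (at_right 0) (\<lambda>\<alpha> :: real. 0 :: ereal) = 0"
    by (rule tendsto_Lim) (simp_all add: trivial_limit_at_right_real)
  moreover have "{K :: 'm set. compact K \<and> interior K \<noteq> {}} \<noteq> {}"
    using comp by (intro ex_in_conv[THEN iffD1] exI[of _ UNIV]) simp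
  ultimately show "gurevic_entropy_at_infinity \<phi> = 0"
    unfolding gurevic_entropy_at_infinity_def out by simp
qed

text \<open>
  The closing lemma, applied near a point outside of a closed orbit, produces a second one.
\<close>

lemma second_closed_orbit:
  assumes p: "\<phi> \<theta> p = p" "0 < \<theta>" and "range (\<lambda>t. \<phi> t p) \<noteq> UNIV"
  obtains q \<theta>' where "\<phi> \<theta>' q = q" "0 < \<theta>'" "q \<notin> range (\<lambda>t. \<phi> t p)"
proof -
  let ?O = "range (\<lambda>t. \<phi> t p)"
  obtain w where w: "w \<notin> ?O" using assms(3) by blast
  have "open (- ?O)" by (rule open_Compl[OF compact_imp_closed[OF compact_periodic_orbit[OF p(2,1)]]])
  then obtain r where r: "r > 0" "ball w r \<subseteq> - ?O" using w openE[of "- ?O" w] by blast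
  define e where "e = r / 3"
  have e: "e > 0" using r by (simp add: e_def)
  have "\<exists>\<delta>>0. \<exists>Tmin>0. \<forall>y\<in>ball w e. \<forall>t\<ge>Tmin. dist (\<phi> t y) y \<le> \<delta> \<longrightarrow>
        (\<exists>z\<in>ball y e. \<exists>\<tau>\<in>{t - e..t + e}. \<phi> \<tau> z = z \<and> (\<forall>s\<in>{0..t}. dist (\<phi> s z) (\<phi> s y) \<le> e))"
    using closing e unfolding closing_lemma_def by blast
  then obtain \<delta> Tm where close: "\<delta> > 0" "\<forall>y\<in>ball w e. \<forall>t\<ge>Tm. dist (\<phi> t y) y \<le> \<delta> \<longrightarrow>
        (\<exists>z\<in>ball y e. \<exists>\<tau>\<in>{t - e..t + e}. \<phi> \<tau> z = z \<and> (\<forall>s\<in>{0..t}. dist (\<phi> s z) (\<phi> s y) \<le> e))"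
    by blast
  define \<rho> where "\<rho> = min e (\<delta> / 2)"
  have \<rho>: "\<rho> > 0" "\<rho> \<le> e" "\<rho> + \<rho> \<le> \<delta>" using e close(1) by (auto simp: \<rho>_def)
  have "\<exists>t\<ge>max Tm (e + 1). \<phi> t ` ball w \<rho> \<inter> ball w \<rho> \<noteq> {}"
    using transitive[unfolded transitive_flow_def, rule_format, of "ball w \<rho>" "ball w \<rho>" "max Tm (e + 1)"]
      \<rho>(1) e by simp
  then obtain t y where t: "t \<ge> max Tm (e + 1)" and y: "y \<in> ball w \<rho>" "\<phi> t y \<in> ball w \<rho>" by blast
  have "dist (\<phi> t y) y \<le> \<delta>" using y \<rho>(3) dist_triangle3[of "\<phi> t y" y w] by simp
  moreover have "y \<in> ball w e" using y(1) \<rho>(2) by simp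
  moreover have "t \<ge> Tm" using t by simp
  ultimately obtain z s where z: "z \<in> ball y e" "s \<in> {t - e..t + e}" "\<phi> s z = z"
    using close(2) by blast
  have "dist w z < r" using z(1) \<open>y \<in> ball w e\<close> dist_triangle[of w z y] r(1) unfolding mem_ball e_def by linarith
  then have "z \<notin> ?O" using r(2) by (metis ComplD mem_ball subsetD)
  moreover have "s > 0" using z(2) t by simp
  ultimately show ?thesis using z(3) by (intro that[of s z]) auto
qed

section \<open>Return times and the limit measure\<close>

lemma nn_integral_orbit_measure:
  assumes \<gamma>: "\<gamma> \<in> periodic_orbits \<phi>" and f: "continuous_on UNIV f" "\<And>x. 0 \<le> f x"
  shows "(\<integral>\<^sup>+x. ennreal (f x) \<partial>orbit_measure \<phi> \<gamma>) =
    ennreal (integral {0..period \<gamma>} (\<lambda>t. f (\<phi> t (orbit_point \<gamma>))) / period \<gamma>)"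
proof -
  let ?o = "orbit_point \<gamma>" and ?l = "period \<gamma>"
  have l: "?l > 0" by (rule periodic_orbitD(1)[OF \<gamma>])
  have [measurable]: "(\<lambda>t. \<phi> t ?o) \<in> borel_measurable borel"
    by (intro borel_measurable_continuous_onI continuous_intros)
  have [measurable]: "f \<in> borel_measurable borel" by (rule borel_measurable_continuous_onI[OF f(1)])
  have cont: "continuous_on {0..?l} (\<lambda>t. f (\<phi> t ?o))"
    by (intro continuous_on_compose2[OF f(1)] continuous_intros) auto
  have "(\<integral>\<^sup>+x. ennreal (f x) \<partial>orbit_measure \<phi> \<gamma>) =
      (\<integral>\<^sup>+t. ennreal (f (\<phi> t ?o)) \<partial>uniform_measure lborel {0..?l})"
    unfolding orbit_measure_def by (subst nn_integral_distr) simp_all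
  also have "\<dots> = (\<integral>\<^sup>+t. ennreal (f (\<phi> t ?o)) * indicator {0..?l} t \<partial>lborel) / ennreal ?l"
    using l by (subst nn_integral_uniform_measure) simp_all
  also have "(\<integral>\<^sup>+t. ennreal (f (\<phi> t ?o)) * indicator {0..?l} t \<partial>lborel) =
      ennreal (integral {0..?l} (\<lambda>t. f (\<phi> t ?o)))"
    using integrable_continuous_real[OF cont] f(2)
    by (intro nn_integral_has_integral_lebesgue') (auto simp: has_integral_integral)
  also have "\<dots> / ennreal ?l = ennreal (integral {0..?l} (\<lambda>t. f (\<phi> t ?o)) / ?l)"
    using l f(2) by (intro divide_ennreal integral_nonneg integrable_continuous_real[OF cont]) auto
  finally show ?thesis .
qed

lemma prob_space_orbit_measure:
  assumes "\<gamma> \<in> periodic_orbits \<phi>"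
  shows "prob_space (orbit_measure \<phi> \<gamma>)"
proof -
  have "(\<lambda>t. \<phi> t (orbit_point \<gamma>)) \<in> borel_measurable borel"
    by (intro borel_measurable_continuous_onI continuous_intros)
  moreover have "prob_space (uniform_measure lborel {0..period \<gamma>})"
    using periodic_orbitD(1)[OF assms] by (intro prob_space_uniform_measure) auto
  ultimately show ?thesis unfolding orbit_measure_def by (intro prob_space.prob_space_distr) simp_all
qed

lemma integral_mean_orbit_measure:
  fixes K :: "'m set" and L :: real and f :: "'m \<Rightarrow> real"
  defines "P \<equiv> orbits_through \<phi> K L (L + 5 * min_period \<phi> K)"
  assumes P: "finite P" "P \<noteq> {}" and f: "continuous_on UNIV f" "\<And>x. 0 \<le> f x"
  shows "integral\<^sup>L (mean_orbit_measure \<phi> K L) f =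
    (\<Sum>\<gamma>\<in>P. integral {0..period \<gamma>} (\<lambda>t. f (\<phi> t (orbit_point \<gamma>))) / period \<gamma>) / card P"
proof -
  have per: "\<gamma> \<in> periodic_orbits \<phi>" if "\<gamma> \<in> P" for \<gamma> using that by (simp add: P_def orbits_through_def)
  have card: "card P > 0" using P by (simp add: card_gt_0_iff)
  have nonneg: "0 \<le> integral {0..period \<gamma>} (\<lambda>t. f (\<phi> t (orbit_point \<gamma>))) / period \<gamma>" if \<gamma>: "\<gamma> \<in> P" for \<gamma>
  proof (rule divide_nonneg_pos)
    have "continuous_on {0..period \<gamma>} (\<lambda>t. f (\<phi> t (orbit_point \<gamma>)))"
      by (intro continuous_on_compose2[OF f(1)] continuous_intros) auto
    then show "0 \<le> integral {0..period \<gamma>} (\<lambda>t. f (\<phi> t (orbit_point \<gamma>)))"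
      using f(2) by (intro integral_nonneg integrable_continuous_real) auto
  qed (rule periodic_orbitD(1)[OF per[OF \<gamma>]])
  obtain \<gamma>0 where \<gamma>0: "\<gamma>0 \<in> P" using P(2) by blast
  \<comment> \<open>the mean is the distribution of a random point on a random orbit\<close>
  define N where "N \<gamma> = orbit_measure \<phi> (if \<gamma> \<in> P then \<gamma> else \<gamma>0)" for \<gamma>
  define Q where "Q = measure_pmf (pmf_of_set P)"
  have N: "N \<in> measurable Q (subprob_algebra borel)"
  proof -
    have "N \<gamma> \<in> space (subprob_algebra borel)" for \<gamma>
    proof -
      have "prob_space (N \<gamma>)" unfolding N_def using per \<gamma>0 by (intro prob_space_orbit_measure) simp
      moreover have "sets (N \<gamma>) = sets borel" by (simp add: N_def orbit_measure_def)
      ultimately show ?thesis by (simp add: space_subprob_algebra prob_space_imp_subprob_space)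
    qed
    then show ?thesis unfolding Q_def by simp
  qed
  have avg: "(\<integral>\<^sup>+\<gamma>. h \<gamma> \<partial>Q) = (\<Sum>\<gamma>\<in>P. h \<gamma>) / of_nat (card P)" for h
    unfolding Q_def using P by (simp add: nn_integral_pmf_of_set)
  have sets: "sets (Q \<bind> N) = sets borel"
    by (rule sets_bind) (simp_all add: N_def orbit_measure_def Q_def)
  have "mean_orbit_measure \<phi> K L = Q \<bind> N"
  proof -
    have "measure_of UNIV (sets borel) (\<lambda>A. (\<Sum>\<gamma>\<in>P. emeasure (orbit_measure \<phi> \<gamma>) A) / of_nat (card P)) =
        measure_of UNIV (sets borel) (emeasure (Q \<bind> N))"
    proof (rule measure_of_eq)
      fix A :: "'m set" assume "A \<in> sigma_sets UNIV (sets borel)"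
      then have "A \<in> sets borel" using sets.sigma_sets_eq[of "borel :: 'm measure"] by simp
      then have "emeasure (Q \<bind> N) A = (\<integral>\<^sup>+\<gamma>. emeasure (N \<gamma>) A \<partial>Q)"
        by (intro emeasure_bind[OF _ N]) (auto simp: Q_def)
      then show "(\<Sum>\<gamma>\<in>P. emeasure (orbit_measure \<phi> \<gamma>) A) / of_nat (card P) = emeasure (Q \<bind> N) A"
        by (simp add: avg N_def)
    qed simp
    also have "\<dots> = Q \<bind> N"
      using measure_of_of_measure[of "Q \<bind> N"] sets sets_eq_imp_space_eq[OF sets] by simp
    finally show ?thesis unfolding mean_orbit_measure_def Let_def P_def[symmetric] .
  qed
  then have "integral\<^sup>L (mean_orbit_measure \<phi> K L) f = integral\<^sup>L (Q \<bind> N) f" by simp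
  also have "\<dots> = enn2real (\<integral>\<^sup>+x. ennreal (f x) \<partial>(Q \<bind> N))"
  proof (rule integral_eq_nn_integral)
    show "f \<in> borel_measurable (Q \<bind> N)"
      using borel_measurable_continuous_onI[OF f(1)] measurable_cong_sets[OF sets refl] by blast
  qed (use f(2) in simp)
  also have "(\<integral>\<^sup>+x. ennreal (f x) \<partial>(Q \<bind> N)) = (\<integral>\<^sup>+\<gamma>. \<integral>\<^sup>+x. ennreal (f x) \<partial>N \<gamma> \<partial>Q)"
    by (rule nn_integral_bind[OF measurable_compose[OF borel_measurable_continuous_onI[OF f(1)] measurable_ennreal] N])
  also have "\<dots> = (\<Sum>\<gamma>\<in>P. \<integral>\<^sup>+x. ennreal (f x) \<partial>orbit_measure \<phi> \<gamma>) / of_nat (card P)"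
    by (simp add: avg N_def)
  also have "\<dots> = (\<Sum>\<gamma>\<in>P. ennreal (integral {0..period \<gamma>} (\<lambda>t. f (\<phi> t (orbit_point \<gamma>))) / period \<gamma>)) / of_nat (card P)"
    using per f by (simp add: nn_integral_orbit_measure)
  also have "\<dots> = ennreal ((\<Sum>\<gamma>\<in>P. integral {0..period \<gamma>} (\<lambda>t. f (\<phi> t (orbit_point \<gamma>))) / period \<gamma>) / card P)"
    using nonneg card by (simp add: sum_ennreal divide_ennreal sum_nonneg ennreal_of_nat_eq_real_of_nat)
  also have "enn2real \<dots> = (\<Sum>\<gamma>\<in>P. integral {0..period \<gamma>} (\<lambda>t. f (\<phi> t (orbit_point \<gamma>))) / period \<gamma>) / card P"
    by (intro enn2real_ennreal divide_nonneg_nonneg[OF sum_nonneg[OF nonneg]] of_nat_0_le_iff)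
  finally show ?thesis .
qed

lemma integral_mean_orbit_measure_trivial:
  fixes L :: real and f :: "'m \<Rightarrow> real"
  assumes "card (orbits_through \<phi> K L (L + 5 * min_period \<phi> K)) = 0"
  shows "integral\<^sup>L (mean_orbit_measure \<phi> K L) f = 0"
proof -
  have "mean_orbit_measure \<phi> K L = measure_of UNIV (sets borel) (\<lambda>_. 0)"
    using assms unfolding mean_orbit_measure_def Let_def by (auto simp: card_eq_0_iff)
  also have "\<dots> = null_measure borel" by (simp add: null_measure_def)
  finally show ?thesis by simp
qed

text \<open>
  On a closed orbit, a test function \<open>f\<close> that vanishes outside \<open>K\<close> satisfies
  \<open>2 \<integral> f - \<integral> max f (f \<circ> \<phi> T) = \<integral> min f (f \<circ> \<phi> T)\<close> for the integrals over one period, by invariance,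
  and the right-hand side is at most the measure of the return times. The maximum is used since it
  has compact support, so that the left-hand side passes to vague limits even if mass escapes to
  infinity.
\<close>

lemma return_times_lower_bound:
  assumes \<gamma>: "\<gamma> \<in> periodic_orbits \<phi>" and T: "0 \<le> T" "T \<le> period \<gamma>" and K: "compact K"
    and f: "continuous_on UNIV f" "\<And>x. 0 \<le> f x" "\<And>x. f x \<le> 1" "\<And>x. x \<notin> K \<Longrightarrow> f x = 0"
  shows "2 * integral {0..period \<gamma>} (\<lambda>t. f (\<phi> t (orbit_point \<gamma>)))
      - integral {0..period \<gamma>} (\<lambda>t. max (f (\<phi> t (orbit_point \<gamma>))) (f (\<phi> T (\<phi> t (orbit_point \<gamma>)))))
    \<le> measure lebesgue (return_times \<phi> T K \<gamma>)"
proof -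
  let ?o = "orbit_point \<gamma>" and ?l = "period \<gamma>" and ?R = "return_times \<phi> T K \<gamma>"
  define h where "h t = f (\<phi> t ?o)" for t
  have h: "continuous_on S h" for S
    unfolding h_def by (intro continuous_on_compose2[OF f(1)] continuous_intros) auto
  have h': "continuous_on S (\<lambda>t. h (t + T))" for S
    by (rule continuous_on_compose2[OF h[of UNIV]]) (auto intro!: continuous_intros)
  have "h (t + ?l) = h t" for t
    using periodic_orbitD(3)[OF \<gamma> periodic_orbitD(2)[OF \<gamma>]] by (simp add: h_def flow_add)
  then have shift: "integral {0..?l} (\<lambda>t. h (t + T)) = integral {0..?l} h"
    using h T by (intro integral_shift_periodic) auto
  have T': "f (\<phi> T (\<phi> t ?o)) = h (t + T)" for t by (simp add: h_def add.commute flip: flow_add)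
  have "closed K" by (rule compact_imp_closed[OF K])
  then have "closed ((\<lambda>t. \<phi> t ?o) -` K)" "closed ((\<lambda>t. \<phi> (T + t) ?o) -` K)"
    by (intro closed_vimage continuous_intros; assumption)+
  moreover have "?R = {0..?l} \<inter> ((\<lambda>t. \<phi> t ?o) -` K \<inter> (\<lambda>t. \<phi> (T + t) ?o) -` K)"
    by (auto simp: return_times_def)
  ultimately have "compact ?R" by (simp add: compact_Int_closed closed_Int)
  then have "(indicator ?R has_integral measure lebesgue ?R) UNIV"
    using lmeasurable_compact lmeasurable_iff_has_integral by blast
  moreover have "(indicator ?R :: real \<Rightarrow> real) = (\<lambda>t. if t \<in> {0..?l} then indicator ?R t else 0)"
    by (auto simp: return_times_def indicator_def)
  ultimately have R: "(indicator ?R has_integral measure lebesgue ?R) {0..?l}"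
    using has_integral_restrict_UNIV[of "{0..?l}" "indicator ?R :: real \<Rightarrow> real"] by simp
  have int: "h integrable_on {0..?l}" "(\<lambda>t. h (t + T)) integrable_on {0..?l}"
    "(\<lambda>t. max (h t) (h (t + T))) integrable_on {0..?l}"
    by (intro integrable_continuous_real continuous_intros h h')+
  have "2 * integral {0..?l} h - integral {0..?l} (\<lambda>t. max (h t) (h (t + T)))
      = integral {0..?l} (\<lambda>t. h t + h (t + T) - max (h t) (h (t + T)))"
    using int shift by (simp add: integral_add integral_diff integrable_add)
  also have "\<dots> \<le> integral {0..?l} (indicator ?R)"
  proof (rule integral_le)
    show "(\<lambda>t. h t + h (t + T) - max (h t) (h (t + T))) integrable_on {0..?l}"
      by (intro integrable_continuous_real continuous_intros h h')
    show "(indicator ?R :: real \<Rightarrow> real) integrable_on {0..?l}" using R by blast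
    fix t assume t: "t \<in> {0..?l}"
    show "h t + h (t + T) - max (h t) (h (t + T)) \<le> indicator ?R t"
    proof (cases "t \<in> ?R")
      case True
      then show ?thesis using f(3)[of "\<phi> t ?o"] f(3)[of "\<phi> (t + T) ?o"] by (simp add: h_def max_def)
    next
      case False
      then have "\<phi> t ?o \<notin> K \<or> \<phi> (t + T) ?o \<notin> K" using t by (auto simp: return_times_def add.commute)
      then have "h t = 0 \<or> h (t + T) = 0" using f(4) by (auto simp: h_def)
      then show ?thesis using False f(2) by (auto simp: h_def max_def)
    qed
  qed
  also have "\<dots> = measure lebesgue ?R" by (rule integral_unique[OF R])
  finally show ?thesis unfolding T' h_def[symmetric] .
qed

text \<open>
  The limit measure gives the interior of \<open>K\<close> more than two thirds of its mass, so a definite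
  proportion of the time, the same for all \<open>T\<close>, consists of return times.
\<close>

lemma frequent_returns:
  assumes m: "locally_finite_borel m" "emeasure m UNIV \<noteq> 0"
    and vague: "vaguely_converges (\<lambda>n. mean_orbit_measure \<phi> K\<^sub>0 (L n)) m"
    and L: "filterlim L at_top sequentially"
    and K: "compact K" "emeasure m (interior K) \<ge> ennreal (3 / 4) * emeasure m UNIV"
  obtains c :: real where "c > 0"
    and "\<And>T. 0 \<le> T \<Longrightarrow> \<forall>\<^sub>F n in sequentially.
      finite (orbits_through \<phi> K\<^sub>0 (L n) (L n + 5 * min_period \<phi> K\<^sub>0)) \<and>
      orbits_through \<phi> K\<^sub>0 (L n) (L n + 5 * min_period \<phi> K\<^sub>0) \<noteq> {} \<and>
      c * real (card (orbits_through \<phi> K\<^sub>0 (L n) (L n + 5 * min_period \<phi> K\<^sub>0)))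
        \<le> (\<Sum>\<gamma>\<in>orbits_through \<phi> K\<^sub>0 (L n) (L n + 5 * min_period \<phi> K\<^sub>0).
            measure lebesgue (return_times \<phi> T K \<gamma>) / period \<gamma>)"
proof -
  have sets: "sets m = sets borel" using m(1) by (simp add: locally_finite_borel_def)
  have sp: "space m = UNIV" using sets_eq_imp_space_eq[OF sets] by simp
  have "emeasure m (interior K) \<le> emeasure m K"
    using sets K(1) by (intro emeasure_mono interior_subset) (simp add: compact_imp_closed)
  also have "\<dots> < \<infinity>" using m(1) K(1) by (simp add: locally_finite_borel_def)
  finally have fin: "emeasure m UNIV \<noteq> \<infinity>"
    using K(2) by (auto simp: ennreal_mult_top)
  interpret finite_measure m by standard (use fin sp in simp)
  define c where "c = measure m UNIV"
  have c: "c > 0" using m(2) by (simp add: c_def emeasure_eq_measure zero_less_measure_iff)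
  have "3 / 4 * c \<le> measure m (interior K)"
    using K(2) unfolding emeasure_eq_measure c_def by (simp flip: ennreal_mult)
  then have "2 / 3 * c < measure m (interior K)" using c by simp
  then obtain f :: "'m \<Rightarrow> real" where f': "continuous_on UNIV f" "\<forall>x. 0 \<le> f x \<and> f x \<le> 1"
    "\<forall>x. x \<notin> interior K \<longrightarrow> f x = 0" "2 / 3 * c < integral\<^sup>L m f"
    by (rule bump_function_below_open[OF sets fin open_interior])
  then have f: "continuous_on UNIV f" "0 \<le> f x" "f x \<le> 1" "x \<notin> interior K \<Longrightarrow> f x = 0"
    "2 / 3 * c < integral\<^sup>L m f" for x by auto
  have f0: "f x = 0" if "x \<notin> K" for x using f(4) that interior_subset by blast
  show ?thesis
  proof (rule that[of "c / 6"])
    show "c / 6 > 0" using c by simp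
    fix T :: real assume T: "0 \<le> T"
    define g where "g x = max (f x) (f (\<phi> T x))" for x
    have cont: "continuous_on UNIV (\<lambda>x. f (\<phi> T x))"
      by (intro continuous_on_compose2[OF f(1)] continuous_intros) auto
    have g: "continuous_on UNIV g" "\<And>x. 0 \<le> g x" "\<And>x. g x \<le> 1"
      unfolding g_def using f(2,3) by (auto intro!: continuous_on_max f(1) cont simp: le_max_iff_disj)
    have KT: "compact (K \<union> \<phi> (- T) ` K)"
      by (intro compact_Un K(1) compact_continuous_image continuous_intros)
    have supp: "compact (closure S)" if "S \<subseteq> C" "compact C" for S C :: "'m set"
      using compact_Int_closed[OF that(2) closed_closure[of S]]
        closure_minimal[OF that(1) compact_imp_closed[OF that(2)]] by (simp add: inf.absorb2)
    have suppf: "compact (closure {x. f x \<noteq> 0})"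
    proof (rule supp)
      show "{x. f x \<noteq> 0} \<subseteq> K" using f0 by blast
    qed (rule K(1))
    have suppg: "compact (closure {x. g x \<noteq> 0})"
    proof (rule supp[OF _ KT])
      show "{x. g x \<noteq> 0} \<subseteq> K \<union> \<phi> (- T) ` K"
      proof
        fix x assume "x \<in> {x. g x \<noteq> 0}"
        then have "f x \<noteq> 0 \<or> f (\<phi> T x) \<noteq> 0" by (auto simp: g_def)
        moreover have "x = \<phi> (- T) (\<phi> T x)" by (simp flip: flow_add)
        ultimately show "x \<in> K \<union> \<phi> (- T) ` K" using f0 by blast
      qed
    qed
    let ?m = "\<lambda>n. mean_orbit_measure \<phi> K\<^sub>0 (L n)"
    have "(\<lambda>n. integral\<^sup>L (?m n) f) \<longlonglongrightarrow> integral\<^sup>L m f" "(\<lambda>n. integral\<^sup>L (?m n) g) \<longlonglongrightarrow> integral\<^sup>L m g"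
      using vague f(1) g(1) suppf suppg unfolding vaguely_converges_def by blast+
    then have "(\<lambda>n. 2 * integral\<^sup>L (?m n) f - integral\<^sup>L (?m n) g) \<longlonglongrightarrow> 2 * integral\<^sup>L m f - integral\<^sup>L m g"
      by (intro tendsto_intros)
    moreover have "integral\<^sup>L m g \<le> c"
    proof -
      have "g \<in> borel_measurable m"
        using borel_measurable_continuous_onI[OF g(1)] measurable_cong_sets[OF sets refl] by blast
      then have "integrable m g" using g(2,3) by (intro integrable_const_bound[where B = 1]) auto
      then have "integral\<^sup>L m g \<le> integral\<^sup>L m (\<lambda>_. 1)" using g(3) by (intro integral_mono) auto
      then show ?thesis using sp by (simp add: c_def)
    qed
    then have "c / 6 < 2 * integral\<^sup>L m f - integral\<^sup>L m g" using f(5) c by linarith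
    ultimately have ev: "\<forall>\<^sub>F n in sequentially. c / 6 < 2 * integral\<^sup>L (?m n) f - integral\<^sup>L (?m n) g"
      by (rule order_tendstoD)
    have "\<forall>\<^sub>F n in sequentially. max T 1 \<le> L n"
      using L unfolding filterlim_at_top by (rule spec)
    with ev show "\<forall>\<^sub>F n in sequentially.
      finite (orbits_through \<phi> K\<^sub>0 (L n) (L n + 5 * min_period \<phi> K\<^sub>0)) \<and>
      orbits_through \<phi> K\<^sub>0 (L n) (L n + 5 * min_period \<phi> K\<^sub>0) \<noteq> {} \<and>
      c / 6 * real (card (orbits_through \<phi> K\<^sub>0 (L n) (L n + 5 * min_period \<phi> K\<^sub>0)))
        \<le> (\<Sum>\<gamma>\<in>orbits_through \<phi> K\<^sub>0 (L n) (L n + 5 * min_period \<phi> K\<^sub>0).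
            measure lebesgue (return_times \<phi> T K \<gamma>) / period \<gamma>)"
    proof eventually_elim
      case (elim n)
      define P where "P = orbits_through \<phi> K\<^sub>0 (L n) (L n + 5 * min_period \<phi> K\<^sub>0)"
      have "card P \<noteq> 0"
      proof
        assume "card P = 0"
        then have "integral\<^sup>L (?m n) h = 0" for h :: "'m \<Rightarrow> real"
          unfolding P_def by (rule integral_mean_orbit_measure_trivial)
        with elim c show False by simp
      qed
      then have P: "finite P" "P \<noteq> {}" "card P > 0" by (auto simp: card_eq_0_iff card_gt_0_iff)
      let ?I = "\<lambda>h \<gamma>. integral {0..period \<gamma>} (\<lambda>t. h (\<phi> t (orbit_point \<gamma>))) :: real"
      have "c / 6 * card P \<le> (2 * integral\<^sup>L (?m n) f - integral\<^sup>L (?m n) g) * card P"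
        using elim(1) by (intro mult_right_mono) auto
      also have "\<dots> = 2 * (\<Sum>\<gamma>\<in>P. ?I f \<gamma> / period \<gamma>) - (\<Sum>\<gamma>\<in>P. ?I g \<gamma> / period \<gamma>)"
        using integral_mean_orbit_measure[of K\<^sub>0 "L n" f] integral_mean_orbit_measure[of K\<^sub>0 "L n" g]
          P f(1,2) g(1,2) unfolding P_def[symmetric] by (simp add: left_diff_distrib)
      also have "\<dots> = (\<Sum>\<gamma>\<in>P. (2 * ?I f \<gamma> - ?I g \<gamma>) / period \<gamma>)"
        by (simp add: sum_subtractf sum_distrib_left diff_divide_distrib)
      also have "\<dots> \<le> (\<Sum>\<gamma>\<in>P. measure lebesgue (return_times \<phi> T K \<gamma>) / period \<gamma>)"
      proof (rule sum_mono)
        fix \<gamma> assume "\<gamma> \<in> P"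
        then have \<gamma>: "\<gamma> \<in> periodic_orbits \<phi>" "L n \<le> period \<gamma>" by (auto simp: P_def orbits_through_def)
        have "2 * ?I f \<gamma> - ?I g \<gamma> \<le> measure lebesgue (return_times \<phi> T K \<gamma>)"
          unfolding g_def using elim(2) \<gamma>(2) T f0
          by (intro return_times_lower_bound[OF \<gamma>(1) _ _ K(1) f(1-3)]) auto
        then show "(2 * ?I f \<gamma> - ?I g \<gamma>) / period \<gamma> \<le> measure lebesgue (return_times \<phi> T K \<gamma>) / period \<gamma>"
          using periodic_orbitD(1)[OF \<gamma>(1)] by (intro divide_right_mono) auto
      qed
      finally show ?case using P unfolding P_def by blast
    qed
  qed
qed

end

section \<open>Splitting periodic orbits into two chords\<close>

theorem proposition6p5:
  fixes A :: "('m::complete_space, 'e::euclidean_space) chart set"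
    and G :: "('m, 'e) metric_tensor"
    and \<phi> :: "real \<Rightarrow> 'm \<Rightarrow> 'm"
    and K\<^sub>0 K :: "'m set"
    and \<epsilon> :: real
    and L :: "nat \<Rightarrow> real"
    and m :: "'m measure"
  assumes "complete_riemannian_manifold A G"
    and "H_flow A \<phi>"
    and "gurevic_entropy_at_infinity \<phi> < gurevic_entropy \<phi>"
    and "compact K\<^sub>0" and "interior K\<^sub>0 \<noteq> {}"
    and "\<epsilon> > 0"
    and "((\<lambda>l. real (card (orbits_rarely_in \<phi> K\<^sub>0 \<epsilon> l (l + 5 * min_period \<phi> K\<^sub>0)))
               / real (card (orbits_through \<phi> K\<^sub>0 l (l + 5 * min_period \<phi> K\<^sub>0)))) \<longlongrightarrow> 0) at_top"
    and "filterlim L at_top sequentially"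
    and "locally_finite_borel m"
    and "vaguely_converges (\<lambda>n. mean_orbit_measure \<phi> K\<^sub>0 (L n)) m"
    and "emeasure m UNIV \<noteq> 0"
    and "compact K" and "K\<^sub>0 \<subseteq> interior K"
    and "emeasure m (interior K) \<ge> ennreal (3 / 4) * emeasure m UNIV"
  shows "\<exists>\<epsilon>\<^sub>1>0. \<forall>\<eta> \<delta>. 0 < \<eta> \<and> \<eta> < \<delta> \<and> \<delta> < \<epsilon>\<^sub>1 / 4 \<longrightarrow>
    (\<exists>S\<^sub>2>0. \<exists>D\<^sub>2>0. \<forall>T>5 * min_period \<phi> K\<^sub>0. \<exists>k\<^sub>0::nat. \<forall>n\<ge>k\<^sub>0.
      \<forall>x\<^sub>0\<in>K. \<forall>y\<^sub>0\<in>K. \<forall>x\<^sub>1\<in>K. \<forall>y\<^sub>1\<in>K. \<forall>S\<ge>S\<^sub>2.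
        L n * real (card (orbits_through \<phi> K\<^sub>0 (L n) (L n + 5 * min_period \<phi> K\<^sub>0)))
          \<le> D\<^sub>2 * real (chord_number \<phi> x\<^sub>0 y\<^sub>0 \<eta> (T + S) (T + S + 5 * min_period \<phi> K\<^sub>0) \<delta>)
               * real (chord_number \<phi> x\<^sub>1 y\<^sub>1 \<eta> (L n - T + S)
                        (L n - T + S + 5 * min_period \<phi> K\<^sub>0) \<delta>))"
proof -
  have "smooth_atlas A" using assms(1) by (simp add: complete_riemannian_manifold_def)
  then interpret H_flow_on_lc \<phi>
    using assms(2) smooth_atlas_locally_compact[of A]
    by unfold_locales (auto simp: H_flow_def C1_flow_def)
  define W where "W = 5 * min_period \<phi> K\<^sub>0"
  define P where "P n = orbits_through \<phi> K\<^sub>0 (L n) (L n + W)" for n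
  obtain c :: real where c: "c > 0" and returns: "\<And>T. 0 \<le> T \<Longrightarrow> \<forall>\<^sub>F n in sequentially.
      finite (P n) \<and> P n \<noteq> {} \<and>
      c * real (card (P n)) \<le> (\<Sum>\<gamma>\<in>P n. measure lebesgue (return_times \<phi> T K \<gamma>) / period \<gamma>)"
    unfolding P_def W_def
    using frequent_returns[OF assms(9,11,10,8,12,14)] by blast
  \<comment> \<open>a closed orbit through \<open>K\<^sub>0\<close> whose period is at most the length of the window\<close>
  obtain p \<theta> where p: "p \<in> K" "\<phi> \<theta> p = p" "0 < \<theta>" "\<theta> \<le> W"
  proof -
    have "\<forall>\<^sub>F n in sequentially. 1 \<le> L n" using assms(8) unfolding filterlim_at_top by (rule spec)
    with returns[of 0] have "\<forall>\<^sub>F n in sequentially. P n \<noteq> {} \<and> 1 \<le> L n"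
      by (auto elim: eventually_elim2)
    then obtain n where n: "P n \<noteq> {}" "1 \<le> L n" using eventually_happens'[OF sequentially_bot] by blast
    then obtain \<gamma> where \<gamma>: "\<gamma> \<in> P n" by blast
    let ?T = "{period \<gamma> | \<gamma>. \<gamma> \<in> periodic_orbits \<phi> \<and> period \<gamma> \<ge> 1 \<and> fst \<gamma> \<inter> K\<^sub>0 \<noteq> {}}"
    have "\<gamma> \<in> periodic_orbits \<phi> \<and> period \<gamma> \<ge> 1 \<and> fst \<gamma> \<inter> K\<^sub>0 \<noteq> {}"
      using \<gamma> n(2) by (auto simp: P_def orbits_through_def)
    then have ne: "?T \<noteq> {}" by blast
    have "1 \<le> min_period \<phi> K\<^sub>0" unfolding min_period_def using ne by (intro cInf_greatest) auto
    then have "Inf ?T < W" using min_period_def[of \<phi> K\<^sub>0] by (simp add: W_def)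
    then obtain t where "t \<in> ?T" "t < W" using cInf_lessD[OF ne] by blast
    then obtain \<gamma>' where \<gamma>': "\<gamma>' \<in> periodic_orbits \<phi>" "period \<gamma>' < W" "fst \<gamma>' \<inter> K\<^sub>0 \<noteq> {}" by blast
    then obtain p where "p \<in> fst \<gamma>'" "p \<in> K\<^sub>0" by blast
    then show ?thesis
      using that[of p "period \<gamma>'"] periodic_orbitD(1,3)[OF \<gamma>'(1)] \<gamma>'(2) assms(13) interior_subset[of K]
      by force
  qed
  have W: "W > 0" using p by simp
  have "range (\<lambda>t. \<phi> t p) \<noteq> UNIV"
    using entropies_single_orbit[OF p(2,3)] assms(3) by auto
  then obtain q \<theta>' where q: "\<phi> \<theta>' q = q" "0 < \<theta>'" "q \<notin> range (\<lambda>t. \<phi> t p)"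
    by (rule second_closed_orbit[OF p(2,3)])
  obtain e1 where e1: "e1 > 0" "\<And>\<eta> \<delta>. \<lbrakk>0 < \<eta>; \<eta> < \<delta>; 4 * \<delta> \<le> e1\<rbrakk> \<Longrightarrow> \<exists>S\<^sub>2>0. \<exists>D\<ge>0.
    \<forall>T\<ge>0. \<forall>H\<ge>max T 2. \<forall>x\<^sub>0\<in>K. \<forall>y\<^sub>0\<in>K. \<forall>x\<^sub>1\<in>K. \<forall>y\<^sub>1\<in>K. \<forall>S\<ge>S\<^sub>2. \<forall>P. finite P \<longrightarrow>
      P \<subseteq> {\<gamma> \<in> periodic_orbits \<phi>. period \<gamma> \<in> {H..H + W} \<and> primitive_orbit \<phi> \<gamma>} \<longrightarrow>
      (\<Sum>\<gamma>\<in>P. measure lebesgue (return_times \<phi> T K \<gamma>))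
        \<le> D * real (chord_number \<phi> x\<^sub>0 y\<^sub>0 \<eta> (T + S) (T + S + W) \<delta>)
            * real (chord_number \<phi> x\<^sub>1 y\<^sub>1 \<eta> (H - T + S) (H - T + S + W) \<delta>)"
    using primitive_orbits_return_times[OF assms(12) p] by blast
  obtain e2 where e2: "e2 > 0" "\<And>\<eta> \<delta>. \<lbrakk>0 < \<eta>; \<eta> < \<delta>; 4 * \<delta> \<le> e2\<rbrakk> \<Longrightarrow> \<exists>S\<^sub>2>0. \<exists>D\<ge>0.
    \<forall>T\<ge>0. \<forall>H\<ge>4 * T + 2 * W + 1. \<forall>x\<^sub>1\<in>K. \<forall>y\<^sub>1\<in>K. \<forall>S\<ge>S\<^sub>2. \<forall>P. finite P \<longrightarrow>
      P \<subseteq> {\<gamma> \<in> orbits_through \<phi> K H (H + W). \<not> primitive_orbit \<phi> \<gamma>} \<longrightarrow>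
      H * real (card P) \<le> D * real (chord_number \<phi> x\<^sub>1 y\<^sub>1 \<eta> (H - T + S) (H - T + S + W) \<delta>)"
    using multiple_orbits_count[OF assms(12) p q] by blast
  obtain e3 where e3: "e3 > 0" "\<And>\<eta> \<delta>. \<lbrakk>0 < \<eta>; \<eta> < \<delta>; 4 * \<delta> \<le> e3\<rbrakk> \<Longrightarrow> \<exists>S\<^sub>2>0.
    \<forall>x\<^sub>0\<in>K. \<forall>y\<^sub>0\<in>K. \<forall>S\<ge>S\<^sub>2. \<forall>T\<ge>0. 1 \<le> chord_number \<phi> x\<^sub>0 y\<^sub>0 \<eta> (T + S) (T + S + W) \<delta>"
    using chord_number_pos[OF assms(12) p] by blast
  show ?thesis
    unfolding W_def[symmetric] P_def[symmetric]
  proof (rule exI[of _ "min e1 (min e2 e3)"], intro conjI allI impI)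
    show "min e1 (min e2 e3) > 0" using e1(1) e2(1) e3(1) by simp
    fix \<eta> \<delta> assume "0 < \<eta> \<and> \<eta> < \<delta> \<and> \<delta> < min e1 (min e2 e3) / 4"
    then have \<eta>: "0 < \<eta>" "\<eta> < \<delta>" "4 * \<delta> \<le> e1" "4 * \<delta> \<le> e2" "4 * \<delta> \<le> e3" by auto
    obtain S1 D1 where 1: "S1 > 0" "D1 \<ge> 0" and prim: "\<forall>T\<ge>0. \<forall>H\<ge>max T 2.
      \<forall>x\<^sub>0\<in>K. \<forall>y\<^sub>0\<in>K. \<forall>x\<^sub>1\<in>K. \<forall>y\<^sub>1\<in>K. \<forall>S\<ge>S1. \<forall>P. finite P \<longrightarrow>
      P \<subseteq> {\<gamma> \<in> periodic_orbits \<phi>. period \<gamma> \<in> {H..H + W} \<and> primitive_orbit \<phi> \<gamma>} \<longrightarrow>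
      (\<Sum>\<gamma>\<in>P. measure lebesgue (return_times \<phi> T K \<gamma>))
        \<le> D1 * real (chord_number \<phi> x\<^sub>0 y\<^sub>0 \<eta> (T + S) (T + S + W) \<delta>)
            * real (chord_number \<phi> x\<^sub>1 y\<^sub>1 \<eta> (H - T + S) (H - T + S + W) \<delta>)"
      using e1(2)[OF \<eta>(1,2,3)] by (elim exE conjE)
    obtain S2 D2 where 2: "S2 > 0" "D2 \<ge> 0" and mult: "\<forall>T\<ge>0. \<forall>H\<ge>4 * T + 2 * W + 1.
      \<forall>x\<^sub>1\<in>K. \<forall>y\<^sub>1\<in>K. \<forall>S\<ge>S2. \<forall>P. finite P \<longrightarrow>
      P \<subseteq> {\<gamma> \<in> orbits_through \<phi> K H (H + W). \<not> primitive_orbit \<phi> \<gamma>} \<longrightarrow>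
      H * real (card P) \<le> D2 * real (chord_number \<phi> x\<^sub>1 y\<^sub>1 \<eta> (H - T + S) (H - T + S + W) \<delta>)"
      using e2(2)[OF \<eta>(1,2,4)] by (elim exE conjE)
    obtain S3 where 3: "S3 > 0" and pos: "\<forall>x\<^sub>0\<in>K. \<forall>y\<^sub>0\<in>K. \<forall>S\<ge>S3. \<forall>T\<ge>0.
      1 \<le> chord_number \<phi> x\<^sub>0 y\<^sub>0 \<eta> (T + S) (T + S + W) \<delta>"
      using e3(2)[OF \<eta>(1,2,5)] by (elim exE conjE)
    show "\<exists>S\<^sub>2>0. \<exists>D\<^sub>2>0. \<forall>T>W. \<exists>k\<^sub>0::nat. \<forall>n\<ge>k\<^sub>0.
      \<forall>x\<^sub>0\<in>K. \<forall>y\<^sub>0\<in>K. \<forall>x\<^sub>1\<in>K. \<forall>y\<^sub>1\<in>K. \<forall>S\<ge>S\<^sub>2.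
        L n * real (card (P n))
          \<le> D\<^sub>2 * real (chord_number \<phi> x\<^sub>0 y\<^sub>0 \<eta> (T + S) (T + S + W) \<delta>)
               * real (chord_number \<phi> x\<^sub>1 y\<^sub>1 \<eta> (L n - T + S) (L n - T + S + W) \<delta>)"
    proof (rule exI[of _ "max S1 (max S2 S3)"], rule conjI, use 1(1) in simp,
        rule exI[of _ "(D1 + D2 + 1) / c"], intro conjI allI impI)
      show "(D1 + D2 + 1) / c > 0" using 1 2 c by simp
      fix T assume "T > W"
      then have T: "0 \<le> T" using W by simp
      have "\<forall>\<^sub>F n in sequentially. 4 * T + 2 * W + 2 \<le> L n"
        using assms(8) unfolding filterlim_at_top by (rule spec)
      with returns[OF T] have "\<forall>\<^sub>F n in sequentially. finite (P n) \<and> 4 * T + 2 * W + 2 \<le> L n \<and>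
          c * real (card (P n)) \<le> (\<Sum>\<gamma>\<in>P n. measure lebesgue (return_times \<phi> T K \<gamma>) / period \<gamma>)"
        by eventually_elim simp
      then obtain k0 where k0: "\<And>n. n \<ge> k0 \<Longrightarrow> finite (P n) \<and> 4 * T + 2 * W + 2 \<le> L n \<and>
          c * real (card (P n)) \<le> (\<Sum>\<gamma>\<in>P n. measure lebesgue (return_times \<phi> T K \<gamma>) / period \<gamma>)"
        unfolding eventually_sequentially by blast
      show "\<exists>k\<^sub>0::nat. \<forall>n\<ge>k\<^sub>0. \<forall>x\<^sub>0\<in>K. \<forall>y\<^sub>0\<in>K. \<forall>x\<^sub>1\<in>K. \<forall>y\<^sub>1\<in>K. \<forall>S\<ge>max S1 (max S2 S3).
        L n * real (card (P n))
          \<le> (D1 + D2 + 1) / c * real (chord_number \<phi> x\<^sub>0 y\<^sub>0 \<eta> (T + S) (T + S + W) \<delta>)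
               * real (chord_number \<phi> x\<^sub>1 y\<^sub>1 \<eta> (L n - T + S) (L n - T + S + W) \<delta>)"
      proof (rule exI[of _ k0], intro allI impI ballI)
        fix n x0 y0 x1 y1 S
        assume n: "k0 \<le> n" and xy: "x0 \<in> K" "y0 \<in> K" "x1 \<in> K" "y1 \<in> K" and S: "max S1 (max S2 S3) \<le> S"
        have fin: "finite (P n)" and Ln: "4 * T + 2 * W + 2 \<le> L n"
          and ret: "c * real (card (P n)) \<le> (\<Sum>\<gamma>\<in>P n. measure lebesgue (return_times \<phi> T K \<gamma>) / period \<gamma>)"
          using k0[OF n] by auto
        have Ln': "L n \<ge> max T 2" "L n > 0" "L n \<ge> 4 * T + 2 * W + 1" using Ln T W by auto
        define N0 where "N0 = real (chord_number \<phi> x0 y0 \<eta> (T + S) (T + S + W) \<delta>)"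
        define N1 where "N1 = real (chord_number \<phi> x1 y1 \<eta> (L n - T + S) (L n - T + S + W) \<delta>)"
        define P1 where "P1 = {\<gamma> \<in> P n. primitive_orbit \<phi> \<gamma>}"
        define P2 where "P2 = {\<gamma> \<in> P n. \<not> primitive_orbit \<phi> \<gamma>}"
        let ?R = "\<lambda>\<gamma>. measure lebesgue (return_times \<phi> T K \<gamma>)"
        have N: "1 \<le> N0" "0 \<le> N1" using pos xy S T by (auto simp: N0_def N1_def)
        have split: "P n = P1 \<union> P2" "P1 \<inter> P2 = {}" "finite P1" "finite P2"
          using fin by (auto simp: P1_def P2_def)
        have per: "\<gamma> \<in> periodic_orbits \<phi>" "L n \<le> period \<gamma>" if "\<gamma> \<in> P n" for \<gamma>
          using that by (auto simp: P_def orbits_through_def)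
        have R1: "?R \<gamma> / period \<gamma> \<le> ?R \<gamma> / L n" if "\<gamma> \<in> P1" for \<gamma>
          using per[of \<gamma>] that Ln'(2) by (intro divide_left_mono) (auto simp: P1_def intro!: mult_pos_pos)
        have R2: "?R \<gamma> / period \<gamma> \<le> 1" if "\<gamma> \<in> P2" for \<gamma>
        proof -
          have "period \<gamma> > 0" using per[of \<gamma>] that Ln'(2) by (auto simp: P2_def)
          moreover have "?R \<gamma> \<le> period \<gamma>"
          proof (cases "return_times \<phi> T K \<gamma> \<in> sets lebesgue")
            case True
            then have "?R \<gamma> \<le> measure lebesgue {0..period \<gamma>}"
              by (intro measure_mono_fmeasurable) (auto simp: return_times_def)
            then show ?thesis using \<open>period \<gamma> > 0\<close> by simp
          next
            case False
            then show ?thesis using \<open>period \<gamma> > 0\<close> by (simp add: measure_notin_sets)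
          qed
          ultimately show ?thesis by simp
        qed
        have "c * real (card (P n)) \<le> (\<Sum>\<gamma>\<in>P1. ?R \<gamma> / period \<gamma>) + (\<Sum>\<gamma>\<in>P2. ?R \<gamma> / period \<gamma>)"
          using ret unfolding split(1) by (simp add: sum.union_disjoint split)
        also have "\<dots> \<le> (\<Sum>\<gamma>\<in>P1. ?R \<gamma> / L n) + (\<Sum>\<gamma>\<in>P2. 1)"
          by (intro add_mono sum_mono R1 R2)
        also have "\<dots> = (\<Sum>\<gamma>\<in>P1. ?R \<gamma>) / L n + real (card P2)" by (simp add: sum_divide_distrib)
        finally have "c * real (card (P n)) \<le> (\<Sum>\<gamma>\<in>P1. ?R \<gamma>) / L n + real (card P2)" .
        then have "L n * (c * real (card (P n))) \<le> L n * ((\<Sum>\<gamma>\<in>P1. ?R \<gamma>) / L n + real (card P2))"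
          using Ln'(2) by (intro mult_left_mono) auto
        then have "c * (L n * real (card (P n))) \<le> (\<Sum>\<gamma>\<in>P1. ?R \<gamma>) + L n * real (card P2)"
          using Ln'(2) by (simp add: distrib_left mult.left_commute)
        moreover have "(\<Sum>\<gamma>\<in>P1. ?R \<gamma>) \<le> D1 * N0 * N1"
        proof -
          have "P1 \<subseteq> {\<gamma> \<in> periodic_orbits \<phi>. period \<gamma> \<in> {L n..L n + W} \<and> primitive_orbit \<phi> \<gamma>}"
            by (auto simp: P1_def P_def orbits_through_def)
          then show ?thesis using prim T Ln'(1) xy S split(3) unfolding N0_def N1_def by auto
        qed
        moreover have "L n * real (card P2) \<le> D2 * N0 * N1"
        proof -
          have "P2 \<subseteq> {\<gamma> \<in> orbits_through \<phi> K (L n) (L n + W). \<not> primitive_orbit \<phi> \<gamma>}"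
            using assms(13) interior_subset[of K] by (auto simp: P2_def P_def orbits_through_def)
          then have "L n * real (card P2) \<le> D2 * N1"
            using mult T Ln'(3) xy S split(4) unfolding N1_def by auto
          also have "\<dots> \<le> D2 * N1 * N0" using N 2(2) mult_left_mono[of 1 N0 "D2 * N1"] by simp
          finally show ?thesis by (simp add: mult_ac)
        qed
        ultimately have "c * (L n * real (card (P n))) \<le> (D1 + D2) * (N0 * N1)" by (simp add: algebra_simps)
        also have "\<dots> \<le> (D1 + D2 + 1) * (N0 * N1)" using N by (intro mult_right_mono) auto
        finally show "L n * real (card (P n)) \<le> (D1 + D2 + 1) / c * real (chord_number \<phi> x0 y0 \<eta> (T + S) (T + S + W) \<delta>)
               * real (chord_number \<phi> x1 y1 \<eta> (L n - T + S) (L n - T + S + W) \<delta>)"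
          unfolding N0_def[symmetric] N1_def[symmetric] using c by (simp add: field_simps)
      qed
    qed
  qed
qed

end
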